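(* Let $\mathcal{G}$ be a locally compact étale groupoid. A $\mathcal{G}$-equivariant operator $T\in\mathcal{L}(L^2(\mathcal{G}))$ is compactly supported if and only if $T$ belongs to the image $\Lambda(C_c(\mathcal{G}))$ of $C_c(\mathcal{G})$ under the left regular representation. Hence the reduced groupoid $C^*$-algebra $C_r^*(\mathcal{G})$ (identified with its image under the faithful representation $\Lambda$) is the norm closure in $\mathcal{L}(L^2(\mathcal{G}))$ of the set of all $\mathcal{G}$-equivariant compactly supported operators.
   Context: Locally compact spaces are assumed Hausdorff. A locally compact étale groupoid $\mathcal{G}$ is a topological groupoid with locally compact topology whose range map $\mathrm{r}$ (hence source map $\mathrm{s}$) is a local homeomorphism; $\mathcal{G}^{(0)}$ is its unit space and $\mathcal{G}_x=\mathrm{s}^{-1}(x)$ (discrete). For $A,B\subseteq\mathcal{G}$, $A\cdot B=\{\alpha\beta:\alpha\in A,\beta\in B,\mathrm{s}(\alpha)=\mathrm{r}(\beta)\}$. $C_b(\mathcal{G})$ is the set of bounded continuous complex functions. $L^2(\mathcal{G})$ is the Hilbert $C_0(\mathcal{G}^{(0)})$-module obtained by completing $C_c(\mathcal{G})$ for $\langle\eta,\xi\rangle(x)=\sum_{\gamma\in\mathcal{G}_x}\overline{\eta(\gamma)}\xi(\gamma)$, with $(\xi f)(\gamma)=\xi(\gamma)f(\mathrm{s}(\gamma))$; its elements are regarded as functions in $C_0(\mathcal{G})$. $\mathcal{L}(L^2(\mathcal{G}))$ is the $C^*$-algebra of adjointable operators. $g\in C_b(\mathcal{G})$ acts on $L^2(\mathcal{G})$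 by pointwise multiplication, also denoted $g$. The left regular representation $\Lambda:C_c(\mathcal{G})\to\mathcal{L}(L^2(\mathcal{G}))$ is $(\Lambda(f)\xi)(\gamma)=\sum_{\alpha\in\mathcal{G}_{\mathrm{s}(\gamma)}}f(\gamma\alpha^{-1})\xi(\alpha)$. $C_r^*(\mathcal{G})$ is the completion of the $*$-algebra $C_c(\mathcal{G})$ (convolution product, $f^*(\gamma)=\overline{f(\gamma^{-1})}$) for the norm $\|f\|_r=\|\Lambda(f)\|$; $\Lambda$ extends to a faithful representation of it. For $g\in C_c(\mathcal{G})$, $\rho(g)$ is the bounded linear operator on the Banach space $L^2(\mathcal{G})$ given by $(\rho(g)\xi)(\gamma)=\sum_{\beta\in\mathcal{G}_{\mathrm{s}(\gamma)}}g(\beta)\xi(\gamma\beta^{-1})$. $T\in\mathcal{L}(L^2(\mathcal{G}))$ is $\mathcal{G}$-equivariant if $T\rho(g)=\rho(g)T$ for all $g\in C_c(\mathcal{G})$. For $K\subseteq\mathcal{G}$, functions $f,g\in C_b(\mathcal{G})$ are $K$-separated if $(K\cdot\mathrm{supp}(f))\cap\mathrm{supp}(g)=\emptyset$ and $\mathrm{supp}(f)\cap(K\cdot\mathrm{supp}(g))=\emptyset$. $T\in\mathcal{L}(L^2(\mathcal{G}))$ is compactly supported if there is a compact $K\subseteq\mathcal{G}$ such that $gTf=0$ for all $K$-separated $f,g\in C_b(\mathcal{G})$. *)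

theory Defs
  imports "HOL-Analysis.Analysis"
begin

text \<open>The arrows of a groupoid are the elements of a type, which also carries its topology. The
  units are identified with the identity arrows, and the value of the composition is only
  meaningful on composable pairs.\<close>

record 'g groupoid =
  rng :: "'g \<Rightarrow> 'g"
  src :: "'g \<Rightarrow> 'g"
  comp :: "'g \<Rightarrow> 'g \<Rightarrow> 'g"
  ginv :: "'g \<Rightarrow> 'g"

definition units :: "'g groupoid \<Rightarrow> 'g set"
  where "units G = range (rng G)"

definition composable :: "'g groupoid \<Rightarrow> ('g \<times> 'g) set"
  where "composable G = {(a, b). src G a = rng G b}"

definition fiber :: "'g groupoid \<Rightarrow> 'g \<Rightarrow> 'g set"
  where "fiber G x = {a. src G a = x}"

definition set_comp :: "'g groupoid \<Rightarrow> 'g set \<Rightarrow> 'g set \<Rightarrow> 'g set"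
  where "set_comp G A B = {comp G a b | a b. a \<in> A \<and> b \<in> B \<and> (a, b) \<in> composable G}"

locale groupoid =
  fixes G :: "'g groupoid"
  assumes rng_src: "rng G (src G a) = src G a"
    and src_rng: "src G (rng G a) = rng G a"
    and rng_comp: "(a, b) \<in> composable G \<Longrightarrow> rng G (comp G a b) = rng G a"
    and src_comp: "(a, b) \<in> composable G \<Longrightarrow> src G (comp G a b) = src G b"
    and comp_assoc: "(a, b) \<in> composable G \<Longrightarrow> (b, c) \<in> composable G \<Longrightarrow>
          comp G (comp G a b) c = comp G a (comp G b c)"
    and unit_left: "comp G (rng G a) a = a"
    and unit_right: "comp G a (src G a) = a"
    and rng_inv: "rng G (ginv G a) = src G a"
    and src_inv: "src G (ginv G a) = rng G a"
    and inv_left: "comp G (ginv G a) a = src G a"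
    and inv_right: "comp G a (ginv G a) = rng G a"

definition local_homeomorphism_onto ::
    "('a::topological_space \<Rightarrow> 'b::topological_space) \<Rightarrow> 'b set \<Rightarrow> bool"
  where "local_homeomorphism_onto f S \<longleftrightarrow>
    (\<forall>x. \<exists>U. open U \<and> x \<in> U \<and> openin (top_of_set S) (f ` U) \<and>
         (\<exists>h. homeomorphism U (f ` U) f h))"

locale etale_groupoid = groupoid G for G :: "'g::t2_space groupoid" +
  assumes locally_compact: "locally_compact_space (euclidean :: 'g topology)"
    and continuous_comp: "continuous_on (composable G) (\<lambda>(a, b). comp G a b)"
    and continuous_inv: "continuous_on UNIV (ginv G)"
    and etale: "local_homeomorphism_onto (rng G) (units G)"


definition supp :: "('g::topological_space \<Rightarrow> complex) \<Rightarrow> 'g set"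
  where "supp f = closure {a. f a \<noteq> 0}"

definition Cc :: "('g::topological_space \<Rightarrow> complex) set"
  where "Cc = {f. continuous_on UNIV f \<and> compact (supp f)}"

definition Cb :: "('g::topological_space \<Rightarrow> complex) set"
  where "Cb = {f. continuous_on UNIV f \<and> bounded (range f)}"


definition l2_inner ::
    "'g groupoid \<Rightarrow> ('g \<Rightarrow> complex) \<Rightarrow> ('g \<Rightarrow> complex) \<Rightarrow> 'g \<Rightarrow> complex"
  where "l2_inner G \<eta> \<xi> x = (\<Sum>\<^sub>\<infinity>a\<in>fiber G x. cnj (\<eta> a) * \<xi> a)"

definition l2_norm :: "'g groupoid \<Rightarrow> ('g \<Rightarrow> complex) \<Rightarrow> real"
  where "l2_norm G \<xi> = sqrt (SUP x\<in>units G. cmod (l2_inner G \<xi> \<xi> x))"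

definition fiberwise_l2 :: "'g groupoid \<Rightarrow> ('g \<Rightarrow> complex) set"
  where "fiberwise_l2 G = {\<xi>.
    (\<forall>x\<in>units G. (\<lambda>a. (cmod (\<xi> a))\<^sup>2) summable_on fiber G x) \<and>
    bdd_above ((\<lambda>x. \<Sum>\<^sub>\<infinity>a\<in>fiber G x. (cmod (\<xi> a))\<^sup>2) ` units G)}"

text \<open>The functions with uniformly bounded \<open>\<ell>\<^sup>2\<close> norms on the source fibers form a Banach space
  under \<^const>\<open>l2_norm\<close>. The completion of \<^const>\<open>Cc\<close>, with its elements regarded as functions,
  is therefore the closure of \<^const>\<open>Cc\<close> in that space. As \<^const>\<open>l2_norm\<close> dominates the supremum
  norm, this closure consists of continuous functions vanishing at infinity.\<close>

definition L2 :: "'g::topological_space groupoid \<Rightarrow> ('g \<Rightarrow> complex) set"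
  where "L2 G = {\<xi> \<in> fiberwise_l2 G.
    \<exists>\<eta>. (\<forall>n. \<eta> n \<in> Cc) \<and> (\<lambda>n. l2_norm G (\<lambda>a. \<xi> a - \<eta> n a)) \<longlonglongrightarrow> 0}"


text \<open>Operators are extensional functions on \<^const>\<open>L2\<close>, so that equality of operators is
  equality in the logic. Linearity and boundedness of a map that has an adjoint are
  automatic, so \<open>op_norm\<close> is a supremum of a bounded set on \<open>adjointable\<close>.\<close>

type_synonym 'g operator = "('g \<Rightarrow> complex) \<Rightarrow> ('g \<Rightarrow> complex)"

definition adjointable :: "'g::topological_space groupoid \<Rightarrow> 'g operator set"
  where "adjointable G = {T \<in> L2 G \<rightarrow>\<^sub>E L2 G.
    \<exists>S \<in> L2 G \<rightarrow>\<^sub>E L2 G. \<forall>\<eta>\<in>L2 G. \<forall>\<xi>\<in>L2 G. l2_inner G \<eta> (T \<xi>) = l2_inner G (S \<eta>) \<xi>}"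

definition op_norm :: "'g::topological_space groupoid \<Rightarrow> 'g operator \<Rightarrow> real"
  where "op_norm G T = (SUP \<xi>\<in>{\<xi> \<in> L2 G. l2_norm G \<xi> \<le> 1}. l2_norm G (T \<xi>))"

definition op_diff ::
    "'g::topological_space groupoid \<Rightarrow> 'g operator \<Rightarrow> 'g operator \<Rightarrow> 'g operator"
  where "op_diff G T S = (\<lambda>\<xi>\<in>L2 G. \<lambda>a. T \<xi> a - S \<xi> a)"

definition norm_closure :: "'g::topological_space groupoid \<Rightarrow> 'g operator set \<Rightarrow> 'g operator set"
  where "norm_closure G A =
    {T \<in> adjointable G. \<forall>\<epsilon>>0. \<exists>S\<in>A. op_norm G (op_diff G T S) < \<epsilon>}"

definition mult_op :: "'g::topological_space groupoid \<Rightarrow> ('g \<Rightarrow> complex) \<Rightarrow> 'g operator"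
  where "mult_op G g = (\<lambda>\<xi>\<in>L2 G. \<lambda>a. g a * \<xi> a)"

text \<open>For \<open>f \<in> Cc\<close> only finitely many terms of each of the following two sums are nonzero.\<close>

definition left_reg :: "'g::topological_space groupoid \<Rightarrow> ('g \<Rightarrow> complex) \<Rightarrow> 'g operator"
  where "left_reg G f = (\<lambda>\<xi>\<in>L2 G. \<lambda>c.
    \<Sum>\<^sub>\<infinity>a\<in>fiber G (src G c). f (comp G c (ginv G a)) * \<xi> a)"

definition right_op :: "'g::topological_space groupoid \<Rightarrow> ('g \<Rightarrow> complex) \<Rightarrow> 'g operator"
  where "right_op G f = (\<lambda>\<xi>\<in>L2 G. \<lambda>c.
    \<Sum>\<^sub>\<infinity>b\<in>fiber G (src G c). f b * \<xi> (comp G c (ginv G b)))"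

definition equivariant :: "'g::topological_space groupoid \<Rightarrow> 'g operator \<Rightarrow> bool"
  where "equivariant G T \<longleftrightarrow>
    (\<forall>g\<in>Cc. \<forall>\<xi>\<in>L2 G. T (right_op G g \<xi>) = right_op G g (T \<xi>))"

definition separated ::
    "'g::topological_space groupoid \<Rightarrow> 'g set \<Rightarrow> ('g \<Rightarrow> complex) \<Rightarrow> ('g \<Rightarrow> complex) \<Rightarrow> bool"
  where "separated G K f g \<longleftrightarrow>
    set_comp G K (supp f) \<inter> supp g = {} \<and> supp f \<inter> set_comp G K (supp g) = {}"

definition compactly_supported :: "'g::topological_space groupoid \<Rightarrow> 'g operator \<Rightarrow> bool"
  where "compactly_supported G T \<longleftrightarrow>
    (\<exists>K. compact K \<and> (\<forall>f\<in>Cb. \<forall>g\<in>Cb. separated G K f g \<longrightarrow>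
      (\<forall>\<xi>\<in>L2 G. mult_op G g (T (mult_op G f \<xi>)) = (\<lambda>_. 0))))"


text \<open>The underlying set of the reduced \<open>C\<^sup>*\<close>-algebra: equivalence classes of sequences in
  \<^const>\<open>Cc\<close> that are Cauchy for the reduced norm.\<close>

definition reduced_norm :: "'g::topological_space groupoid \<Rightarrow> ('g \<Rightarrow> complex) \<Rightarrow> real"
  where "reduced_norm G f = op_norm G (left_reg G f)"

definition reduced_Cauchy :: "'g::topological_space groupoid \<Rightarrow> (nat \<Rightarrow> 'g \<Rightarrow> complex) set"
  where "reduced_Cauchy G = {F. (\<forall>n. F n \<in> Cc) \<and>
    (\<forall>\<epsilon>>0. \<exists>N. \<forall>m\<ge>N. \<forall>n\<ge>N. reduced_norm G (\<lambda>a. F m a - F n a) < \<epsilon>)}"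

definition reduced_equiv ::
    "'g::topological_space groupoid \<Rightarrow> ((nat \<Rightarrow> 'g \<Rightarrow> complex) \<times> (nat \<Rightarrow> 'g \<Rightarrow> complex)) set"
  where "reduced_equiv G = {(E, F). E \<in> reduced_Cauchy G \<and> F \<in> reduced_Cauchy G \<and>
    (\<lambda>n. reduced_norm G (\<lambda>a. E n a - F n a)) \<longlonglongrightarrow> 0}"

definition reduced_Cstar ::
    "'g::topological_space groupoid \<Rightarrow> (nat \<Rightarrow> 'g \<Rightarrow> complex) set set"
  where "reduced_Cstar G = reduced_Cauchy G // reduced_equiv G"

text \<open>The extension of \<^const>\<open>left_reg\<close> by continuity.\<close>

definition left_reg_ext ::
    "'g::topological_space groupoid \<Rightarrow> (nat \<Rightarrow> 'g \<Rightarrow> complex) set \<Rightarrow> 'g operator"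
  where "left_reg_ext G X = (THE T. T \<in> adjointable G \<and>
    (\<forall>F\<in>X. (\<lambda>n. op_norm G (op_diff G T (left_reg G (F n)))) \<longlonglongrightarrow> 0))"

end

theory Submission
  imports Defs
begin

text \<open>The operators \<open>\<Lambda>(f)\<close> and \<open>\<rho>(g)\<close> are the one-sided convolutions \<open>\<xi> \<mapsto> f * \<xi>\<close> and
  \<open>\<xi> \<mapsto> \<xi> * g\<close>, so \<open>\<Lambda>(f)\<close> is equivariant by associativity, and it is supported in \<open>supp f\<close>.
  Conversely, let \<open>T\<close> be equivariant with compact support \<open>K\<close>. The unit space is open and closed, and for
  \<open>h \<in> C\<^sub>c(G\<^sup>0)\<close> convolution by \<open>h\<close> from the left and from the right is multiplication by \<open>h \<circ> r\<close> and
  \<open>h \<circ> s\<close>. Equivariance gives \<open>T h * k = T (h k) = T k * h\<close> for such \<open>h, k\<close>, so there is one continuous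
  function \<open>f\<close> with \<open>T h = f \<cdot> (h \<circ> s)\<close> for all \<open>h\<close>; it vanishes off \<open>K \<union> K\<inverse>\<close>. For \<open>\<xi> \<in> C\<^sub>c(G)\<close>
  choose \<open>h = 1\<close> on \<open>r(supp \<xi>)\<close>: then \<open>T \<xi> = T (h * \<xi>) = T h * \<xi> = f * \<xi>\<close>, and by density \<open>T = \<Lambda>(f)\<close>.

  The statement on \<open>C\<^sub>r\<^sup>*(G)\<close> then follows because adjointable operators are bounded and form a
  complete space.\<close>

subsection \<open>Compactly supported functions on an etale groupoid\<close>

text \<open>If the unit space is compact, \<open>f\<close> is simply \<open>T\<close> applied to its
  indicator function. In general that indicator is continuous but does not vanish at infinity, so it
  lies outside \<open>L2 G\<close> and \<open>T\<close> cannot be evaluated there. This is why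
  \<open>f\<close> is glued from the functions \<open>T h\<close> with compactly supported cut-offs
  \<open>h\<close>, and the commutation relation is what makes the pieces agree. The other obstacle
  is analytic. \<open>l2_norm\<close> and \<open>op_norm\<close> are suprema, which carry
  information only once a bound is known, and an adjointable operator is given merely by the
  existence of an adjoint. The estimates are therefore phrased by the relations \<open>l2_le\<close>
  and \<open>op_le\<close>, and the suprema are brought back through them. Boundedness of
  adjointable operators is extracted from the completeness of \<open>L2 G\<close> by a uniform
  boundedness argument. It is needed to pass from \<open>Cc\<close> to \<open>L2 G\<close> by
  density, and again to turn \<open>op_norm\<close> into a genuine norm for the closure
  statement.\<close>

lemma Hausdorff_space_t2: "Hausdorff_space (euclidean :: 'a::t2_space topology)"
  unfolding Hausdorff_space_def disjnt_def using hausdorff by (metis open_openin)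

text \<open>Finitely many open sets on which \<open>f\<close> is injective cover \<open>L\<close>. A
  fiber of \<open>f\<close> meets each of them at most once, so it embeds into the index set of the
  cover, whose size bounds all fibers at once.\<close>

lemma compact_locally_inj_card_bound:
  assumes "compact L" and loc: "\<And>x. \<exists>U. open U \<and> x \<in> U \<and> inj_on f U"
  shows "\<exists>N::nat. \<forall>y. finite {a \<in> L. f a = y} \<and> card {a \<in> L. f a = y} \<le> N"
proof -
  obtain U where U: "\<And>x. open (U x)" "\<And>x. x \<in> U x" "\<And>x. inj_on f (U x)"
    using loc by metis
  obtain D where D: "D \<subseteq> L" "finite D" "L \<subseteq> (\<Union>x\<in>D. U x)"
    by (rule compactE_image[OF \<open>compact L\<close>, of L U]) (use U in auto)
  show ?thesis
  proof (intro exI allI)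
    fix y
    define h where "h a = (SOME x. x \<in> D \<and> a \<in> U x)" for a
    have h: "h a \<in> D \<and> a \<in> U (h a)" if "a \<in> L" for a
      unfolding h_def by (rule someI_ex) (use that D in auto)
    have inj: "inj_on h {a \<in> L. f a = y}"
    proof (rule inj_onI)
      fix a b assume ab: "a \<in> {a \<in> L. f a = y}" "b \<in> {a \<in> L. f a = y}" "h a = h b"
      then have "a \<in> U (h a)" "b \<in> U (h a)" using h[of a] h[of b] by auto
      with ab U(3)[of "h a"] show "a = b" by (auto dest: inj_onD)
    qed
    have sub: "h ` {a \<in> L. f a = y} \<subseteq> D" using h by auto
    show "finite {a \<in> L. f a = y} \<and> card {a \<in> L. f a = y} \<le> card D"
      using inj sub D(2) by (meson card_inj_on_le inj_on_finite)
  qed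
qed

lemma zero_outside_supp: "a \<notin> supp f \<Longrightarrow> f a = 0"
  unfolding supp_def using closure_subset[of "{a. f a \<noteq> 0}"] by auto

lemma supp_subset: "closed S \<Longrightarrow> (\<And>a. f a \<noteq> 0 \<Longrightarrow> a \<in> S) \<Longrightarrow> supp f \<subseteq> S"
  unfolding supp_def by (rule closure_minimal) auto

lemma CcI:
  fixes f :: "'a::t2_space \<Rightarrow> complex"
  assumes "continuous_on UNIV f" "compact L" "\<And>a. f a \<noteq> 0 \<Longrightarrow> a \<in> L"
  shows "f \<in> Cc"
proof -
  have "supp f \<subseteq> L" using assms by (intro supp_subset compact_imp_closed)
  then have "compact (supp f)"
    using compact_Int_closed[OF \<open>compact L\<close>, of "supp f"] by (simp add: supp_def Int_absorb1)
  with assms show ?thesis by (simp add: Cc_def)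
qed

lemma Cc_continuous: "f \<in> Cc \<Longrightarrow> continuous_on UNIV f"
  and Cc_compact_supp: "f \<in> Cc \<Longrightarrow> compact (supp f)"
  by (auto simp: Cc_def)

lemma Cc_bounded:
  assumes "f \<in> Cc"
  obtains M where "M \<ge> 0" "\<And>a. cmod (f a) \<le> M"
proof -
  have "compact (f ` supp f)"
    using assms by (meson Cc_compact_supp Cc_continuous compact_continuous_image continuous_on_subset subset_UNIV)
  then obtain M where "\<forall>z\<in>f ` supp f. cmod z \<le> M"
    using compact_imp_bounded bounded_iff by metis
  then have "cmod (f a) \<le> max M 0" for a
    using zero_outside_supp[of a f] by (cases "a \<in> supp f") fastforce+
  then show ?thesis using that[of "max M 0"] by auto
qed

lemma Cc_diff:
  fixes f :: "'a::t2_space \<Rightarrow> complex"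
  assumes "f \<in> Cc" "g \<in> Cc" shows "(\<lambda>a. f a - g a) \<in> Cc"
proof (rule CcI[where L="supp f \<union> supp g"])
  show "continuous_on UNIV (\<lambda>a. f a - g a)"
    using assms by (intro continuous_intros Cc_continuous)
  show "compact (supp f \<union> supp g)" using assms by (intro compact_Un Cc_compact_supp)
  show "a \<in> supp f \<union> supp g" if "f a - g a \<noteq> 0" for a
    using that zero_outside_supp[of a f] zero_outside_supp[of a g]
    by (cases "a \<in> supp f") auto
qed

lemma Cc_mult:
  fixes f :: "'a::t2_space \<Rightarrow> complex"
  assumes "continuous_on UNIV g" "f \<in> Cc" shows "(\<lambda>a. g a * f a) \<in> Cc"
proof (rule CcI[where L="supp f"])
  show "continuous_on UNIV (\<lambda>a. g a * f a)"
    by (intro continuous_on_mult assms(1) Cc_continuous[OF assms(2)])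
qed (use assms(2) zero_outside_supp[of _ f] Cc_compact_supp in auto)

lemma Cc_mult_const:
  fixes f :: "'a::t2_space \<Rightarrow> complex"
  assumes "f \<in> Cc" shows "(\<lambda>a. c * f a) \<in> Cc"
  by (rule Cc_mult[OF continuous_on_const assms])

lemma Cc_add:
  fixes f :: "'a::t2_space \<Rightarrow> complex"
  assumes "f \<in> Cc" "g \<in> Cc" shows "(\<lambda>a. f a + g a) \<in> Cc"
proof -
  have "(\<lambda>a. f a - (-1) * g a) \<in> Cc" by (intro Cc_diff assms Cc_mult_const)
  then show ?thesis by simp
qed

section \<open>Algebra of a groupoid\<close>

context groupoid
begin

lemma unit_iff: "x \<in> units G \<longleftrightarrow> rng G x = x"
proof -
  have "rng G (rng G y) = rng G y" for y using rng_src[of "rng G y"] by (simp add: src_rng)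
  then show ?thesis unfolding units_def by (auto simp: image_iff intro: sym)
qed

lemma rng_mem_units [simp]: "rng G a \<in> units G" and src_mem_units [simp]: "src G a \<in> units G"
  by (simp add: units_def) (metis rng_src unit_iff)

lemma rng_unit: "x \<in> units G \<Longrightarrow> rng G x = x"
  and src_unit: "x \<in> units G \<Longrightarrow> src G x = x"
  unfolding unit_iff by (metis src_rng)+

lemma ginv_unit: "x \<in> units G \<Longrightarrow> ginv G x = x"
  by (metis inv_right rng_inv rng_unit src_unit unit_left)

lemma comp_rng: "src G a = rng G b \<Longrightarrow> rng G (comp G a b) = rng G a"
  and comp_src: "src G a = rng G b \<Longrightarrow> src G (comp G a b) = src G b"
  using rng_comp[of a b] src_comp[of a b] by (auto simp: composable_def)

lemma assoc: "src G a = rng G b \<Longrightarrow> src G b = rng G c \<Longrightarrow>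
    comp G (comp G a b) c = comp G a (comp G b c)"
  using comp_assoc[of a b c] by (auto simp: composable_def)

lemma cancel_left: "src G a = rng G b \<Longrightarrow> comp G (ginv G a) (comp G a b) = b"
  by (metis assoc inv_left src_inv unit_left)

lemma cancel_right: "src G a = rng G b \<Longrightarrow> comp G (comp G a b) (ginv G b) = a"
  by (metis assoc inv_right rng_inv unit_right)

lemma ginv_ginv [simp]: "ginv G (ginv G a) = a"
  by (metis cancel_right inv_right rng_inv src_inv unit_left)

lemma cancel_right': "src G a = src G b \<Longrightarrow> comp G (comp G a (ginv G b)) b = a"
  using cancel_right[of a "ginv G b"] by (simp add: rng_inv)

lemma ginv_comp: "src G a = rng G b \<Longrightarrow> ginv G (comp G a b) = comp G (ginv G b) (ginv G a)"
proof -
  assume ab: "src G a = rng G b"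
  let ?c = "comp G a b" and ?d = "comp G (ginv G b) (ginv G a)"
  have cd: "comp G ?c ?d = rng G a"
    using ab by (metis assoc cancel_right comp_src inv_right rng_inv src_inv)
  have "?d = comp G (ginv G ?c) (comp G ?c ?d)"
    using ab by (metis cancel_left comp_rng comp_src rng_inv src_inv)
  also have "\<dots> = ginv G ?c"
    unfolding cd by (metis ab comp_rng src_inv unit_right)
  finally show ?thesis by simp
qed

text \<open>The substitution a = d b in sums over fibers, on which associativity of convolution
  rests.\<close>

lemma bij_betw_translate:
  "bij_betw (\<lambda>d. comp G d b) (fiber G (rng G b)) (fiber G (src G b))"
  by (rule bij_betw_byWitness[where f'="\<lambda>a. comp G a (ginv G b)"])
    (auto simp: fiber_def cancel_right cancel_right' comp_src rng_inv src_inv)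

text \<open>For a kernel concentrated on the units this leaves only the diagonal entry.\<close>

lemma quotient_unit_iff:
  assumes "src G c = src G a"
  shows "comp G c (ginv G a) \<in> units G \<longleftrightarrow> c = a"
proof
  assume "comp G c (ginv G a) \<in> units G"
  then have "comp G c (ginv G a) = rng G a"
    by (metis assms comp_src rng_inv src_inv src_unit)
  then show "c = a" using cancel_right'[OF assms] unit_left by metis
qed (simp add: inv_right)

end

section \<open>Topology of an etale groupoid\<close>

context etale_groupoid
begin

lemma continuous_on_comp:
  assumes "continuous_on S f" "continuous_on S g" "\<And>x. x \<in> S \<Longrightarrow> src G (f x) = rng G (g x)"
  shows "continuous_on S (\<lambda>x. comp G (f x) (g x))"
proof -
  have "continuous_on S (\<lambda>x. (f x, g x))" using assms by (intro continuous_on_Pair)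
  from continuous_on_compose2[OF continuous_comp this] show ?thesis
    using assms(3) by (simp add: composable_def image_subset_iff)
qed

lemma continuous_on_ginv [continuous_intros]:
  "continuous_on S f \<Longrightarrow> continuous_on S (\<lambda>x. ginv G (f x))"
  using continuous_on_compose2[OF continuous_inv, of S f] by auto

text \<open>The range of an arrow is its product with its inverse, so continuity comes from these
  two operations.\<close>

lemma continuous_on_rng [continuous_intros]:
  assumes "continuous_on S f" shows "continuous_on S (\<lambda>x. rng G (f x))"
proof -
  have "continuous_on S (\<lambda>x. comp G (f x) (ginv G (f x)))"
    using assms by (intro continuous_on_comp continuous_on_ginv) (auto simp: rng_inv)
  then show ?thesis by (simp add: inv_right)
qed

lemma continuous_on_src [continuous_intros]:
  assumes "continuous_on S f" shows "continuous_on S (\<lambda>x. src G (f x))"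
proof -
  have "continuous_on S (\<lambda>x. comp G (ginv G (f x)) (f x))"
    using assms by (intro continuous_on_comp continuous_on_ginv) (auto simp: src_inv)
  then show ?thesis by (simp add: inv_left)
qed

lemma open_src_vimage: "open V \<Longrightarrow> open (src G -` V)"
  by (intro open_vimage continuous_on_src continuous_on_id)

lemma open_ginv_vimage: "open V \<Longrightarrow> open (ginv G -` V)"
  by (intro open_vimage continuous_on_ginv continuous_on_id)

lemma closed_units: "closed (units G)"
proof -
  have "units G = {x. rng G x = x}" using unit_iff by auto
  then show ?thesis
    using closed_Collect_eq[of "rng G" "\<lambda>x. x"] by (simp add: continuous_on_rng continuous_on_id)
qed

text \<open>Take a neighbourhood U of a unit on which \<open>rng\<close> is injective. If both a and
  \<open>rng G a\<close> lie in U, they have the same range and hence coincide, so a is a unit. Such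
  a form a neighbourhood of the given unit.\<close>

lemma open_units: "open (units G)"
  unfolding open_subopen[of "units G"]
proof safe
  fix x assume x: "x \<in> units G"
  obtain U h where U: "open U" "x \<in> U" "homeomorphism U (rng G ` U) (rng G) h"
    using etale unfolding local_homeomorphism_onto_def by metis
  let ?V = "U \<inter> rng G -` U"
  have "open ?V" using U by (intro open_Int open_vimage continuous_on_rng continuous_on_id)
  moreover have "x \<in> ?V" using x U by (simp add: rng_unit)
  moreover have "?V \<subseteq> units G"
  proof
    fix a assume a: "a \<in> ?V"
    have "rng G (rng G a) = rng G a" by (simp add: rng_unit)
    with a U(3) have "rng G a = a" unfolding homeomorphism_def
      by (metis Int_iff vimageD)
    then show "a \<in> units G" by (simp add: unit_iff)
  qed
  ultimately show "\<exists>T. open T \<and> x \<in> T \<and> T \<subseteq> units G" by blast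
qed

text \<open>Inversion exchanges range and source, which turns a local inverse of \<open>rng\<close>
  into one of \<open>src\<close>. Since the units are open, the image is open in the whole groupoid
  and not only in the unit space.\<close>

lemma src_local_section:
  obtains U V s where "open U" "a \<in> U" "open V" "V = src G ` U" "continuous_on V s"
    "\<And>b. b \<in> U \<Longrightarrow> s (src G b) = b" "\<And>x. x \<in> V \<Longrightarrow> s x \<in> U \<and> src G (s x) = x"
proof -
  obtain U h where U: "open U" "ginv G a \<in> U" "openin (top_of_set (units G)) (rng G ` U)"
    "homeomorphism U (rng G ` U) (rng G) h"
    using etale unfolding local_homeomorphism_onto_def by metis
  have V: "rng G ` U = src G ` (ginv G -` U)"
  proof safe
    fix b assume "b \<in> U"
    then show "rng G b \<in> src G ` (ginv G -` U)"
      by (intro image_eqI[of _ _ "ginv G b"]) (simp_all add: src_inv)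
  next
    fix b assume "ginv G b \<in> U"
    then show "src G b \<in> rng G ` U"
      by (intro image_eqI[of _ _ "ginv G b"]) (simp_all add: rng_inv)
  qed
  have hU: "h (rng G b) = b" if "b \<in> U" for b
    using U(4) that by (simp add: homeomorphism_def)
  show ?thesis
  proof (rule that[of "ginv G -` U" "rng G ` U" "\<lambda>x. ginv G (h x)"])
    show "open (ginv G -` U)" using U open_ginv_vimage by auto
    show "open (rng G ` U)" using U(3) open_units openin_open_trans by blast
    show "continuous_on (rng G ` U) (\<lambda>x. ginv G (h x))"
      using U(4) by (intro continuous_on_ginv) (auto simp: homeomorphism_def)
    show "ginv G (h (src G b)) = b" if "b \<in> ginv G -` U" for b
      using hU[of "ginv G b"] that by (simp add: rng_inv)
    show "ginv G (h x) \<in> ginv G -` U \<and> src G (ginv G (h x)) = x" if "x \<in> rng G ` U" for x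
      using that hU by (auto simp: src_inv)
  qed (use U V in auto)
qed

lemma src_fiber_card_bound:
  assumes "compact L"
  shows "\<exists>N::nat. \<forall>y. finite {a \<in> L. src G a = y} \<and> card {a \<in> L. src G a = y} \<le> N"
proof (rule compact_locally_inj_card_bound[OF assms])
  fix a
  obtain U V s where "open U" "a \<in> U" "\<And>b. b \<in> U \<Longrightarrow> s (src G b) = b"
    using src_local_section by metis
  then show "\<exists>U. open U \<and> a \<in> U \<and> inj_on (src G) U" by (metis inj_onI)
qed

lemma rng_fiber_card_bound:
  assumes "compact L"
  shows "\<exists>N::nat. \<forall>y. finite {a \<in> L. rng G a = y} \<and> card {a \<in> L. rng G a = y} \<le> N"
proof (rule compact_locally_inj_card_bound[OF assms])
  fix a
  obtain U h where "open U" "a \<in> U" "homeomorphism U (rng G ` U) (rng G) h"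
    using etale unfolding local_homeomorphism_onto_def by metis
  then show "\<exists>U. open U \<and> a \<in> U \<and> inj_on (rng G) U"
    by (intro exI[of _ U]) (auto simp: homeomorphism_def intro: inj_on_inverseI)
qed

lemma finite_fiber_Int_compact: "compact L \<Longrightarrow> finite (fiber G x \<inter> L)"
proof -
  assume "compact L"
  then have "finite {a \<in> L. src G a = x}" using src_fiber_card_bound by metis
  moreover have "fiber G x \<inter> L = {a \<in> L. src G a = x}" by (auto simp: fiber_def)
  ultimately show ?thesis by simp
qed

text \<open>The fiber over the source of c0 meets \<open>L\<close> in a finite set A. As c moves
  near c0, the points of A move along local sections of \<open>src\<close> without colliding, and no
  further point of \<open>L\<close> enters the fiber. Near c0 the sum thus has a fixed finite number
  of continuous terms.\<close>

lemma continuous_fiber_sum: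
  assumes cont: "continuous_on {(c, a). src G c = src G a} (\<lambda>(c, a). \<Phi> c a)"
    and L: "compact L" and zero: "\<And>c a. src G c = src G a \<Longrightarrow> a \<notin> L \<Longrightarrow> \<Phi> c a = (0::complex)"
  shows "continuous_on UNIV (\<lambda>c. \<Sum>\<^sub>\<infinity>a\<in>fiber G (src G c). \<Phi> c a)"
proof (clarsimp simp: continuous_on_eq_continuous_at)
  fix c0
  define A where "A = fiber G (src G c0) \<inter> L"
  have finA: "finite A" unfolding A_def by (rule finite_fiber_Int_compact[OF L])
  have "\<forall>a. \<exists>U V s. open U \<and> a \<in> U \<and> open V \<and> V = src G ` U \<and> continuous_on V s \<and>
    (\<forall>b\<in>U. s (src G b) = b) \<and> (\<forall>x\<in>V. s x \<in> U \<and> src G (s x) = x)"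
    by (rule allI) (rule src_local_section, blast)
  then obtain U where "\<forall>a. \<exists>V s. open (U a) \<and> a \<in> U a \<and> open V \<and> V = src G ` U a \<and> continuous_on V s \<and>
    (\<forall>b\<in>U a. s (src G b) = b) \<and> (\<forall>x\<in>V. s x \<in> U a \<and> src G (s x) = x)"
    by (rule choice[THEN exE]) blast
  then obtain V where "\<forall>a. \<exists>s. open (U a) \<and> a \<in> U a \<and> open (V a) \<and> V a = src G ` U a \<and> continuous_on (V a) s \<and>
    (\<forall>b\<in>U a. s (src G b) = b) \<and> (\<forall>x\<in>V a. s x \<in> U a \<and> src G (s x) = x)"
    by (rule choice[THEN exE]) blast
  then obtain s where "\<forall>a. open (U a) \<and> a \<in> U a \<and> open (V a) \<and> V a = src G ` U a \<and> continuous_on (V a) (s a) \<and>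
    (\<forall>b\<in>U a. s a (src G b) = b) \<and> (\<forall>x\<in>V a. s a x \<in> U a \<and> src G (s a x) = x)"
    by (rule choice[THEN exE]) blast
  then have U: "\<And>a. open (U a)" "\<And>a. a \<in> U a" and V: "\<And>a. open (V a)" "\<And>a. V a = src G ` U a"
    and s: "\<And>a. continuous_on (V a) (s a)" "\<And>a b. b \<in> U a \<Longrightarrow> s a (src G b) = b"
      "\<And>a x. x \<in> V a \<Longrightarrow> s a x \<in> U a \<and> src G (s a x) = x"
    by blast+
  have srcA: "src G a = src G c0" if "a \<in> A" for a using that by (simp add: A_def fiber_def)
  have V0: "src G c0 \<in> V a" if "a \<in> A" for a 
    unfolding V(2) using srcA[OF that] U(2)[of a] by (metis imageI)
  have s0: "s a (src G c0) = a" if "a \<in> A" for a using s(2)[OF U(2)[of a]] srcA[OF that] by simp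
  have contS: "continuous_on (src G -` V a) (\<lambda>c. s a (src G c))" for a
    by (rule continuous_on_compose2[OF s(1)]) (auto intro!: continuous_intros)
  have atS: "isCont (\<lambda>c. s a (src G c)) c0" if "a \<in> A" for a
    using contS[of a] open_src_vimage[OF V(1)[of a]] V0[OF that]
    by (simp add: continuous_on_eq_continuous_at)
  have nhds_src: "\<forall>\<^sub>F c in nhds c0. src G c \<in> W" if "open W" "src G c0 \<in> W" for W
    using eventually_nhds_in_open[OF open_src_vimage[OF that(1)], of c0] that(2) by simp
  have ev1: "\<forall>\<^sub>F c in nhds c0. \<forall>a\<in>A. src G c \<in> V a"
    using finA V0 V(1) by (intro eventually_ball_finite ballI nhds_src) auto
  \<comment> \<open>Distinct sections stay distinct, since otherwise reindexing by A would count a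
    term twice.\<close>
  have ev2: "\<forall>\<^sub>F c in nhds c0. \<forall>a\<in>A. \<forall>b\<in>A. a \<noteq> b \<longrightarrow> s a (src G c) \<noteq> s b (src G c)"
  proof (intro eventually_ball_finite finA ballI)
    fix a b assume ab: "a \<in> A" "b \<in> A"
    show "\<forall>\<^sub>F c in nhds c0. a \<noteq> b \<longrightarrow> s a (src G c) \<noteq> s b (src G c)"
    proof (cases "a = b")
      case False
      then obtain P Q where PQ: "open P" "open Q" "a \<in> P" "b \<in> Q" "P \<inter> Q = {}"
        using hausdorff by metis
      have "\<forall>\<^sub>F c in nhds c0. s a (src G c) \<in> P"
        using atS[OF ab(1)] s0[OF ab(1)] PQ unfolding isCont_def
        by (metis eventually_nhds_conv_at tendsto_def)
      moreover have "\<forall>\<^sub>F c in nhds c0. s b (src G c) \<in> Q"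
        using atS[OF ab(2)] s0[OF ab(2)] PQ unfolding isCont_def
        by (metis eventually_nhds_conv_at tendsto_def)
      ultimately show ?thesis by eventually_elim (use PQ in auto)
    qed simp
  qed
  \<comment> \<open>The part of \<open>L\<close> outside the chosen neighbourhoods is compact, so
    its source image is closed. It misses the source of c0 because every point of \<open>L\<close>
    in that fiber belongs to A.\<close>
  have "open (- src G ` (L - (\<Union>a\<in>A. U a)))"
    using L U by (intro open_Compl compact_imp_closed compact_continuous_image
        continuous_on_src continuous_on_id compact_diff) auto
  then have ev3: "\<forall>\<^sub>F c in nhds c0. src G c \<in> - src G ` (L - (\<Union>a\<in>A. U a))"
    by (rule nhds_src) (use U(2) in \<open>force simp: A_def fiber_def\<close>)
  obtain W where W: "open W" "c0 \<in> W" and P: "\<And>c. c \<in> W \<Longrightarrow>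
     (\<forall>a\<in>A. src G c \<in> V a) \<and>
     (\<forall>a\<in>A. \<forall>b\<in>A. a \<noteq> b \<longrightarrow> s a (src G c) \<noteq> s b (src G c)) \<and>
     src G c \<in> - src G ` (L - (\<Union>a\<in>A. U a))"
    using ev1 ev2 ev3 unfolding eventually_nhds[of _ c0] by (metis (no_types, lifting) IntI Int_iff open_Int)
  have eq: "(\<Sum>\<^sub>\<infinity>a\<in>fiber G (src G c). \<Phi> c a) = (\<Sum>a\<in>A. \<Phi> c (s a (src G c)))" if "c \<in> W" for c
  proof -
    note Pc = P[OF that]
    have "(\<Sum>\<^sub>\<infinity>a\<in>fiber G (src G c). \<Phi> c a) = (\<Sum>\<^sub>\<infinity>b\<in>(\<lambda>a. s a (src G c)) ` A. \<Phi> c b)"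
    proof (rule infsum_cong_neutral)
      fix b assume b: "b \<in> fiber G (src G c) - (\<lambda>a. s a (src G c)) ` A"
      have "b \<notin> L"
      proof
        assume "b \<in> L"
        moreover have sb: "src G b = src G c" using b by (simp add: fiber_def)
        moreover have "src G c \<notin> src G ` (L - (\<Union>a\<in>A. U a))" using Pc by blast
        ultimately obtain a where a: "a \<in> A" "b \<in> U a" by (metis DiffI UN_E imageI)
        have "s a (src G c) = b" using s(2)[OF a(2)] unfolding sb .
        then have "b \<in> (\<lambda>a. s a (src G c)) ` A" using a(1) by blast
        with b show False by blast
      qed
      then show "\<Phi> c b = 0" using b by (intro zero) (auto simp: fiber_def)
    next
      fix b assume "b \<in> (\<lambda>a. s a (src G c)) ` A - fiber G (src G c)"
      then obtain a where a: "a \<in> A" "b = s a (src G c)" "b \<notin> fiber G (src G c)" by blast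
      then have "src G b = src G c" using Pc s(3) by metis
      with a(3) show "\<Phi> c b = 0" by (simp add: fiber_def)
    qed auto
    also have "\<dots> = (\<Sum>b\<in>(\<lambda>a. s a (src G c)) ` A. \<Phi> c b)" using finA by simp
    also have "\<dots> = (\<Sum>a\<in>A. \<Phi> c (s a (src G c)))"
    proof -
      have "inj_on (\<lambda>a. s a (src G c)) A" using Pc unfolding inj_on_def by metis
      then show ?thesis by (simp add: sum.reindex)
    qed
    finally show ?thesis .
  qed
  have "continuous_on W (\<lambda>c. \<Sum>a\<in>A. \<Phi> c (s a (src G c)))"
  proof (rule continuous_on_sum)
    fix a assume a: "a \<in> A"
    have "continuous_on W (\<lambda>c. (c, s a (src G c)))"
      using contS[of a] P a by (intro continuous_on_Pair continuous_on_id) (auto elim!: continuous_on_subset)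
    moreover have "(\<lambda>c. (c, s a (src G c))) ` W \<subseteq> {(c, a). src G c = src G a}"
    proof safe
      fix c assume "c \<in> W"
      then show "src G c = src G (s a (src G c))" using P a s(3) by metis
    qed
    ultimately show "continuous_on W (\<lambda>c. \<Phi> c (s a (src G c)))"
      using continuous_on_compose2[OF cont, of W "\<lambda>c. (c, s a (src G c))"] by simp
  qed
  then have "continuous_on W (\<lambda>c. \<Sum>\<^sub>\<infinity>a\<in>fiber G (src G c). \<Phi> c a)"
    using eq by (simp cong: continuous_on_cong)
  then show "isCont (\<lambda>c. \<Sum>\<^sub>\<infinity>a\<in>fiber G (src G c). \<Phi> c a) c0"
    using W by (simp add: continuous_on_eq_continuous_at)
qed

section \<open>Compact neighbourhoods and cut-off functions\<close>

lemma completely_regular: "completely_regular_space (euclidean :: 'g topology)"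
  using locally_compact Hausdorff_space_t2 by (intro locally_compact_regular_imp_completely_regular_space) auto

lemma compact_nbhd:
  fixes U :: "'g set"
  assumes "open U" "a \<in> U"
  obtains V K where "open V" "compact K" "a \<in> V" "V \<subseteq> K" "K \<subseteq> U"
proof -
  have "neighbourhood_base_of (compactin euclidean) (euclidean :: 'g topology)"
    using locally_compact locally_compact_space_neighbourhood_base Hausdorff_space_t2 by blast
  then have "\<exists>V K. open V \<and> compact K \<and> a \<in> V \<and> V \<subseteq> K \<and> K \<subseteq> U"
    using assms unfolding neighbourhood_base_of by simp
  then show ?thesis by (elim exE conjE) (rule that)
qed

text \<open>Urysohn's lemma is applied to C and the complement of an intermediate open set ?W lying
  in a compact ?L inside U. The detour through ?L is what puts the closed support, and not only the
  nonvanishing set, inside U and makes it compact.\<close>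

lemma bump_function:
  assumes C: "compact C" and U: "open U" "C \<subseteq> U"
  obtains h :: "'g \<Rightarrow> complex" where "h \<in> Cc" "\<And>a. a \<in> C \<Longrightarrow> h a = 1" "supp h \<subseteq> U"
    "\<And>a. cmod (h a) \<le> 1"
proof -
  have "\<exists>V K. open V \<and> compact K \<and> a \<in> V \<and> V \<subseteq> K \<and> K \<subseteq> U" if "a \<in> C" for a
  proof -
    have "a \<in> U" using that U(2) by blast
    then obtain V K where "open V" "compact K" "a \<in> V" "V \<subseteq> K" "K \<subseteq> U"
      by (rule compact_nbhd[OF U(1)])
    then show ?thesis by (intro exI conjI)
  qed
  then have "\<forall>a. \<exists>V K. a \<in> C \<longrightarrow> open V \<and> compact K \<and> a \<in> V \<and> V \<subseteq> K \<and> K \<subseteq> U" by simp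
  then obtain V where "\<forall>a. \<exists>K. a \<in> C \<longrightarrow> open (V a) \<and> compact K \<and> a \<in> V a \<and> V a \<subseteq> K \<and> K \<subseteq> U"
    by (rule choice[THEN exE]) (rule that)
  then obtain K where "\<forall>a. a \<in> C \<longrightarrow> open (V a) \<and> compact (K a) \<and> a \<in> V a \<and> V a \<subseteq> K a \<and> K a \<subseteq> U"
    by (rule choice[THEN exE]) (rule that)
  then have VK: "\<And>a. a \<in> C \<Longrightarrow> open (V a) \<and> compact (K a) \<and> a \<in> V a \<and> V a \<subseteq> K a \<and> K a \<subseteq> U" by simp
  obtain D where D: "D \<subseteq> C" "finite D" "C \<subseteq> (\<Union>a\<in>D. V a)"
  proof (rule compactE_image[OF C, of C V])
    show "open (V a)" if "a \<in> C" for a using VK[OF that] by blast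
    show "C \<subseteq> (\<Union>a\<in>C. V a)" using VK by blast
  qed blast
  let ?W = "\<Union>a\<in>D. V a" and ?L = "\<Union>a\<in>D. K a"
  have VK': "open (V a)" "compact (K a)" "V a \<subseteq> K a" "K a \<subseteq> U" if "a \<in> D" for a
    using VK[of a] that D(1) by (simp_all add: subsetD)
  have W: "open ?W" "compact ?L" "?W \<subseteq> ?L" "?L \<subseteq> U"
  proof -
    show "open ?W" by (intro open_UN ballI VK')
    show "compact ?L" by (intro compact_UN D VK')
    show "?W \<subseteq> ?L" by (intro UN_mono VK' subset_refl)
    show "?L \<subseteq> U" by (intro UN_least VK')
  qed
  obtain f where f: "continuous_map euclidean (top_of_set {0..1::real}) f" "f ` (- ?W) \<subseteq> {0}" "f ` C \<subseteq> {1}"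
  proof (rule Urysohn_completely_regular_compact_closed[of 0 1 "euclidean :: 'g topology" C "- ?W"])
    show "completely_regular_space (euclidean :: 'g topology)" by (rule completely_regular)
  qed (use D(3) W(1) C in \<open>auto simp: disjnt_def closed_def compactin_euclidean_iff\<close>)
  have f': "continuous_on UNIV f" "\<And>a. 0 \<le> f a \<and> f a \<le> 1"
    using f(1) by (auto simp: continuous_map_in_subtopology continuous_map_iff_continuous2 Pi_iff)
  have nz: "a \<in> ?L" if "complex_of_real (f a) \<noteq> 0" for a
  proof -
    have "a \<in> ?W" using that f(2) by fastforce
    then show ?thesis using W by blast
  qed
  show ?thesis
  proof (rule that[of "\<lambda>a. complex_of_real (f a)"])
    show "(\<lambda>a. complex_of_real (f a)) \<in> Cc"
      using nz W(2) f'(1) by (intro CcI[where L="?L"] continuous_on_of_real) auto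
    have "supp (\<lambda>a. complex_of_real (f a)) \<subseteq> ?L"
      by (intro supp_subset nz compact_imp_closed W(2))
    then show "supp (\<lambda>a. complex_of_real (f a)) \<subseteq> U" using W(4) by blast
  qed (use f(3) f'(2) in auto)
qed

end

subsection \<open>The Hilbert module\<close>

text \<open>Testing on finite subsets of fibers avoids summability side conditions, so the relation
  is meaningful for every function. By \<open>l2_norm_le\<close> and \<open>l2_le_norm\<close> it is
  the inequality between \<open>l2_norm\<close> and \<open>C\<close> for functions in
  \<open>fiberwise_l2 G\<close>.\<close>

definition l2_le :: "'g groupoid \<Rightarrow> ('g \<Rightarrow> complex) \<Rightarrow> real \<Rightarrow> bool"
  where "l2_le G \<xi> C \<longleftrightarrow> (\<forall>x F. finite F \<longrightarrow> F \<subseteq> fiber G x \<longrightarrow> L2_set (\<lambda>a. cmod (\<xi> a)) F \<le> C)"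

lemma l2_leI: "(\<And>x F. finite F \<Longrightarrow> F \<subseteq> fiber G x \<Longrightarrow> L2_set (\<lambda>a. cmod (\<xi> a)) F \<le> C) \<Longrightarrow> l2_le G \<xi> C"
  and l2_leD: "l2_le G \<xi> C \<Longrightarrow> finite F \<Longrightarrow> F \<subseteq> fiber G x \<Longrightarrow> L2_set (\<lambda>a. cmod (\<xi> a)) F \<le> C"
  unfolding l2_le_def by blast+

lemma l2_le_nonneg: "l2_le G \<xi> C \<Longrightarrow> 0 \<le> C"
  using l2_leD[of G \<xi> C "{}"] by simp

lemma l2_le_mono: "l2_le G \<xi> C \<Longrightarrow> C \<le> D \<Longrightarrow> l2_le G \<xi> D"
  unfolding l2_le_def by (meson order_trans)

lemma l2_le_zero: "l2_le G (\<lambda>_. 0) 0"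
  by (intro l2_leI) (simp add: L2_set_def)

lemma l2_le_dominated:
  assumes "l2_le G \<xi> C" "\<And>a. cmod (\<eta> a) \<le> cmod (\<xi> a)"
  shows "l2_le G \<eta> C"
proof (rule l2_leI)
  fix x F assume F: "finite F" "F \<subseteq> fiber G x"
  have "L2_set (\<lambda>a. cmod (\<eta> a)) F \<le> L2_set (\<lambda>a. cmod (\<xi> a)) F"
    by (intro L2_set_mono assms(2) norm_ge_zero)
  also have "\<dots> \<le> C" by (rule l2_leD[OF assms(1) F])
  finally show "L2_set (\<lambda>a. cmod (\<eta> a)) F \<le> C" .
qed

lemma l2_le_add:
  assumes "l2_le G \<xi> C" "l2_le G \<eta> D" shows "l2_le G (\<lambda>a. \<xi> a + \<eta> a) (C + D)"
proof (rule l2_leI)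
  fix x F assume F: "finite F" "F \<subseteq> fiber G x"
  have "L2_set (\<lambda>a. cmod (\<xi> a + \<eta> a)) F \<le> L2_set (\<lambda>a. cmod (\<xi> a) + cmod (\<eta> a)) F"
    by (intro L2_set_mono norm_triangle_ineq norm_ge_zero)
  also have "\<dots> \<le> L2_set (\<lambda>a. cmod (\<xi> a)) F + L2_set (\<lambda>a. cmod (\<eta> a)) F"
    by (rule L2_set_triangle_ineq)
  also have "\<dots> \<le> C + D" using assms F by (intro add_mono l2_leD)
  finally show "L2_set (\<lambda>a. cmod (\<xi> a + \<eta> a)) F \<le> C + D" .
qed

lemma l2_le_scale:
  assumes "l2_le G \<xi> C" shows "l2_le G (\<lambda>a. c * \<xi> a) (cmod c * C)"
  using l2_leD[OF assms]
  by (intro l2_leI) (simp add: norm_mult L2_set_right_distrib[symmetric] mult_left_mono)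

lemma l2_le_diff:
  assumes "l2_le G \<xi> C" "l2_le G \<eta> D" shows "l2_le G (\<lambda>a. \<xi> a - \<eta> a) (C + D)"
  using l2_le_add[OF assms(1) l2_le_scale[OF assms(2), of "-1"]] by simp

lemma l2_le_commute: "l2_le G (\<lambda>a. \<xi> a - \<eta> a) C \<longleftrightarrow> l2_le G (\<lambda>a. \<eta> a - \<xi> a) C"
  unfolding l2_le_def by (simp add: norm_minus_commute)

lemma l2_le_triangle:
  assumes "l2_le G (\<lambda>a. \<xi> a - \<eta> a) C" "l2_le G (\<lambda>a. \<eta> a - \<zeta> a) D"
  shows "l2_le G (\<lambda>a. \<xi> a - \<zeta> a) (C + D)"
  using l2_le_add[OF assms] by simp

lemma l2_le_pointwise: "l2_le G \<xi> C \<Longrightarrow> cmod (\<xi> a) \<le> C"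
  using l2_leD[of G \<xi> C "{a}" "src G a"] by (simp add: fiber_def)

text \<open>A form of Fatou's lemma: a finite set sees finitely many values, so each tested
  inequality survives a pointwise limit.\<close>

lemma l2_le_limit:
  assumes "\<And>a. (\<lambda>n. \<xi> n a) \<longlonglongrightarrow> \<eta> a" "\<forall>\<^sub>F n in sequentially. l2_le G (\<xi> n) C"
  shows "l2_le G \<eta> C"
proof (rule l2_leI)
  fix x F assume F: "finite F" "F \<subseteq> fiber G x"
  have "(\<lambda>n. L2_set (\<lambda>a. cmod (\<xi> n a)) F) \<longlonglongrightarrow> L2_set (\<lambda>a. cmod (\<eta> a)) F"
    unfolding L2_set_def by (intro tendsto_intros assms(1))
  moreover have "\<forall>\<^sub>F n in sequentially. L2_set (\<lambda>a. cmod (\<xi> n a)) F \<le> C"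
    using assms(2) by eventually_elim (rule l2_leD[OF _ F])
  ultimately show "L2_set (\<lambda>a. cmod (\<eta> a)) F \<le> C"
    by (intro tendsto_upperbound) auto
qed

lemma l2_inner_self: "l2_inner G \<xi> \<xi> x = of_real (\<Sum>\<^sub>\<infinity>a\<in>fiber G x. (cmod (\<xi> a))\<^sup>2)"
proof -
  have "l2_inner G \<xi> \<xi> x = (\<Sum>\<^sub>\<infinity>a\<in>fiber G x. complex_of_real ((cmod (\<xi> a))\<^sup>2))"
    unfolding l2_inner_def by (intro infsum_cong) (metis complex_norm_square mult.commute)
  also have "\<dots> = of_real (\<Sum>\<^sub>\<infinity>a\<in>fiber G x. (cmod (\<xi> a))\<^sup>2)"
    by (rule infsum_bounded_linear_strong[OF _ bounded_linear_of_real])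
      (use summable_on_Re[where f="\<lambda>a. complex_of_real ((cmod (\<xi> a))\<^sup>2)"] summable_on_of_real in force)
  finally show ?thesis .
qed

lemma l2_norm_eq: "l2_norm G \<xi> = sqrt (SUP x\<in>units G. \<Sum>\<^sub>\<infinity>a\<in>fiber G x. (cmod (\<xi> a))\<^sup>2)"
  unfolding l2_norm_def l2_inner_self by (simp add: infsum_nonneg)

lemma l2_inner_cnj: "l2_inner G \<eta> \<xi> x = cnj (l2_inner G \<xi> \<eta> x)"
  unfolding l2_inner_def infsum_cnj[symmetric] by (simp add: mult.commute)

lemma l2_le_sum:
  assumes "l2_le G \<xi> C" "finite F" "F \<subseteq> fiber G x"
  shows "(\<Sum>a\<in>F. (cmod (\<xi> a))\<^sup>2) \<le> C\<^sup>2"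
  using l2_leD[OF assms] l2_le_nonneg[OF assms(1)] unfolding L2_set_def
  by (metis real_sqrt_le_iff real_sqrt_abs abs_of_nonneg)

lemma l2_le_summable:
  assumes "l2_le G \<xi> C"
  shows "(\<lambda>a. (cmod (\<xi> a))\<^sup>2) summable_on fiber G x"
  by (rule nonneg_bdd_above_summable_on)
    (use l2_le_sum[OF assms] in \<open>auto intro!: bdd_aboveI[where M="C\<^sup>2"]\<close>)

lemma l2_le_infsum:
  assumes "l2_le G \<xi> C"
  shows "(\<Sum>\<^sub>\<infinity>a\<in>fiber G x. (cmod (\<xi> a))\<^sup>2) \<le> C\<^sup>2"
  by (rule infsum_le_finite_sums[OF l2_le_summable[OF assms] l2_le_sum[OF assms]])

text \<open>Cauchy-Schwarz on finite subsets, which also yields absolute summability.\<close>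

lemma l2_inner_summable:
  assumes "l2_le G \<eta> C" "l2_le G \<xi> D"
  shows "(\<lambda>a. cmod (cnj (\<eta> a) * \<xi> a)) summable_on fiber G x"
    and "(\<Sum>\<^sub>\<infinity>a\<in>fiber G x. cmod (cnj (\<eta> a) * \<xi> a)) \<le> C * D"
proof -
  have bound: "(\<Sum>a\<in>F. cmod (cnj (\<eta> a) * \<xi> a)) \<le> C * D" if F: "finite F" "F \<subseteq> fiber G x" for F
  proof -
    have "(\<Sum>a\<in>F. cmod (cnj (\<eta> a) * \<xi> a)) = (\<Sum>a\<in>F. \<bar>cmod (\<eta> a)\<bar> * \<bar>cmod (\<xi> a)\<bar>)"
      by (simp add: norm_mult)
    also have "\<dots> \<le> L2_set (\<lambda>a. cmod (\<eta> a)) F * L2_set (\<lambda>a. cmod (\<xi> a)) F"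
      by (rule L2_set_mult_ineq)
    also have "\<dots> \<le> C * D"
      using assms F l2_le_nonneg by (intro mult_mono l2_leD) auto
    finally show ?thesis .
  qed
  show s: "(\<lambda>a. cmod (cnj (\<eta> a) * \<xi> a)) summable_on fiber G x"
    by (rule nonneg_bdd_above_summable_on) (use bound in \<open>auto intro!: bdd_aboveI[where M="C * D"]\<close>)
  show "(\<Sum>\<^sub>\<infinity>a\<in>fiber G x. cmod (cnj (\<eta> a) * \<xi> a)) \<le> C * D"
    by (rule infsum_le_finite_sums[OF s bound])
qed

lemma l2_inner_bound:
  assumes "l2_le G \<eta> C" "l2_le G \<xi> D"
  shows "cmod (l2_inner G \<eta> \<xi> x) \<le> C * D"
  unfolding l2_inner_def
  by (rule order_trans[OF norm_infsum_bound l2_inner_summable(2)[OF assms]])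
    (rule l2_inner_summable(1)[OF assms])

lemma l2_inner_add_right:
  assumes "l2_le G \<eta> C" "l2_le G \<xi> D" "l2_le G \<zeta> E"
  shows "l2_inner G \<eta> (\<lambda>a. \<xi> a + c * \<zeta> a) x = l2_inner G \<eta> \<xi> x + c * l2_inner G \<eta> \<zeta> x"
proof -
  note s = abs_summable_summable[OF l2_inner_summable(1)[OF assms(1,2)]]
    abs_summable_summable[OF l2_inner_summable(1)[OF assms(1,3)]]
  have "l2_inner G \<eta> (\<lambda>a. \<xi> a + c * \<zeta> a) x
      = (\<Sum>\<^sub>\<infinity>a\<in>fiber G x. cnj (\<eta> a) * \<xi> a + c * (cnj (\<eta> a) * \<zeta> a))"
    unfolding l2_inner_def by (intro infsum_cong) (simp add: algebra_simps)
  also have "\<dots> = l2_inner G \<eta> \<xi> x + c * l2_inner G \<eta> \<zeta> x"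
    unfolding l2_inner_def infsum_cmult_right'[symmetric]
    by (intro infsum_add s summable_on_cmult_right)
  finally show ?thesis .
qed

lemma l2_inner_diff_right:
  assumes "l2_le G \<eta> C" "l2_le G \<xi> D" "l2_le G \<zeta> E"
  shows "l2_inner G \<eta> (\<lambda>a. \<xi> a - \<zeta> a) x = l2_inner G \<eta> \<xi> x - l2_inner G \<eta> \<zeta> x"
  using l2_inner_add_right[OF assms, of "-1"] by simp

lemma l2_inner_diff_left:
  assumes "l2_le G \<eta> C" "l2_le G \<xi> D" "l2_le G \<zeta> E"
  shows "l2_inner G (\<lambda>a. \<xi> a - \<zeta> a) \<eta> x = l2_inner G \<xi> \<eta> x - l2_inner G \<zeta> \<eta> x"
  using l2_inner_diff_right[OF assms] l2_inner_cnj by (metis complex_cnj_diff)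

lemma l2_inner_self_zero:
  assumes "l2_le G \<xi> C" "\<And>x. l2_inner G \<xi> \<xi> x = 0"
  shows "\<xi> = (\<lambda>_. 0)"
proof
  fix a
  have "(\<Sum>b\<in>{a}. (cmod (\<xi> b))\<^sup>2) \<le> (\<Sum>\<^sub>\<infinity>b\<in>fiber G (src G a). (cmod (\<xi> b))\<^sup>2)"
    by (rule finite_sum_le_infsum[OF l2_le_summable[OF assms(1)]]) (auto simp: fiber_def)
  also have "\<dots> = 0" using assms(2)[of "src G a"] unfolding l2_inner_self by simp
  finally show "\<xi> a = 0" by simp
qed

text \<open>The bound with some \<open>D\<close> secures summability. On a fiber without it the
  infinite sum would take its default value 0 and the third premise would say nothing there.\<close>

lemma l2_inner_self_le:
  assumes "l2_le G \<xi> D" "0 \<le> C" "\<And>x. cmod (l2_inner G \<xi> \<xi> x) \<le> C\<^sup>2"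
  shows "l2_le G \<xi> C"
proof (rule l2_leI)
  fix x F assume F: "finite F" "F \<subseteq> fiber G x"
  have "(\<Sum>a\<in>F. (cmod (\<xi> a))\<^sup>2) \<le> (\<Sum>\<^sub>\<infinity>a\<in>fiber G x. (cmod (\<xi> a))\<^sup>2)"
    by (rule finite_sum_le_infsum[OF l2_le_summable[OF assms(1)] F]) auto
  also have "\<dots> \<le> C\<^sup>2" using assms(3)[of x] unfolding l2_inner_self by (simp add: infsum_nonneg)
  finally show "L2_set (\<lambda>a. cmod (\<xi> a)) F \<le> C"
    unfolding L2_set_def by (intro real_le_lsqrt assms(2)) (auto intro: sum_nonneg)
qed

context etale_groupoid
begin

text \<open>\<open>l2_le\<close> ranges over all arrows x and \<open>l2_norm\<close> only over
  units; the empty fibers over the remaining x reconcile the two.\<close>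

lemma fiber_nonunit: "x \<notin> units G \<Longrightarrow> fiber G x = {}"
  by (auto simp: fiber_def)

lemma units_nonempty: "units G \<noteq> {}"
  by (simp add: units_def)

lemma fiberwise_l2_iff: "\<xi> \<in> fiberwise_l2 G \<longleftrightarrow> (\<exists>C. l2_le G \<xi> C)"
proof
  assume \<xi>: "\<xi> \<in> fiberwise_l2 G"
  then obtain B where B: "\<And>x. x \<in> units G \<Longrightarrow> (\<Sum>\<^sub>\<infinity>a\<in>fiber G x. (cmod (\<xi> a))\<^sup>2) \<le> B"
    unfolding fiberwise_l2_def bdd_above_def by auto
  have "l2_le G \<xi> (sqrt \<bar>B\<bar>)"
  proof (rule l2_leI)
    fix x F assume F: "finite F" "F \<subseteq> fiber G x"
    show "L2_set (\<lambda>a. cmod (\<xi> a)) F \<le> sqrt \<bar>B\<bar>"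
    proof (cases "x \<in> units G")
      case True
      then have "(\<Sum>a\<in>F. (cmod (\<xi> a))\<^sup>2) \<le> (\<Sum>\<^sub>\<infinity>a\<in>fiber G x. (cmod (\<xi> a))\<^sup>2)"
        using \<xi> F by (intro finite_sum_le_infsum) (auto simp: fiberwise_l2_def)
      also have "\<dots> \<le> \<bar>B\<bar>" using B[OF True] by linarith
      finally show ?thesis unfolding L2_set_def by simp
    qed (use F fiber_nonunit[of x] in simp)
  qed
  then show "\<exists>C. l2_le G \<xi> C" by blast
next
  assume "\<exists>C. l2_le G \<xi> C"
  then obtain C where C: "l2_le G \<xi> C" ..
  then show "\<xi> \<in> fiberwise_l2 G"
    unfolding fiberwise_l2_def using l2_le_summable[OF C] l2_le_infsum[OF C]
    by (auto intro!: bdd_aboveI[where M="C\<^sup>2"])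
qed

lemma l2_norm_le: "l2_le G \<xi> C \<Longrightarrow> l2_norm G \<xi> \<le> C"
proof -
  assume C: "l2_le G \<xi> C"
  have "(SUP x\<in>units G. \<Sum>\<^sub>\<infinity>a\<in>fiber G x. (cmod (\<xi> a))\<^sup>2) \<le> C\<^sup>2"
    by (intro cSUP_least units_nonempty l2_le_infsum C)
  then have "l2_norm G \<xi> \<le> sqrt (C\<^sup>2)" unfolding l2_norm_eq by (rule real_sqrt_le_mono)
  then show ?thesis using l2_le_nonneg[OF C] by simp
qed

text \<open>Some bound \<open>C\<close> must be known first, because only then is the supremum in
  \<open>l2_norm\<close> an upper bound of its values.\<close>

lemma l2_le_norm: "l2_le G \<xi> C \<Longrightarrow> l2_le G \<xi> (l2_norm G \<xi>)"
proof (rule l2_leI)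
  fix x F assume C: "l2_le G \<xi> C" and F: "finite F" "F \<subseteq> fiber G x"
  let ?s = "\<lambda>x. \<Sum>\<^sub>\<infinity>a\<in>fiber G x. (cmod (\<xi> a))\<^sup>2"
  have bdd: "bdd_above (?s ` units G)"
    using l2_le_infsum[OF C] by (auto intro!: bdd_aboveI[where M="C\<^sup>2"])
  have "(\<Sum>a\<in>F. (cmod (\<xi> a))\<^sup>2) \<le> (SUP x\<in>units G. ?s x)"
  proof (cases "x \<in> units G")
    case True
    have "(\<Sum>a\<in>F. (cmod (\<xi> a))\<^sup>2) \<le> ?s x"
      by (rule finite_sum_le_infsum[OF l2_le_summable[OF C] F]) auto
    also have "\<dots> \<le> (SUP x\<in>units G. ?s x)" by (rule cSUP_upper[OF True bdd])
    finally show ?thesis .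
  next
    case False
    \<comment> \<open>The empty sum over a non-unit needs a nonnegative supremum, which the value at
      any unit provides.\<close>
    obtain y where y: "y \<in> units G" using units_nonempty by auto
    have "0 \<le> ?s y" by (simp add: infsum_nonneg)
    also have "\<dots> \<le> (SUP x\<in>units G. ?s x)" by (rule cSUP_upper[OF y bdd])
    finally show ?thesis using F fiber_nonunit[OF False] by simp
  qed
  then show "L2_set (\<lambda>a. cmod (\<xi> a)) F \<le> l2_norm G \<xi>" unfolding L2_set_def l2_norm_eq by simp
qed

text \<open>The support has at most N points in each fiber and the values are at most M. Estimating
  the square norm by the sum of absolute values gives the crude constant N * M.\<close>

lemma Cc_l2_le:
  assumes "f \<in> Cc" shows "\<exists>C. l2_le G f C"
proof -
  obtain M where M: "M \<ge> 0" "\<And>a. cmod (f a) \<le> M" using Cc_bounded[OF assms] by blast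
  obtain N :: nat where N: "\<And>y. finite {a \<in> supp f. src G a = y} \<and> card {a \<in> supp f. src G a = y} \<le> N"
    using src_fiber_card_bound[OF Cc_compact_supp[OF assms]] by auto
  have "l2_le G f (N * M)"
  proof (rule l2_leI)
    fix x F assume F: "finite F" "F \<subseteq> fiber G x"
    have "L2_set (\<lambda>a. cmod (f a)) F \<le> (\<Sum>a\<in>F. cmod (f a))" by (rule L2_set_le_sum) auto
    also have "\<dots> = (\<Sum>a\<in>F \<inter> supp f. cmod (f a))"
      using F zero_outside_supp[of _ f] by (intro sum.mono_neutral_right) auto
    also have "\<dots> \<le> (\<Sum>a\<in>F \<inter> supp f. M)" by (intro sum_mono M)
    also have "\<dots> = card (F \<inter> supp f) * M" by simp
    also have "\<dots> \<le> N * M"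
    proof -
      have "F \<inter> supp f \<subseteq> {a \<in> supp f. src G a = x}" using F by (auto simp: fiber_def)
      then have "card (F \<inter> supp f) \<le> N" using N[of x] card_mono le_trans by metis
      then show ?thesis using M by (intro mult_right_mono) auto
    qed
    finally show "L2_set (\<lambda>a. cmod (f a)) F \<le> N * M" .
  qed
  then show ?thesis by blast
qed

lemma L2_l2_le: "\<xi> \<in> L2 G \<Longrightarrow> \<exists>C. l2_le G \<xi> C"
  unfolding L2_def by (simp add: fiberwise_l2_iff)

lemma L2_iff: "\<xi> \<in> L2 G \<longleftrightarrow> (\<forall>\<epsilon>>0. \<exists>\<eta>\<in>Cc. l2_le G (\<lambda>a. \<xi> a - \<eta> a) \<epsilon>)"
proof
  assume "\<xi> \<in> L2 G"
  then obtain \<eta> C where \<eta>: "\<And>n. \<eta> n \<in> Cc" "(\<lambda>n. l2_norm G (\<lambda>a. \<xi> a - \<eta> n a)) \<longlonglongrightarrow> 0" "l2_le G \<xi> C"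
    unfolding L2_def by (auto simp: fiberwise_l2_iff)
  show "\<forall>\<epsilon>>0. \<exists>\<eta>\<in>Cc. l2_le G (\<lambda>a. \<xi> a - \<eta> a) \<epsilon>"
  proof (intro allI impI)
    fix \<epsilon> :: real assume "\<epsilon> > 0"
    then have "\<forall>\<^sub>F n in sequentially. l2_norm G (\<lambda>a. \<xi> a - \<eta> n a) < \<epsilon>"
      using \<eta>(2) by (intro order_tendstoD(2)) auto
    then obtain n where n: "l2_norm G (\<lambda>a. \<xi> a - \<eta> n a) < \<epsilon>"
      using eventually_happens'[OF sequentially_bot] by blast
    obtain D where "l2_le G (\<eta> n) D" using Cc_l2_le \<eta>(1) by blast
    from l2_le_norm[OF l2_le_diff[OF \<eta>(3) this]] have "l2_le G (\<lambda>a. \<xi> a - \<eta> n a) \<epsilon>"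
      by (rule l2_le_mono) (use n in simp)
    then show "\<exists>\<eta>\<in>Cc. l2_le G (\<lambda>a. \<xi> a - \<eta> a) \<epsilon>" using \<eta>(1) by blast
  qed
next
  assume H: "\<forall>\<epsilon>>0. \<exists>\<eta>\<in>Cc. l2_le G (\<lambda>a. \<xi> a - \<eta> a) \<epsilon>"
  have "\<exists>\<eta>\<in>Cc. l2_le G (\<lambda>a. \<xi> a - \<eta> a) (inverse (real (Suc n)))" for n
    using H by simp
  then obtain \<eta> where \<eta>: "\<And>n. \<eta> n \<in> Cc" "\<And>n. l2_le G (\<lambda>a. \<xi> a - \<eta> n a) (inverse (real (Suc n)))"
    by metis
  \<comment> \<open>A single approximant at finite distance already bounds \<xi>, which gives
    membership in \<open>fiberwise_l2 G\<close>.\<close>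
  obtain D where "l2_le G (\<eta> 0) D" using Cc_l2_le \<eta>(1) by blast
  from l2_le_add[OF \<eta>(2)[of 0] this] have "\<xi> \<in> fiberwise_l2 G" by (auto simp: fiberwise_l2_iff)
  moreover have "(\<lambda>n. l2_norm G (\<lambda>a. \<xi> a - \<eta> n a)) \<longlonglongrightarrow> 0"
  proof (rule tendsto_sandwich[OF _ _ tendsto_const LIMSEQ_inverse_real_of_nat])
    show "\<forall>\<^sub>F n in sequentially. 0 \<le> l2_norm G (\<lambda>a. \<xi> a - \<eta> n a)"
      using l2_le_nonneg[OF l2_le_norm[OF \<eta>(2)]] by simp
    show "\<forall>\<^sub>F n in sequentially. l2_norm G (\<lambda>a. \<xi> a - \<eta> n a) \<le> inverse (real (Suc n))"
      using l2_norm_le[OF \<eta>(2)] by simp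
  qed
  ultimately show "\<xi> \<in> L2 G" unfolding L2_def using \<eta>(1) by blast
qed

lemma Cc_L2: "f \<in> Cc \<Longrightarrow> f \<in> L2 G"
  unfolding L2_iff by (intro allI impI bexI[of _ f]) (simp_all add: l2_le_mono[OF l2_le_zero])

lemma L2_closed:
  assumes "\<And>\<epsilon>. \<epsilon> > 0 \<Longrightarrow> \<exists>\<zeta>\<in>L2 G. l2_le G (\<lambda>a. \<xi> a - \<zeta> a) \<epsilon>"
  shows "\<xi> \<in> L2 G"
  unfolding L2_iff
proof (intro allI impI)
  fix \<epsilon> :: real assume "\<epsilon> > 0"
  then obtain \<zeta> where "\<zeta> \<in> L2 G" and 1: "l2_le G (\<lambda>a. \<xi> a - \<zeta> a) (\<epsilon>/2)"
    using assms[of "\<epsilon>/2"] by auto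
  then obtain \<eta> where \<eta>: "\<eta> \<in> Cc" "l2_le G (\<lambda>a. \<zeta> a - \<eta> a) (\<epsilon>/2)"
    using \<open>\<epsilon> > 0\<close> unfolding L2_iff by (meson half_gt_zero)
  show "\<exists>\<eta>\<in>Cc. l2_le G (\<lambda>a. \<xi> a - \<eta> a) \<epsilon>"
    using l2_le_triangle[OF 1 \<eta>(2)] \<eta>(1) by auto
qed

lemma L2_zero: "(\<lambda>_. 0) \<in> L2 G"
  by (intro Cc_L2 CcI[where L="{}"]) auto

lemma L2_axpy:
  assumes "\<xi> \<in> L2 G" "\<zeta> \<in> L2 G" shows "(\<lambda>a. \<xi> a + c * \<zeta> a) \<in> L2 G"
  unfolding L2_iff
proof (intro allI impI)
  fix \<epsilon> :: real assume e: "\<epsilon> > 0"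
  then obtain \<eta> where \<eta>: "\<eta> \<in> Cc" "l2_le G (\<lambda>a. \<xi> a - \<eta> a) (\<epsilon>/2)"
    using assms(1) unfolding L2_iff by (meson half_gt_zero)
  \<comment> \<open>The summand 1 covers c = 0.\<close>
  have "\<epsilon> / 2 / (cmod c + 1) > 0" using e by (simp add: add_nonneg_pos)
  then obtain \<theta> where \<theta>: "\<theta> \<in> Cc" "l2_le G (\<lambda>a. \<zeta> a - \<theta> a) (\<epsilon> / 2 / (cmod c + 1))"
    using assms(2) unfolding L2_iff by meson
  have sum: "l2_le G (\<lambda>a. (\<xi> a - \<eta> a) + c * (\<zeta> a - \<theta> a)) (\<epsilon>/2 + cmod c * (\<epsilon> / 2 / (cmod c + 1)))"
    by (intro l2_le_add l2_le_scale \<eta> \<theta>)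
  have "cmod c * (\<epsilon> / 2 / (cmod c + 1)) \<le> \<epsilon> / 2"
    using e mult_right_mono[of "cmod c" "cmod c + 1" "\<epsilon> / 2"] norm_ge_zero[of c]
    by (simp only: times_divide_eq_right pos_divide_le_eq add_nonneg_pos zero_less_one mult.commute)
  then have "l2_le G (\<lambda>a. (\<xi> a - \<eta> a) + c * (\<zeta> a - \<theta> a)) \<epsilon>"
    by (intro l2_le_mono[OF sum]) linarith
  then have "l2_le G (\<lambda>a. (\<xi> a + c * \<zeta> a) - (\<eta> a + c * \<theta> a)) \<epsilon>"
    by (simp add: algebra_simps)
  then show "\<exists>\<eta>\<in>Cc. l2_le G (\<lambda>a. (\<xi> a + c * \<zeta> a) - \<eta> a) \<epsilon>"
    using Cc_add[OF \<eta>(1) Cc_mult_const[OF \<theta>(1), of c]] by (rule rev_bexI[rotated])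
qed

lemma L2_diff: "\<xi> \<in> L2 G \<Longrightarrow> \<zeta> \<in> L2 G \<Longrightarrow> (\<lambda>a. \<xi> a - \<zeta> a) \<in> L2 G"
  using L2_axpy[of \<xi> \<zeta> "-1"] by simp

lemma L2_scale: "\<zeta> \<in> L2 G \<Longrightarrow> (\<lambda>a. c * \<zeta> a) \<in> L2 G"
  using L2_axpy[OF L2_zero, of \<zeta> c] by simp

text \<open>The fiberwise bound dominates every single value, so approximation by \<open>Cc\<close>
  is uniform.\<close>

lemma L2_continuous:
  assumes "\<xi> \<in> L2 G" shows "continuous_on UNIV \<xi>"
proof -
  have "\<exists>\<eta>\<in>Cc. l2_le G (\<lambda>a. \<xi> a - \<eta> a) (inverse (real (Suc n)))" for n
    using assms unfolding L2_iff by simp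
  then obtain \<eta> where \<eta>: "\<And>n. \<eta> n \<in> Cc" "\<And>n. l2_le G (\<lambda>a. \<xi> a - \<eta> n a) (inverse (real (Suc n)))"
    by metis
  show ?thesis
  proof (rule uniform_limit_theorem)
    show "\<forall>\<^sub>F n in sequentially. continuous_on UNIV (\<eta> n)"
      using Cc_continuous[OF \<eta>(1)] by simp
    show "uniform_limit UNIV \<eta> \<xi> sequentially"
    proof (rule uniform_limitI)
      fix e :: real assume "e > 0"
      then obtain N where N: "inverse (real (Suc N)) < e" using reals_Archimedean by blast
      show "\<forall>\<^sub>F n in sequentially. \<forall>x\<in>UNIV. dist (\<eta> n x) (\<xi> x) < e"
        unfolding eventually_sequentially
      proof (intro exI allI impI ballI)
        fix n x assume "N \<le> n"
        have "dist (\<eta> n x) (\<xi> x) \<le> inverse (real (Suc n))"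
          using l2_le_pointwise[OF \<eta>(2)] by (simp add: dist_norm norm_minus_commute)
        also have "\<dots> \<le> inverse (real (Suc N))" using \<open>N \<le> n\<close> by (simp add: field_simps)
        finally show "dist (\<eta> n x) (\<xi> x) < e" using N by simp
      qed
    qed
  qed simp
qed

text \<open>Values are Cauchy because an \<open>l2_le\<close> bound dominates them, and
  \<open>l2_le_limit\<close> turns the Cauchy estimate into an estimate for the pointwise limit.
  Pointwise convergence is all that is exported, since norm estimates for the limit can be regained
  in the same way.\<close>

lemma L2_complete:
  assumes L2: "\<And>n. \<xi> n \<in> L2 G"
    and Cauchy: "\<And>\<epsilon>. \<epsilon> > 0 \<Longrightarrow> \<exists>N. \<forall>m\<ge>N. \<forall>n\<ge>N. l2_le G (\<lambda>a. \<xi> m a - \<xi> n a) \<epsilon>"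
  obtains \<eta> where "\<eta> \<in> L2 G" "\<And>a. (\<lambda>n. \<xi> n a) \<longlonglongrightarrow> \<eta> a"
proof -
  have "Cauchy (\<lambda>n. \<xi> n a)" for a
  proof (rule metric_CauchyI)
    fix e :: real assume "e > 0"
    then obtain N where N: "\<forall>m\<ge>N. \<forall>n\<ge>N. l2_le G (\<lambda>a. \<xi> m a - \<xi> n a) (e/2)"
      using Cauchy[of "e/2"] by auto
    have "dist (\<xi> m a) (\<xi> n a) < e" if "m \<ge> N" "n \<ge> N" for m n
    proof -
      have "l2_le G (\<lambda>a. \<xi> m a - \<xi> n a) (e/2)" using N that by blast
      from l2_le_pointwise[OF this, of a] show ?thesis using \<open>e > 0\<close> by (simp add: dist_norm)
    qed
    then show "\<exists>M. \<forall>m\<ge>M. \<forall>n\<ge>M. dist (\<xi> m a) (\<xi> n a) < e" by blast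
  qed
  then have "\<forall>a. \<exists>l. (\<lambda>n. \<xi> n a) \<longlonglongrightarrow> l" by (simp add: Cauchy_convergent_iff convergent_def)
  then obtain \<eta> where \<eta>: "\<And>a. (\<lambda>n. \<xi> n a) \<longlonglongrightarrow> \<eta> a" by metis
  have "\<eta> \<in> L2 G"
  proof (rule L2_closed)
    fix e :: real assume "e > 0"
    then obtain N where N: "\<forall>m\<ge>N. \<forall>n\<ge>N. l2_le G (\<lambda>a. \<xi> m a - \<xi> n a) e"
      using Cauchy by blast
    have "l2_le G (\<lambda>a. \<eta> a - \<xi> N a) e"
    proof (rule l2_le_limit)
      show "(\<lambda>n. \<xi> n a - \<xi> N a) \<longlonglongrightarrow> \<eta> a - \<xi> N a" for a by (intro tendsto_intros \<eta>)
      show "\<forall>\<^sub>F n in sequentially. l2_le G (\<lambda>a. \<xi> n a - \<xi> N a) e"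
        using N by (auto simp: eventually_sequentially)
    qed
    then show "\<exists>\<zeta>\<in>L2 G. l2_le G (\<lambda>a. \<eta> a - \<zeta> a) e" using L2 by blast
  qed
  then show ?thesis using that \<eta> by blast
qed

end

subsection \<open>Adjointable operators\<close>

text \<open>Quantifying over every \<open>D\<close>, and not only over the unit ball, builds in
  homogeneity. The triangle inequality for \<open>op_diff\<close> then holds for arbitrary maps,
  without linearity.\<close>

definition op_le :: "'g::topological_space groupoid \<Rightarrow> 'g operator \<Rightarrow> real \<Rightarrow> bool"
  where "op_le G T C \<longleftrightarrow> (\<forall>\<xi>\<in>L2 G. \<forall>D. l2_le G \<xi> D \<longrightarrow> l2_le G (T \<xi>) (C * D))"

lemma op_leD: "op_le G T C \<Longrightarrow> \<xi> \<in> L2 G \<Longrightarrow> l2_le G \<xi> D \<Longrightarrow> l2_le G (T \<xi>) (C * D)"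
  unfolding op_le_def by blast

lemma op_le_mono: "op_le G T C \<Longrightarrow> C \<le> D \<Longrightarrow> op_le G T D"
  unfolding op_le_def by (meson l2_le_mono l2_le_nonneg mult_right_mono)

lemma op_le_op_diff_commute: "op_le G (op_diff G T S) C \<longleftrightarrow> op_le G (op_diff G S T) C"
  unfolding op_le_def op_diff_def
  by (intro ball_cong all_cong1 refl imp_cong) (simp add: l2_le_commute[of G "T _"])

lemma op_le_op_diff_triangle:
  assumes "op_le G (op_diff G T R) C" "op_le G (op_diff G R S) D"
  shows "op_le G (op_diff G T S) (C + D)"
  unfolding op_le_def
proof (intro ballI allI impI)
  fix \<xi> E assume \<xi>: "\<xi> \<in> L2 G" "l2_le G \<xi> E"
  show "l2_le G (op_diff G T S \<xi>) ((C + D) * E)"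
    using l2_le_triangle[of G "T \<xi>" "R \<xi>" "C * E" "S \<xi>" "D * E"]
      op_leD[OF assms(1) \<xi>] op_leD[OF assms(2) \<xi>] \<xi>(1)
    by (simp add: op_diff_def distrib_right)
qed

text \<open>Keeps the adjoint as data, because the completeness proof has to follow the adjoints
  along with the operators.\<close>

definition adjoint_pair :: "'g::topological_space groupoid \<Rightarrow> 'g operator \<Rightarrow> 'g operator \<Rightarrow> bool"
  where "adjoint_pair G T S \<longleftrightarrow> T \<in> L2 G \<rightarrow>\<^sub>E L2 G \<and> S \<in> L2 G \<rightarrow>\<^sub>E L2 G \<and>
    (\<forall>\<eta>\<in>L2 G. \<forall>\<xi>\<in>L2 G. l2_inner G \<eta> (T \<xi>) = l2_inner G (S \<eta>) \<xi>)"

lemma adjointable_iff: "T \<in> adjointable G \<longleftrightarrow> (\<exists>S. adjoint_pair G T S)"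
  unfolding adjointable_def adjoint_pair_def by blast

lemma adjoint_pairD:
  assumes "adjoint_pair G T S"
  shows "\<xi> \<in> L2 G \<Longrightarrow> T \<xi> \<in> L2 G" "\<xi> \<in> L2 G \<Longrightarrow> S \<xi> \<in> L2 G"
    "\<eta> \<in> L2 G \<Longrightarrow> \<xi> \<in> L2 G \<Longrightarrow> l2_inner G \<eta> (T \<xi>) = l2_inner G (S \<eta>) \<xi>"
  using assms unfolding adjoint_pair_def by auto

lemma adjointable_L2: "T \<in> adjointable G \<Longrightarrow> \<xi> \<in> L2 G \<Longrightarrow> T \<xi> \<in> L2 G"
  unfolding adjointable_def by auto

lemma adjointable_eqI:
  assumes "T \<in> adjointable G" "S \<in> adjointable G" "\<And>\<xi>. \<xi> \<in> L2 G \<Longrightarrow> T \<xi> = S \<xi>"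
  shows "T = S"
proof (rule PiE_ext)
  show "T \<in> L2 G \<rightarrow>\<^sub>E L2 G" "S \<in> L2 G \<rightarrow>\<^sub>E L2 G"
    using assms(1,2) unfolding adjointable_def by blast+
qed (rule assms(3))

context etale_groupoid
begin

lemma L2_l2_le_pos: "\<xi> \<in> L2 G \<Longrightarrow> \<exists>C>0. l2_le G \<xi> C"
proof -
  assume "\<xi> \<in> L2 G"
  then obtain C where "l2_le G \<xi> C" using L2_l2_le by blast
  then have "l2_le G \<xi> (max C 1)" by (rule l2_le_mono) simp
  then show ?thesis by (intro exI[of _ "max C 1"]) simp
qed

lemma L2_eqI:
  assumes "u \<in> L2 G" "v \<in> L2 G" "\<And>\<eta>. \<eta> \<in> L2 G \<Longrightarrow> l2_inner G \<eta> u = l2_inner G \<eta> v"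
  shows "u = v"
proof -
  obtain C D where CD: "l2_le G u C" "l2_le G v D" using L2_l2_le assms(1,2) by blast
  let ?w = "\<lambda>a. u a - v a"
  have w: "?w \<in> L2 G" by (intro L2_diff assms)
  have "?w = (\<lambda>_. 0)"
  proof (rule l2_inner_self_zero[OF l2_le_diff[OF CD]])
    show "l2_inner G ?w ?w x = 0" for x
      using l2_inner_diff_right[OF l2_le_diff[OF CD] CD, of x] assms(3)[OF w] by simp
  qed
  then show ?thesis by (metis eq_iff_diff_eq_0 ext)
qed

text \<open>Moving \<open>T\<close> across the inner product leaves an expression in the vectors
  themselves, which is linear in them. \<open>L2_eqI\<close> then separates the two sides.\<close>

lemma adjointable_axpy:
  assumes "T \<in> adjointable G" "\<xi> \<in> L2 G" "\<zeta> \<in> L2 G"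
  shows "T (\<lambda>a. \<xi> a + c * \<zeta> a) = (\<lambda>a. T \<xi> a + c * T \<zeta> a)"
proof (rule L2_eqI)
  obtain S where S: "adjoint_pair G T S" using assms(1) by (auto simp: adjointable_iff)
  note SD = adjoint_pairD[OF S]
  show "T (\<lambda>a. \<xi> a + c * \<zeta> a) \<in> L2 G" by (intro SD L2_axpy assms)
  show "(\<lambda>a. T \<xi> a + c * T \<zeta> a) \<in> L2 G" by (intro SD L2_axpy assms)
  fix \<eta> assume \<eta>: "\<eta> \<in> L2 G"
  obtain B C D E F H where b: "l2_le G \<eta> B" "l2_le G (S \<eta>) C" "l2_le G \<xi> D" "l2_le G \<zeta> E"
    "l2_le G (T \<xi>) F" "l2_le G (T \<zeta>) H"
    using L2_l2_le[OF \<eta>] L2_l2_le[OF assms(2)] L2_l2_le[OF assms(3)] L2_l2_le[OF SD(1)[OF assms(2)]]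
      L2_l2_le[OF SD(1)[OF assms(3)]] L2_l2_le[OF SD(2)[OF \<eta>]] by blast
  show "l2_inner G \<eta> (T (\<lambda>a. \<xi> a + c * \<zeta> a)) = l2_inner G \<eta> (\<lambda>a. T \<xi> a + c * T \<zeta> a)"
    by (rule ext) (simp add: SD(3) \<eta> assms L2_axpy l2_inner_add_right[OF b(2-4)] l2_inner_add_right[OF b(1,5,6)])
qed

lemma adjointable_scale:
  assumes "T \<in> adjointable G" "\<zeta> \<in> L2 G"
  shows "T (\<lambda>a. c * \<zeta> a) = (\<lambda>a. c * T \<zeta> a)"
proof -
  have z: "T (\<lambda>_. 0) = (\<lambda>_. 0)"
    using adjointable_axpy[OF assms(1) L2_zero L2_zero, of "-1"] by simp
  show ?thesis using adjointable_axpy[OF assms(1) L2_zero assms(2), of c] z by simp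
qed

lemma op_le_unit:
  assumes T: "T \<in> adjointable G" and unit: "\<And>\<xi>. \<xi> \<in> L2 G \<Longrightarrow> l2_le G \<xi> 1 \<Longrightarrow> l2_le G (T \<xi>) C"
  shows "op_le G T C"
  unfolding op_le_def
proof (intro ballI allI impI)
  fix \<xi> D assume \<xi>: "\<xi> \<in> L2 G" "l2_le G \<xi> D"
  show "l2_le G (T \<xi>) (C * D)"
  proof (cases "D = 0")
    \<comment> \<open>Here \<xi> cannot be normalised, but it is zero and \<open>T\<close> sends it
      to zero.\<close>
    case True
    have "\<xi> = (\<lambda>a. 0 * \<xi> a)" using l2_le_pointwise[OF \<xi>(2)] True by (auto simp: fun_eq_iff)
    then have "T \<xi> = (\<lambda>a. 0 * T \<xi> a)" using adjointable_scale[OF T \<xi>(1), of 0] by metis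
    then have "T \<xi> = (\<lambda>_. 0)" by (simp add: fun_eq_iff)
    then show ?thesis using True l2_le_zero by simp
  next
    case False
    then have D: "D > 0" using l2_le_nonneg[OF \<xi>(2)] by simp
    let ?\<zeta> = "\<lambda>a. of_real (1/D) * \<xi> a"
    have "l2_le G ?\<zeta> 1"
      using l2_le_scale[OF \<xi>(2), of "of_real (1/D)"] D by (simp add: norm_divide)
    then have "l2_le G (T ?\<zeta>) C" using \<xi> by (intro unit L2_scale)
    from l2_le_scale[OF this, of "of_real D"]
    show ?thesis unfolding adjointable_scale[OF T \<xi>(1)] using D by (simp add: mult.commute)
  qed
qed

text \<open>Uniform boundedness by Sokal's gliding hump: the signs of the increments are chosen so that
  the \<open>n\<close>-th functional is large at the \<open>n\<close>-th partial sum, and the remaining increments are too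
  small to destroy this.\<close>

lemma gliding_hump:
  fixes \<phi> :: "nat \<Rightarrow> ('g \<Rightarrow> complex) \<Rightarrow> complex" and M :: "nat \<Rightarrow> real"
  assumes lin: "\<And>n \<eta> \<zeta> c. \<eta> \<in> L2 G \<Longrightarrow> \<zeta> \<in> L2 G \<Longrightarrow> \<phi> n (\<lambda>a. \<eta> a + c * \<zeta> a) = \<phi> n \<eta> + c * \<phi> n \<zeta>"
    and bound: "\<And>n \<eta> D. \<eta> \<in> L2 G \<Longrightarrow> l2_le G \<eta> D \<Longrightarrow> cmod (\<phi> n \<eta>) \<le> M n * D"
    and u: "\<And>n. u n \<in> L2 G" "\<And>n. l2_le G (u n) 1" "\<And>n. cmod (\<phi> n (u n)) \<ge> 3/4 * M n"
    and M: "\<And>n. M n \<ge> 4 ^ n"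
  shows "\<exists>\<eta>\<in>L2 G. \<forall>B. \<exists>n. cmod (\<phi> n \<eta>) > B"
proof -
  \<comment> \<open>Increments of size \<open>(1/3)^n\<close> have total size at most
    \<open>(1/3)^n / 2\<close> after step n. Step n itself gains 3/4 of
    \<open>(1/3)^n * M n\<close>, so at least a quarter of this product survives. As
    \<open>M n\<close> is at least \<open>4^n\<close>, the values grow at least like
    \<open>(4/3)^n / 4\<close>.\<close>
  let ?q = "\<lambda>n. (1/3::real) ^ n"
  have "\<exists>\<eta>. \<forall>n. \<eta> n \<in> L2 G \<and> (l2_le G (\<lambda>a. \<eta> (Suc n) a - \<eta> n a) (?q n) \<and>
      cmod (\<phi> n (\<eta> (Suc n))) \<ge> ?q n * (3/4 * M n))"
  proof (rule dependent_nat_choice)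
    show "\<exists>x. x \<in> L2 G" using L2_zero by blast
    fix x n assume x: "x \<in> L2 G"
    let ?c = "complex_of_real (?q n)"
    \<comment> \<open>The values at x + c u and x - c u differ by twice c times the value at u, so
      one of them is large enough, whatever the value at x is.\<close>
    have "\<phi> n (u n) * (2 * ?c) = (\<phi> n x + ?c * \<phi> n (u n)) - (\<phi> n x + (- ?c) * \<phi> n (u n))"
      by (simp add: algebra_simps)
    then have "cmod (\<phi> n (u n)) * (2 * ?q n) = cmod ((\<phi> n x + ?c * \<phi> n (u n)) - (\<phi> n x + (- ?c) * \<phi> n (u n)))"
      by (metis norm_mult norm_of_real abs_of_nonneg of_real_mult of_real_numeral zero_le_power zero_le_divide_1_iff zero_le_numeral zero_le_mult_iff)
    also have "\<dots> \<le> cmod (\<phi> n x + ?c * \<phi> n (u n)) + cmod (\<phi> n x + (- ?c) * \<phi> n (u n))"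
      by (rule norm_triangle_ineq4)
    finally have "cmod (\<phi> n x + ?c * \<phi> n (u n)) \<ge> ?q n * cmod (\<phi> n (u n)) \<or>
        cmod (\<phi> n x + (- ?c) * \<phi> n (u n)) \<ge> ?q n * cmod (\<phi> n (u n))"
      by (auto simp: algebra_simps)
    then obtain c where c: "c = ?c \<or> c = - ?c" "cmod (\<phi> n x + c * \<phi> n (u n)) \<ge> ?q n * cmod (\<phi> n (u n))"
      by blast
    have cn: "cmod c = ?q n" using c(1) by (auto simp: norm_power norm_divide)
    have "?q n * (3/4 * M n) \<le> ?q n * cmod (\<phi> n (u n))" using u(3) by (intro mult_left_mono) auto
    then have "cmod (\<phi> n (\<lambda>a. x a + c * u n a)) \<ge> ?q n * (3/4 * M n)"
      unfolding lin[OF x u(1)] using c(2) by linarith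
    moreover have "l2_le G (\<lambda>a. (x a + c * u n a) - x a) (?q n)"
      using l2_le_scale[OF u(2), of c n] cn by simp
    ultimately show "\<exists>y. y \<in> L2 G \<and> l2_le G (\<lambda>a. y a - x a) (?q n) \<and> cmod (\<phi> n y) \<ge> ?q n * (3/4 * M n)"
      using L2_axpy[OF x u(1), of c n] by (intro exI[of _ "\<lambda>a. x a + c * u n a"]) blast
  qed
  then obtain \<eta> where \<eta>: "\<And>n. \<eta> n \<in> L2 G" "\<And>n. l2_le G (\<lambda>a. \<eta> (Suc n) a - \<eta> n a) (?q n)"
    "\<And>n. cmod (\<phi> n (\<eta> (Suc n))) \<ge> ?q n * (3/4 * M n)" by blast
  have tele: "l2_le G (\<lambda>a. \<eta> (n + k) a - \<eta> n a) (3/2 * ?q n - 3/2 * ?q (n + k))" for n k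
  proof (induction k)
    case 0 show ?case using l2_le_zero by simp
  next
    case (Suc k)
    from l2_le_triangle[OF \<eta>(2) Suc] show ?case by (simp add: field_simps)
  qed
  have diff: "l2_le G (\<lambda>a. \<eta> m a - \<eta> n a) (3/2 * ?q n)" if "m \<ge> n" for m n
    using tele[of n "m - n"] that by (auto elim!: l2_le_mono)
  have small: "\<exists>N. 3/2 * ?q N \<le> \<epsilon>" if "\<epsilon> > 0" for \<epsilon> :: real
  proof -
    have "\<exists>N. ?q N < \<epsilon> * (2/3)" by (rule real_arch_pow_inv) (use that in auto)
    then obtain N where "?q N < \<epsilon> * (2/3)" ..
    then show ?thesis by (intro exI[of _ N]) simp
  qed
  have cau: "\<exists>N. \<forall>m\<ge>N. \<forall>n\<ge>N. l2_le G (\<lambda>a. \<eta> m a - \<eta> n a) \<epsilon>" if e: "\<epsilon> > 0" for \<epsilon>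
  proof -
    from e obtain N where N: "3/2 * ?q N \<le> \<epsilon>/2" using small[of "\<epsilon>/2"] by auto
    have "l2_le G (\<lambda>a. \<eta> m a - \<eta> n a) \<epsilon>" if "m \<ge> N" "n \<ge> N" for m n
    proof -
      have "l2_le G (\<lambda>a. \<eta> m a - \<eta> N a) (\<epsilon>/2)" "l2_le G (\<lambda>a. \<eta> N a - \<eta> n a) (\<epsilon>/2)"
        using l2_le_mono[OF diff[OF that(1)] N] l2_le_mono[OF diff[OF that(2)] N]
        by (simp_all add: l2_le_commute[of G "\<eta> N"])
      from l2_le_triangle[OF this] show ?thesis by simp
    qed
    then show ?thesis by blast
  qed
  obtain \<theta> where \<theta>: "\<theta> \<in> L2 G" "\<And>a. (\<lambda>n. \<eta> n a) \<longlonglongrightarrow> \<theta> a"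
    by (rule L2_complete[OF \<eta>(1) cau]) (assumption | rule that)+
  have large: "cmod (\<phi> n \<theta>) \<ge> (4/3)^n / 4" for n
  proof -
    have "l2_le G (\<lambda>a. \<theta> a - \<eta> (Suc n) a) (3/2 * ?q (Suc n))"
    proof (rule l2_le_limit)
      show "(\<lambda>m. \<eta> m a - \<eta> (Suc n) a) \<longlonglongrightarrow> \<theta> a - \<eta> (Suc n) a" for a by (intro tendsto_intros \<theta>)
      show "\<forall>\<^sub>F m in sequentially. l2_le G (\<lambda>a. \<eta> m a - \<eta> (Suc n) a) (3/2 * ?q (Suc n))"
        using diff unfolding eventually_sequentially by blast
    qed
    then have "cmod (\<phi> n (\<lambda>a. \<theta> a - \<eta> (Suc n) a)) \<le> M n * (3/2 * ?q (Suc n))"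
      by (intro bound L2_diff \<theta> \<eta>)
    moreover have "\<phi> n (\<lambda>a. \<theta> a - \<eta> (Suc n) a) = \<phi> n \<theta> - \<phi> n (\<eta> (Suc n))"
      using lin[OF \<theta>(1) \<eta>(1), of n "-1" "Suc n"] by simp
    ultimately have "cmod (\<phi> n \<theta> - \<phi> n (\<eta> (Suc n))) \<le> M n * (?q n / 2)" by (simp add: field_simps)
    then have "cmod (\<phi> n (\<eta> (Suc n))) - cmod (\<phi> n \<theta>) \<le> M n * (?q n / 2)"
      using norm_triangle_ineq3[of "\<phi> n \<theta>" "\<phi> n (\<eta> (Suc n))"] by linarith
    then have "cmod (\<phi> n \<theta>) \<ge> ?q n * M n / 4" using \<eta>(3)[of n] by (simp add: field_simps)
    moreover have "?q n * 4^n \<le> ?q n * M n" using M by (intro mult_left_mono) auto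
    moreover have "?q n * 4^n = (4/3)^n" by (simp add: power_divide field_simps)
    ultimately show ?thesis by linarith
  qed
  show ?thesis
  proof (intro bexI allI)
    fix B :: real
    obtain n where "4 * B < (4/3::real)^n" using real_arch_pow[of "4/3" "4 * B"] by auto
    then show "\<exists>n. cmod (\<phi> n \<theta>) > B" using large[of n] by (intro exI[of _ n]) linarith
  qed (rule \<theta>)
qed

text \<open>If \<open>T\<close> is unbounded, choose \<xi> n in the unit ball with T (\<xi> n) large
  and a unit where this is nearly attained. Pairing with T (\<xi> n) at that point gives scalar
  functionals of \<eta> with unbounded norms. Yet for fixed \<eta> they are bounded by any bound of
  S \<eta>, because the adjoint moves \<open>T\<close> away from \<xi> n.
  \<open>gliding_hump\<close> rules this out.\<close>

lemma adjointable_bounded: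
  assumes T: "T \<in> adjointable G" shows "\<exists>C. op_le G T C"
proof (rule ccontr)
  assume unb: "\<nexists>C. op_le G T C"
  obtain S where S: "adjoint_pair G T S" using T by (auto simp: adjointable_iff)
  note SD = adjoint_pairD[OF S]
  have "\<exists>\<xi> x. \<xi> \<in> L2 G \<and> l2_le G \<xi> 1 \<and> l2_norm G (T \<xi>) \<ge> 4 ^ n \<and>
      cmod (l2_inner G (T \<xi>) (T \<xi>) x) \<ge> 3/4 * (l2_norm G (T \<xi>))\<^sup>2" for n :: nat
  proof -
    have "\<not> op_le G T (4 ^ n)" using unb by blast
    then obtain \<xi> where \<xi>: "\<xi> \<in> L2 G" "l2_le G \<xi> 1" "\<not> l2_le G (T \<xi>) (4 ^ n)"
      using op_le_unit[OF T] by blast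
    obtain C where C: "l2_le G (T \<xi>) C" using L2_l2_le SD(1) \<xi>(1) by blast
    let ?N = "l2_norm G (T \<xi>)"
    have N: "?N > 4 ^ n" using l2_le_mono[OF l2_le_norm[OF C]] \<xi>(3) by (meson not_le)
    then have N0: "?N > 0" by (meson less_trans zero_less_numeral zero_less_power)
    \<comment> \<open>The supremum over the units need not be attained, so a point is taken where at
      least 9/10 of the norm is reached; the square of 9/10 exceeds the 3/4 that
      \<open>gliding_hump\<close> asks for.\<close>
    have "\<exists>x. cmod (l2_inner G (T \<xi>) (T \<xi>) x) > (9/10 * ?N)\<^sup>2"
    proof (rule ccontr)
      assume "\<nexists>x. cmod (l2_inner G (T \<xi>) (T \<xi>) x) > (9/10 * ?N)\<^sup>2"
      then have "l2_le G (T \<xi>) (9/10 * ?N)"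
        using N0 by (intro l2_inner_self_le[OF C]) (auto simp: not_less)
      from l2_norm_le[OF this] N0 show False by simp
    qed
    then obtain x where "cmod (l2_inner G (T \<xi>) (T \<xi>) x) > (9/10 * ?N)\<^sup>2" ..
    moreover have "(9/10 * ?N)\<^sup>2 \<ge> 3/4 * ?N\<^sup>2" by (simp add: power_mult_distrib power_divide)
    ultimately have "cmod (l2_inner G (T \<xi>) (T \<xi>) x) \<ge> 3/4 * ?N\<^sup>2" by linarith
    then show ?thesis using \<xi> N by (intro exI[of _ \<xi>] exI[of _ x]) auto
  qed
  then obtain \<xi> x where \<xi>: "\<And>n. \<xi> n \<in> L2 G" "\<And>n. l2_le G (\<xi> n) 1"
    and N: "\<And>n::nat. l2_norm G (T (\<xi> n)) \<ge> 4 ^ n"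
    and x: "\<And>n. cmod (l2_inner G (T (\<xi> n)) (T (\<xi> n)) (x n)) \<ge> 3/4 * (l2_norm G (T (\<xi> n)))\<^sup>2"
    by metis
  let ?N = "\<lambda>n. l2_norm G (T (\<xi> n))"
  let ?\<phi> = "\<lambda>n \<eta>. l2_inner G (T (\<xi> n)) \<eta> (x n)"
  have le: "l2_le G (T (\<xi> n)) (?N n)" for n using L2_l2_le SD(1) \<xi>(1) l2_le_norm by blast
  have N0: "?N n > 0" for n using N[of n] by (meson less_le_trans zero_less_numeral zero_less_power)
  have "\<exists>\<eta>\<in>L2 G. \<forall>B. \<exists>n. cmod (?\<phi> n \<eta>) > B"
  proof (rule gliding_hump)
    show "?\<phi> n (\<lambda>a. \<eta> a + c * \<zeta> a) = ?\<phi> n \<eta> + c * ?\<phi> n \<zeta>" if "\<eta> \<in> L2 G" "\<zeta> \<in> L2 G" for n \<eta> \<zeta> c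
      using l2_inner_add_right[OF le] L2_l2_le that by metis
    show "cmod (?\<phi> n \<eta>) \<le> ?N n * D" if "\<eta> \<in> L2 G" "l2_le G \<eta> D" for n \<eta> D
      by (rule l2_inner_bound[OF le that(2)])
    show u: "(\<lambda>a. of_real (1 / ?N n) * T (\<xi> n) a) \<in> L2 G" for n
      by (intro L2_scale SD \<xi>)
    show "l2_le G (\<lambda>a. of_real (1 / ?N n) * T (\<xi> n) a) 1" for n
      using l2_le_scale[OF le, of "of_real (1 / ?N n)" n] N0[of n] by (simp add: norm_divide)
    show "3/4 * ?N n \<le> cmod (?\<phi> n (\<lambda>a. of_real (1 / ?N n) * T (\<xi> n) a))" for n
    proof -
      have "?\<phi> n (\<lambda>a. 0 + of_real (1 / ?N n) * T (\<xi> n) a) = ?\<phi> n (\<lambda>_. 0) + of_real (1 / ?N n) * ?\<phi> n (T (\<xi> n))"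
        by (rule l2_inner_add_right[OF le l2_le_zero le])
      then have "cmod (?\<phi> n (\<lambda>a. of_real (1 / ?N n) * T (\<xi> n) a)) = cmod (?\<phi> n (T (\<xi> n))) / ?N n"
        using N0[of n] by (simp add: norm_mult norm_divide l2_inner_def)
      also have "\<dots> \<ge> 3/4 * ?N n" using x[of n] N0[of n] by (simp add: pos_le_divide_eq power2_eq_square)
      finally show ?thesis .
    qed
    show "4 ^ n \<le> ?N n" for n by (rule N)
  qed
  then obtain \<eta> where \<eta>: "\<eta> \<in> L2 G" "\<And>B. \<exists>n. cmod (?\<phi> n \<eta>) > B" by blast
  obtain C where C: "l2_le G (S \<eta>) C" using L2_l2_le SD(2) \<eta>(1) by blast
  have "cmod (?\<phi> n \<eta>) \<le> C" for n
  proof -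
    have "?\<phi> n \<eta> = cnj (l2_inner G (S \<eta>) (\<xi> n) (x n))"
      using SD(3)[OF \<eta>(1) \<xi>(1)] l2_inner_cnj by metis
    then show ?thesis using l2_inner_bound[OF C \<xi>(2)] by simp
  qed
  then show False using \<eta>(2)[of C] by (meson not_le)
qed

section \<open>The operator norm on adjointable operators\<close>

lemma op_norm_le: "op_le G T C \<Longrightarrow> 0 \<le> C \<Longrightarrow> op_norm G T \<le> C"
proof -
  assume T: "op_le G T C" "0 \<le> C"
  have z: "(\<lambda>_. 0) \<in> {\<xi> \<in> L2 G. l2_norm G \<xi> \<le> 1}"
    using L2_zero l2_norm_le[OF l2_le_zero] by auto
  show ?thesis unfolding op_norm_def
  proof (rule cSUP_least)
    fix \<xi> assume "\<xi> \<in> {\<xi> \<in> L2 G. l2_norm G \<xi> \<le> 1}"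
    then have \<xi>: "\<xi> \<in> L2 G" "l2_norm G \<xi> \<le> 1" by auto
    then have "l2_le G \<xi> 1" using L2_l2_le l2_le_norm l2_le_mono by metis
    from op_leD[OF T(1) \<xi>(1) this] show "l2_norm G (T \<xi>) \<le> C" using l2_norm_le by simp
  qed (use z in blast)
qed

text \<open>\<open>adjointable_bounded\<close> makes the defining set of \<open>op_norm\<close>
  bounded above, so that the supremum really bounds the operator.\<close>

lemma op_le_norm: "T \<in> adjointable G \<Longrightarrow> op_le G T (op_norm G T)"
proof -
  assume T: "T \<in> adjointable G"
  obtain C where C: "op_le G T C" using adjointable_bounded[OF T] by blast
  show ?thesis
  proof (rule op_le_unit[OF T])
    fix \<xi> assume \<xi>: "\<xi> \<in> L2 G" "l2_le G \<xi> 1"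
    have "l2_norm G (T \<xi>) \<le> op_norm G T" unfolding op_norm_def
    proof (rule cSUP_upper)
      show "\<xi> \<in> {\<xi> \<in> L2 G. l2_norm G \<xi> \<le> 1}" using \<xi> l2_norm_le by simp
      show "bdd_above ((\<lambda>\<xi>. l2_norm G (T \<xi>)) ` {\<xi> \<in> L2 G. l2_norm G \<xi> \<le> 1})"
      proof (rule bdd_aboveI2)
        fix \<xi> assume "\<xi> \<in> {\<xi> \<in> L2 G. l2_norm G \<xi> \<le> 1}"
        then have \<xi>: "\<xi> \<in> L2 G" "l2_norm G \<xi> \<le> 1" by auto
        then have "l2_le G \<xi> 1" using L2_l2_le l2_le_norm l2_le_mono by metis
        from op_leD[OF C \<xi>(1) this] show "l2_norm G (T \<xi>) \<le> C" using l2_norm_le by simp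
      qed
    qed
    moreover have "l2_le G (T \<xi>) (l2_norm G (T \<xi>))"
      using l2_le_norm op_leD[OF C \<xi>] by blast
    ultimately show "l2_le G (T \<xi>) (op_norm G T)" using l2_le_mono by blast
  qed
qed

lemma op_norm_nonneg: "T \<in> adjointable G \<Longrightarrow> 0 \<le> op_norm G T"
proof -
  assume T: "T \<in> adjointable G"
  have "l2_le G (\<lambda>_. 0) 1" by (rule l2_le_mono[OF l2_le_zero]) simp
  from l2_le_nonneg[OF op_leD[OF op_le_norm[OF T] L2_zero this]] show ?thesis by simp
qed

lemma adjoint_pair_op_diff:
  assumes "adjoint_pair G T S" "adjoint_pair G T' S'"
  shows "adjoint_pair G (op_diff G T T') (op_diff G S S')"
proof -
  note D = adjoint_pairD[OF assms(1)] and D' = adjoint_pairD[OF assms(2)]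
  show ?thesis unfolding adjoint_pair_def
  proof (intro conjI ballI)
    show "op_diff G T T' \<in> L2 G \<rightarrow>\<^sub>E L2 G" "op_diff G S S' \<in> L2 G \<rightarrow>\<^sub>E L2 G"
      unfolding op_diff_def using D D' L2_diff by auto
    fix \<eta> \<xi> assume \<eta>: "\<eta> \<in> L2 G" and \<xi>: "\<xi> \<in> L2 G"
    obtain A B C E F H where b: "l2_le G \<eta> A" "l2_le G (T \<xi>) B" "l2_le G (T' \<xi>) C"
       "l2_le G \<xi> E" "l2_le G (S \<eta>) F" "l2_le G (S' \<eta>) H"
      using L2_l2_le[OF \<eta>] L2_l2_le[OF \<xi>] L2_l2_le[OF D(1)[OF \<xi>]] L2_l2_le[OF D'(1)[OF \<xi>]]
        L2_l2_le[OF D(2)[OF \<eta>]] L2_l2_le[OF D'(2)[OF \<eta>]] by blast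
    show "l2_inner G \<eta> (op_diff G T T' \<xi>) = l2_inner G (op_diff G S S' \<eta>) \<xi>"
      using \<eta> \<xi> by (intro ext) (simp add: op_diff_def l2_inner_diff_right[OF b(1-3)]
        l2_inner_diff_left[OF b(4-6)] D D')
  qed
qed

lemma op_diff_adjointable:
  "T \<in> adjointable G \<Longrightarrow> S \<in> adjointable G \<Longrightarrow> op_diff G T S \<in> adjointable G"
  unfolding adjointable_iff using adjoint_pair_op_diff by blast

lemma op_norm_triangle:
  assumes "T \<in> adjointable G" "R \<in> adjointable G" "S \<in> adjointable G"
  shows "op_norm G (op_diff G T S) \<le> op_norm G (op_diff G T R) + op_norm G (op_diff G R S)"
  by (intro op_norm_le op_le_op_diff_triangle[where R=R] op_le_norm op_diff_adjointable assms
      add_nonneg_nonneg op_norm_nonneg)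

lemma op_norm_commute:
  assumes "T \<in> adjointable G" "S \<in> adjointable G"
  shows "op_norm G (op_diff G T S) = op_norm G (op_diff G S T)"
proof -
  have "op_norm G (op_diff G T S) \<le> op_norm G (op_diff G S T)"
    if "T \<in> adjointable G" "S \<in> adjointable G" for T S
    using that by (intro op_norm_le op_norm_nonneg op_diff_adjointable)
      (auto simp: op_le_op_diff_commute[of G T] intro: op_le_norm op_diff_adjointable)
  then show ?thesis using assms by (meson antisym)
qed

lemma op_norm_diff_zero:
  assumes "T \<in> adjointable G" "S \<in> adjointable G" "op_norm G (op_diff G T S) \<le> 0"
  shows "T = S"
proof (rule adjointable_eqI[OF assms(1,2)])
  fix \<xi> assume \<xi>: "\<xi> \<in> L2 G"
  obtain C where C: "l2_le G \<xi> C" using L2_l2_le \<xi> by blast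
  have "op_norm G (op_diff G T S) = 0"
    using assms op_norm_nonneg[OF op_diff_adjointable] by (meson antisym)
  then have "l2_le G (op_diff G T S \<xi>) 0"
    using op_leD[OF op_le_norm[OF op_diff_adjointable[OF assms(1,2)]] \<xi> C] by simp
  from l2_le_pointwise[OF this] show "T \<xi> = S \<xi>"
    using \<xi> by (auto simp: op_diff_def fun_eq_iff)
qed

text \<open>With N the norm of S \<eta>, pairing S \<eta> with itself equals pairing \<eta> with T
  (S \<eta>). This bounds the square of N by D * C * N, and one factor N cancels.\<close>

lemma adjoint_op_le:
  assumes "adjoint_pair G T S" "op_le G T C" "0 \<le> C"
  shows "op_le G S C"
  unfolding op_le_def
proof (intro ballI allI impI)
  fix \<eta> D assume \<eta>: "\<eta> \<in> L2 G" "l2_le G \<eta> D"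
  note SD = adjoint_pairD[OF assms(1)]
  obtain B where B: "l2_le G (S \<eta>) B" using L2_l2_le SD(2) \<eta>(1) by blast
  let ?N = "l2_norm G (S \<eta>)"
  have N: "l2_le G (S \<eta>) ?N" by (rule l2_le_norm[OF B])
  have D0: "0 \<le> D" and N0: "0 \<le> ?N" using l2_le_nonneg \<eta> N by blast+
  have "l2_le G (S \<eta>) (sqrt (D * (C * ?N)))"
  proof (rule l2_inner_self_le[OF N])
    show "0 \<le> sqrt (D * (C * ?N))" using D0 N0 assms(3) by simp
    fix x
    have "cmod (l2_inner G (S \<eta>) (S \<eta>) x) = cmod (l2_inner G \<eta> (T (S \<eta>)) x)"
      using SD(3)[OF \<eta>(1) SD(2)[OF \<eta>(1)]] by simp
    also have "\<dots> \<le> D * (C * ?N)"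
      by (intro l2_inner_bound \<eta> op_leD[OF assms(2)] SD N)
    also have "\<dots> = (sqrt (D * (C * ?N)))\<^sup>2" using D0 N0 assms(3) by simp
    finally show "cmod (l2_inner G (S \<eta>) (S \<eta>) x) \<le> (sqrt (D * (C * ?N)))\<^sup>2" .
  qed
  from l2_norm_le[OF this] have "?N\<^sup>2 \<le> (sqrt (D * (C * ?N)))\<^sup>2" using N0 by (intro power_mono)
  also have "\<dots> = (C * D) * ?N" using D0 N0 assms(3) by simp
  finally have "?N \<le> C * D" using N0 D0 assms(3)
    by (cases "?N = 0") (auto simp: power2_eq_square)
  with N show "l2_le G (S \<eta>) (C * D)" by (rule l2_le_mono)
qed

text \<open>The limit is taken vector by vector. Adjointability is left out of the assumptions so
  that the lemma can serve both for a sequence of operators and for the sequence of their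
  adjoints.\<close>

lemma op_limit:
  fixes T :: "nat \<Rightarrow> 'g operator"
  assumes T: "\<And>n \<xi>. \<xi> \<in> L2 G \<Longrightarrow> T n \<xi> \<in> L2 G"
    and Cauchy: "\<And>\<epsilon>. \<epsilon> > 0 \<Longrightarrow> \<exists>N. \<forall>m\<ge>N. \<forall>n\<ge>N. op_le G (op_diff G (T m) (T n)) \<epsilon>"
  obtains R where "R \<in> L2 G \<rightarrow>\<^sub>E L2 G" "\<And>\<epsilon>. \<epsilon> > 0 \<Longrightarrow> \<exists>N. \<forall>n\<ge>N. op_le G (op_diff G R (T n)) \<epsilon>"
proof -
  have "\<exists>\<eta>. \<eta> \<in> L2 G \<and> (\<forall>a. (\<lambda>n. T n \<xi> a) \<longlonglongrightarrow> \<eta> a)" if \<xi>: "\<xi> \<in> L2 G" for \<xi>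
  proof -
    obtain C where C: "C > 0" "l2_le G \<xi> C" using L2_l2_le_pos[OF \<xi>] by blast
    have "\<exists>N. \<forall>m\<ge>N. \<forall>n\<ge>N. l2_le G (\<lambda>a. T m \<xi> a - T n \<xi> a) \<epsilon>" if e: "\<epsilon> > 0" for \<epsilon>
    proof -
      obtain N where N: "\<forall>m\<ge>N. \<forall>n\<ge>N. op_le G (op_diff G (T m) (T n)) (\<epsilon> / C)"
        using Cauchy[OF divide_pos_pos[OF e C(1)]] by (rule exE)
      have "l2_le G (\<lambda>a. T m \<xi> a - T n \<xi> a) \<epsilon>" if "m \<ge> N" "n \<ge> N" for m n
      proof -
        have "op_le G (op_diff G (T m) (T n)) (\<epsilon> / C)" by (rule N[rule_format, OF that])
        from op_leD[OF this \<xi> C(2)] show ?thesis using C \<xi> by (simp add: op_diff_def)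
      qed
      then show ?thesis by blast
    qed
    then show ?thesis using L2_complete[of "\<lambda>n. T n \<xi>"] T[OF \<xi>] by metis
  qed
  then obtain R0 where R0: "\<And>\<xi>. \<xi> \<in> L2 G \<Longrightarrow> R0 \<xi> \<in> L2 G"
     "\<And>\<xi> a. \<xi> \<in> L2 G \<Longrightarrow> (\<lambda>n. T n \<xi> a) \<longlonglongrightarrow> R0 \<xi> a" by metis
  show ?thesis
  proof (rule that[of "restrict R0 (L2 G)"])
    show "restrict R0 (L2 G) \<in> L2 G \<rightarrow>\<^sub>E L2 G" using R0 by auto
    fix \<epsilon> :: real assume "\<epsilon> > 0"
    then obtain N where N: "\<forall>m\<ge>N. \<forall>n\<ge>N. op_le G (op_diff G (T m) (T n)) \<epsilon>" using Cauchy by blast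
    have "op_le G (op_diff G (restrict R0 (L2 G)) (T n)) \<epsilon>" if n: "n \<ge> N" for n
      unfolding op_le_def
    proof (intro ballI allI impI)
      fix \<xi> D assume \<xi>: "\<xi> \<in> L2 G" "l2_le G \<xi> D"
      have "l2_le G (\<lambda>a. R0 \<xi> a - T n \<xi> a) (\<epsilon> * D)"
      proof (rule l2_le_limit)
        show "(\<lambda>m. T m \<xi> a - T n \<xi> a) \<longlonglongrightarrow> R0 \<xi> a - T n \<xi> a" for a
          by (intro tendsto_intros R0 \<xi>)
        have "l2_le G (\<lambda>a. T m \<xi> a - T n \<xi> a) (\<epsilon> * D)" if "m \<ge> N" for m
        proof -
          have "op_le G (op_diff G (T m) (T n)) \<epsilon>" by (rule N[rule_format, OF that n])
          from op_leD[OF this \<xi>] show ?thesis using \<xi> by (simp add: op_diff_def)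
        qed
        then show "\<forall>\<^sub>F m in sequentially. l2_le G (\<lambda>a. T m \<xi> a - T n \<xi> a) (\<epsilon> * D)"
          unfolding eventually_sequentially by blast
      qed
      then show "l2_le G (op_diff G (restrict R0 (L2 G)) (T n) \<xi>) (\<epsilon> * D)"
        using \<xi> by (simp add: op_diff_def)
    qed
    then show "\<exists>N. \<forall>n\<ge>N. op_le G (op_diff G (restrict R0 (L2 G)) (T n)) \<epsilon>" by blast
  qed
qed

text \<open>By \<open>adjoint_op_le\<close> the adjoints form a Cauchy sequence as well. Both
  sequences converge, and the adjoint relation passes to the two limits.\<close>

lemma adjointable_complete:
  fixes T :: "nat \<Rightarrow> 'g operator"
  assumes T: "\<And>n. T n \<in> adjointable G"
    and Cauchy: "\<And>\<epsilon>. \<epsilon> > 0 \<Longrightarrow> \<exists>N. \<forall>m\<ge>N. \<forall>n\<ge>N. op_norm G (op_diff G (T m) (T n)) < \<epsilon>"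
  obtains R where "R \<in> adjointable G" "(\<lambda>n. op_norm G (op_diff G R (T n))) \<longlonglongrightarrow> 0"
proof -
  obtain S where S: "\<And>n. adjoint_pair G (T n) (S n)" using T unfolding adjointable_iff by metis
  have CT: "\<exists>N. \<forall>m\<ge>N. \<forall>n\<ge>N. op_le G (op_diff G (T m) (T n)) \<epsilon>" if "\<epsilon> > 0" for \<epsilon>
    using Cauchy[OF that] op_le_norm[OF op_diff_adjointable[OF T T]] by (meson op_le_mono less_imp_le)
  have CS: "\<exists>N. \<forall>m\<ge>N. \<forall>n\<ge>N. op_le G (op_diff G (S m) (S n)) \<epsilon>" if "\<epsilon> > 0" for \<epsilon>
    using CT[OF that] adjoint_op_le[OF adjoint_pair_op_diff[OF S S]] that by (meson less_imp_le)
  obtain R where R: "R \<in> L2 G \<rightarrow>\<^sub>E L2 G" "\<And>\<epsilon>. \<epsilon> > 0 \<Longrightarrow> \<exists>N. \<forall>n\<ge>N. op_le G (op_diff G R (T n)) \<epsilon>"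
    using op_limit[of T] adjoint_pairD(1)[OF S] CT by metis
  obtain Q where Q: "Q \<in> L2 G \<rightarrow>\<^sub>E L2 G" "\<And>\<epsilon>. \<epsilon> > 0 \<Longrightarrow> \<exists>N. \<forall>n\<ge>N. op_le G (op_diff G Q (S n)) \<epsilon>"
    using op_limit[of S] adjoint_pairD(2)[OF S] CS by metis
  have "l2_inner G \<eta> (R \<xi>) x = l2_inner G (Q \<eta>) \<xi> x" if \<eta>: "\<eta> \<in> L2 G" and \<xi>: "\<xi> \<in> L2 G" for \<eta> \<xi> x
  proof -
    obtain C D where C: "C > 0" "l2_le G \<eta> C" and D: "D > 0" "l2_le G \<xi> D"
      using L2_l2_le_pos[OF \<eta>] L2_l2_le_pos[OF \<xi>] by blast
    have "cmod (l2_inner G \<eta> (R \<xi>) x - l2_inner G (Q \<eta>) \<xi> x) \<le> 0 + e" if "e > 0" for e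
    proof -
      \<comment> \<open>Each of the two errors below is at most this number times C * D, that is,
        half of e.\<close>
      let ?\<epsilon> = "e / (2 * (C * D))"
      have "?\<epsilon> > 0" using C D that by simp
      then obtain N1 N2 where "\<forall>n\<ge>N1. op_le G (op_diff G R (T n)) ?\<epsilon>" "\<forall>n\<ge>N2. op_le G (op_diff G Q (S n)) ?\<epsilon>"
        using R(2) Q(2) by metis
      then obtain n where n: "op_le G (op_diff G R (T n)) ?\<epsilon>" "op_le G (op_diff G Q (S n)) ?\<epsilon>"
        by (meson max.cobounded1 max.cobounded2)
      have RQ: "R \<xi> \<in> L2 G" "Q \<eta> \<in> L2 G" "T n \<xi> \<in> L2 G" "S n \<eta> \<in> L2 G"
        using R Q \<xi> \<eta> adjoint_pairD[OF S] by auto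
      obtain b1 b2 b3 b4 where b: "l2_le G (R \<xi>) b1" "l2_le G (T n \<xi>) b2" "l2_le G (Q \<eta>) b3" "l2_le G (S n \<eta>) b4"
        using L2_l2_le[OF RQ(1)] L2_l2_le[OF RQ(2)] L2_l2_le[OF RQ(3)] L2_l2_le[OF RQ(4)] by blast
      have 1: "cmod (l2_inner G \<eta> (\<lambda>a. R \<xi> a - T n \<xi> a) x) \<le> C * (?\<epsilon> * D)"
        using op_leD[OF n(1) \<xi> D(2)] \<xi> by (intro l2_inner_bound C) (simp add: op_diff_def)
      have 2: "cmod (l2_inner G (\<lambda>a. Q \<eta> a - S n \<eta> a) \<xi> x) \<le> (?\<epsilon> * C) * D"
        using op_leD[OF n(2) \<eta> C(2)] \<eta> by (intro l2_inner_bound D) (simp add: op_diff_def)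
      have "l2_inner G \<eta> (R \<xi>) x - l2_inner G (Q \<eta>) \<xi> x =
         l2_inner G \<eta> (\<lambda>a. R \<xi> a - T n \<xi> a) x - l2_inner G (\<lambda>a. Q \<eta> a - S n \<eta> a) \<xi> x"
        using adjoint_pairD(3)[OF S \<eta> \<xi>, of n]
        by (simp add: l2_inner_diff_right[OF C(2) b(1,2)] l2_inner_diff_left[OF D(2) b(3,4)])
      also have "cmod \<dots> \<le> C * (?\<epsilon> * D) + (?\<epsilon> * C) * D"
        by (rule order_trans[OF norm_triangle_ineq4 add_mono[OF 1 2]])
      also have "\<dots> = e" using C D by (simp add: field_simps)
      finally show ?thesis by simp
    qed
    from field_le_epsilon[OF this] show ?thesis by simp
  qed
  then have "adjoint_pair G R Q" unfolding adjoint_pair_def using R Q by auto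
  then have RA: "R \<in> adjointable G" using adjointable_iff by blast
  moreover have "(\<lambda>n. op_norm G (op_diff G R (T n))) \<longlonglongrightarrow> 0"
  proof (rule LIMSEQ_I)
    fix r :: real assume "r > 0"
    then obtain N where N: "\<forall>n\<ge>N. op_le G (op_diff G R (T n)) (r/2)" using R(2)[of "r/2"] by auto
    have "norm (op_norm G (op_diff G R (T n)) - 0) < r" if "n \<ge> N" for n
      using op_norm_le[of "op_diff G R (T n)" "r/2"] N that \<open>r > 0\<close>
        op_norm_nonneg[OF op_diff_adjointable[OF RA T], of n] by auto
    then show "\<exists>no. \<forall>n\<ge>no. norm (op_norm G (op_diff G R (T n)) - 0) < r" by blast
  qed
  ultimately show ?thesis using that by blast
qed

end

subsection \<open>Convolution\<close>

definition conv :: "'g groupoid \<Rightarrow> ('g \<Rightarrow> complex) \<Rightarrow> ('g \<Rightarrow> complex) \<Rightarrow> 'g \<Rightarrow> complex"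
  where "conv G f g c = (\<Sum>\<^sub>\<infinity>a\<in>fiber G (src G c). f (comp G c (ginv G a)) * g a)"

lemma left_reg_apply: "\<xi> \<in> L2 G \<Longrightarrow> left_reg G f \<xi> = conv G f \<xi>"
  unfolding left_reg_def conv_def by simp

lemma right_op_apply: "\<xi> \<in> L2 G \<Longrightarrow> right_op G g \<xi> = conv G \<xi> g"
  unfolding right_op_def conv_def by (simp add: mult.commute)

lemma conv_eq_sum:
  assumes "finite A" "A \<subseteq> fiber G (src G c)"
    and "\<And>a. a \<in> fiber G (src G c) \<Longrightarrow> a \<notin> A \<Longrightarrow> f (comp G c (ginv G a)) * g a = 0"
  shows "conv G f g c = (\<Sum>a\<in>A. f (comp G c (ginv G a)) * g a)"
proof -
  have "conv G f g c = (\<Sum>\<^sub>\<infinity>a\<in>A. f (comp G c (ginv G a)) * g a)"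
    unfolding conv_def by (rule infsum_cong_neutral) (use assms in auto)
  then show ?thesis using assms(1) by simp
qed

lemma L2_set_sum_le: "L2_set (\<lambda>c. \<Sum>a\<in>B. h a c) F \<le> (\<Sum>a\<in>B. L2_set (h a) F)"
proof (induction B rule: infinite_finite_induct)
  case (insert a B)
  have "L2_set (\<lambda>c. h a c + (\<Sum>a\<in>B. h a c)) F \<le> L2_set (h a) F + L2_set (\<lambda>c. \<Sum>a\<in>B. h a c) F"
    by (rule L2_set_triangle_ineq)
  then show ?case using insert by simp
qed (simp_all add: L2_set_def)

text \<open>The last step of the density arguments. The sign of K is left open: for nonzero z the
  case e = 1 forces K to be positive, and a smaller e then gives a contradiction.\<close>

lemma eq_zeroI:
  fixes z :: complex
  assumes "\<And>e. e > 0 \<Longrightarrow> cmod z \<le> K * e"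
  shows "z = 0"
proof (rule ccontr)
  assume z: "z \<noteq> 0"
  have "0 < cmod z" using z by simp
  also have "\<dots> \<le> K" using assms[of 1] by simp
  finally have K: "K > 0" .
  from assms[of "cmod z / (2 * K)"] z K show False by (simp add: field_simps)
qed

context groupoid
begin

lemma src_quotient: "src G c = src G a \<Longrightarrow> src G (comp G c (ginv G a)) = rng G a"
  and rng_quotient: "src G c = src G a \<Longrightarrow> rng G (comp G c (ginv G a)) = rng G c"
  by (simp_all add: comp_src comp_rng rng_inv src_inv)

lemma ginv_quotient: "src G c = src G a \<Longrightarrow> ginv G (comp G c (ginv G a)) = comp G a (ginv G c)"
  by (simp add: ginv_comp rng_inv)

lemma quotient_inj_left: "inj_on (\<lambda>c. comp G c (ginv G a)) (fiber G (src G a))"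
  by (rule inj_on_inverseI[where g="\<lambda>b. comp G b a"]) (simp add: fiber_def cancel_right')

lemma quotient_inj_right: "inj_on (\<lambda>a. comp G c (ginv G a)) (fiber G (src G c))"
proof (rule inj_on_inverseI[where g="\<lambda>b. comp G (ginv G b) c"])
  fix a assume "a \<in> fiber G (src G c)"
  then show "comp G (ginv G (comp G c (ginv G a))) c = a"
    by (simp add: fiber_def ginv_quotient cancel_right')
qed

end

context etale_groupoid
begin

text \<open>For fixed c the quotient c a^-1 embeds a row into the points of L with the range of c;
  for fixed a it embeds a column into the points of L whose source is the range of a. Both sets are
  uniformly finite because \<open>rng\<close> and \<open>src\<close> are locally injective.\<close>

lemma quotient_card_bound:
  assumes "compact L"
  obtains N :: nat where
    "\<And>c. finite {a \<in> fiber G (src G c). comp G c (ginv G a) \<in> L}"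
    "\<And>c. card {a \<in> fiber G (src G c). comp G c (ginv G a) \<in> L} \<le> N"
    "\<And>a. finite {c \<in> fiber G (src G a). comp G c (ginv G a) \<in> L}"
    "\<And>a. card {c \<in> fiber G (src G a). comp G c (ginv G a) \<in> L} \<le> N"
    "\<And>x. card (fiber G x \<inter> L) \<le> N"
proof -
  obtain N1 :: nat where N1: "\<And>y. finite {a \<in> L. src G a = y} \<and> card {a \<in> L. src G a = y} \<le> N1"
    using src_fiber_card_bound[OF assms] by blast
  obtain N2 :: nat where N2: "\<And>y. finite {a \<in> L. rng G a = y} \<and> card {a \<in> L. rng G a = y} \<le> N2"
    using rng_fiber_card_bound[OF assms] by blast
  have row: "inj_on (\<lambda>a. comp G c (ginv G a)) {a \<in> fiber G (src G c). comp G c (ginv G a) \<in> L}"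
    "(\<lambda>a. comp G c (ginv G a)) ` {a \<in> fiber G (src G c). comp G c (ginv G a) \<in> L} \<subseteq> {b \<in> L. rng G b = rng G c}" for c
    by (rule inj_on_subset[OF quotient_inj_right]) (auto simp: fiber_def rng_quotient)
  have col: "inj_on (\<lambda>c. comp G c (ginv G a)) {c \<in> fiber G (src G a). comp G c (ginv G a) \<in> L}"
    "(\<lambda>c. comp G c (ginv G a)) ` {c \<in> fiber G (src G a). comp G c (ginv G a) \<in> L} \<subseteq> {b \<in> L. src G b = rng G a}" for a
    by (rule inj_on_subset[OF quotient_inj_left]) (auto simp: fiber_def src_quotient)
  show ?thesis
  proof (rule that[of "max N1 N2"])
    show "finite {a \<in> fiber G (src G c). comp G c (ginv G a) \<in> L}" for c
      using row N2 by (rule inj_on_finite[OF _ _ conjunct1])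
    show "card {a \<in> fiber G (src G c). comp G c (ginv G a) \<in> L} \<le> max N1 N2" for c
      using card_inj_on_le[OF row, of c] N2[of "rng G c"] by linarith
    show "finite {c \<in> fiber G (src G a). comp G c (ginv G a) \<in> L}" for a
      using col N1 by (rule inj_on_finite[OF _ _ conjunct1])
    show "card {c \<in> fiber G (src G a). comp G c (ginv G a) \<in> L} \<le> max N1 N2" for a
      using card_inj_on_le[OF col, of a] N1[of "rng G a"] by linarith
    have "fiber G x \<inter> L = {a \<in> L. src G a = x}" for x by (auto simp: fiber_def)
    then show "card (fiber G x \<inter> L) \<le> max N1 N2" for x using N1[of x] by (simp add: le_max_iff_disj)
  qed
qed

lemma conv_left_sum:
  assumes "f \<in> Cc"
  shows "finite {a \<in> fiber G (src G c). comp G c (ginv G a) \<in> supp f}"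
    and "conv G f \<xi> c = (\<Sum>a\<in>{a \<in> fiber G (src G c). comp G c (ginv G a) \<in> supp f}.
           f (comp G c (ginv G a)) * \<xi> a)"
proof -
  show fin: "finite {a \<in> fiber G (src G c). comp G c (ginv G a) \<in> supp f}"
    by (rule quotient_card_bound[OF Cc_compact_supp[OF assms]])
  show "conv G f \<xi> c = (\<Sum>a\<in>{a \<in> fiber G (src G c). comp G c (ginv G a) \<in> supp f}.
           f (comp G c (ginv G a)) * \<xi> a)"
    by (rule conv_eq_sum[OF fin]) (auto simp: zero_outside_supp)
qed

lemma conv_right_sum:
  assumes "g \<in> Cc"
  shows "conv G \<xi> g c = (\<Sum>a\<in>fiber G (src G c) \<inter> supp g. \<xi> (comp G c (ginv G a)) * g a)"
  by (rule conv_eq_sum[OF finite_fiber_Int_compact[OF Cc_compact_supp[OF assms]]])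
    (auto simp: zero_outside_supp)

lemma conv_diff_right: "f \<in> Cc \<Longrightarrow> conv G f (\<lambda>a. \<xi> a - \<eta> a) = (\<lambda>c. conv G f \<xi> c - conv G f \<eta> c)"
  by (simp add: fun_eq_iff conv_left_sum(2) sum_subtractf right_diff_distrib)

lemma conv_diff_left: "g \<in> Cc \<Longrightarrow> conv G (\<lambda>a. \<xi> a - \<eta> a) g = (\<lambda>c. conv G \<xi> g c - conv G \<eta> g c)"
  by (simp add: fun_eq_iff conv_right_sum sum_subtractf left_diff_distrib)

lemma conv_diff_kernel:
  assumes "f \<in> Cc" "g \<in> Cc"
  shows "conv G (\<lambda>a. f a - g a) \<xi> = (\<lambda>c. conv G f \<xi> c - conv G g \<xi> c)"
proof
  fix c
  define A where "A = {a \<in> fiber G (src G c). comp G c (ginv G a) \<in> supp f} \<union>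
    {a \<in> fiber G (src G c). comp G c (ginv G a) \<in> supp g}"
  have A: "finite A" "A \<subseteq> fiber G (src G c)" unfolding A_def using conv_left_sum(1) assms by auto
  have z: "f (comp G c (ginv G a)) = 0 \<and> g (comp G c (ginv G a)) = 0"
    if "a \<in> fiber G (src G c)" "a \<notin> A" for a
    using that by (auto simp: A_def zero_outside_supp)
  have e: "conv G h \<xi> c = (\<Sum>a\<in>A. h (comp G c (ginv G a)) * \<xi> a)"
    if "\<And>a. a \<in> fiber G (src G c) \<Longrightarrow> a \<notin> A \<Longrightarrow> h (comp G c (ginv G a)) = 0" for h
    by (rule conv_eq_sum[OF A]) (simp add: that)
  show "conv G (\<lambda>a. f a - g a) \<xi> c = conv G f \<xi> c - conv G g \<xi> c"
    using e[of f] e[of g] e[of "\<lambda>a. f a - g a"] z by (simp add: sum_subtractf left_diff_distrib)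
qed

text \<open>Schur's test: the kernel \<open>f (c a\<inverse>)\<close> has a bounded number of nonzero entries in each row and
  each column.\<close>

lemma conv_left_bound:
  assumes "f \<in> Cc"
  obtains C where "C \<ge> 0" "\<And>\<xi> D. l2_le G \<xi> D \<Longrightarrow> l2_le G (conv G f \<xi>) (C * D)"
proof -
  obtain M where M: "M \<ge> 0" "\<And>a. cmod (f a) \<le> M" using Cc_bounded[OF assms] by blast
  let ?L = "supp f"
  let ?R = "\<lambda>c. {a \<in> fiber G (src G c). comp G c (ginv G a) \<in> ?L}"
  obtain N :: nat where N: "\<And>c. finite (?R c)" "\<And>c. card (?R c) \<le> N"
    "\<And>a. finite {c \<in> fiber G (src G a). comp G c (ginv G a) \<in> ?L}"
    "\<And>a. card {c \<in> fiber G (src G a). comp G c (ginv G a) \<in> ?L} \<le> N"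
    by (rule quotient_card_bound[OF Cc_compact_supp[OF assms]]) blast
  have "l2_le G (conv G f \<xi>) ((N * M) * D)" if D: "l2_le G \<xi> D" for \<xi> D
  proof (rule l2_leI)
    fix x F assume F: "finite F" "F \<subseteq> fiber G x"
    let ?h = "\<lambda>a. (cmod (\<xi> a))\<^sup>2"
    \<comment> \<open>U collects the columns met by the rows in F, so that the order of summation
      can be exchanged between finite sets.\<close>
    define U where "U = (\<Union>c\<in>F. ?R c)"
    have U: "finite U" "U \<subseteq> fiber G x" unfolding U_def using F N(1) by (auto simp: fiber_def)
    have row: "(cmod (conv G f \<xi> c))\<^sup>2 \<le> N * M\<^sup>2 * (\<Sum>a\<in>?R c. ?h a)" for c
    proof -
      have "cmod (conv G f \<xi> c) \<le> (\<Sum>a\<in>?R c. cmod (f (comp G c (ginv G a)) * \<xi> a))"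
        unfolding conv_left_sum(2)[OF assms] by (rule norm_sum)
      also have "\<dots> \<le> (\<Sum>a\<in>?R c. M * cmod (\<xi> a))"
        by (intro sum_mono) (simp add: norm_mult mult_right_mono M)
      also have "\<dots> = M * (\<Sum>a\<in>?R c. cmod (\<xi> a))" by (simp add: sum_distrib_left)
      finally have "(cmod (conv G f \<xi> c))\<^sup>2 \<le> (M * (\<Sum>a\<in>?R c. cmod (\<xi> a)))\<^sup>2"
        by (intro power_mono) auto
      also have "\<dots> = M\<^sup>2 * (\<Sum>a\<in>?R c. cmod (\<xi> a))\<^sup>2" by (simp add: power_mult_distrib)
      also have "\<dots> \<le> M\<^sup>2 * ((\<Sum>a\<in>?R c. ?h a) * card (?R c))"
        by (intro mult_left_mono sum_squared_le_sum_of_squares) auto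
      also have "\<dots> \<le> M\<^sup>2 * ((\<Sum>a\<in>?R c. ?h a) * N)"
        using N(2) by (intro mult_left_mono) (auto intro: sum_nonneg)
      finally show ?thesis by (simp add: mult_ac)
    qed
    have "(\<Sum>c\<in>F. \<Sum>a\<in>?R c. ?h a) = (\<Sum>c\<in>F. \<Sum>a\<in>{a \<in> U. comp G c (ginv G a) \<in> ?L}. ?h a)"
    proof (rule sum.cong[OF refl])
      fix c assume c: "c \<in> F"
      then have "src G c = x" using F by (auto simp: fiber_def)
      then have "?R c = {a \<in> U. comp G c (ginv G a) \<in> ?L}" using c U(2) by (auto simp: U_def)
      then show "(\<Sum>a\<in>?R c. ?h a) = (\<Sum>a\<in>{a \<in> U. comp G c (ginv G a) \<in> ?L}. ?h a)" by simp
    qed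
    also have "\<dots> = (\<Sum>a\<in>U. \<Sum>c\<in>{c \<in> F. comp G c (ginv G a) \<in> ?L}. ?h a)"
      by (rule sum.swap_restrict[OF F(1) U(1)])
    also have "\<dots> \<le> (\<Sum>a\<in>U. N * ?h a)"
    proof (rule sum_mono)
      fix a assume a: "a \<in> U"
      then have "src G a = x" using U by (auto simp: fiber_def)
      then have "{c \<in> F. comp G c (ginv G a) \<in> ?L} \<subseteq> {c \<in> fiber G (src G a). comp G c (ginv G a) \<in> ?L}"
        using F by auto
      from card_mono[OF N(3) this] N(4)[of a]
      have "card {c \<in> F. comp G c (ginv G a) \<in> ?L} \<le> N" by linarith
      then show "(\<Sum>c\<in>{c \<in> F. comp G c (ginv G a) \<in> ?L}. ?h a) \<le> N * ?h a"
        by (simp add: mult_right_mono)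
    qed
    also have "\<dots> = N * (\<Sum>a\<in>U. ?h a)" by (simp add: sum_distrib_left)
    also have "\<dots> \<le> N * D\<^sup>2" using l2_le_sum[OF D U] by (intro mult_left_mono) auto
    finally have cols: "(\<Sum>c\<in>F. \<Sum>a\<in>?R c. ?h a) \<le> N * D\<^sup>2" .
    have "(\<Sum>c\<in>F. (cmod (conv G f \<xi> c))\<^sup>2) \<le> (\<Sum>c\<in>F. N * M\<^sup>2 * (\<Sum>a\<in>?R c. ?h a))"
      by (intro sum_mono row)
    also have "\<dots> = N * M\<^sup>2 * (\<Sum>c\<in>F. \<Sum>a\<in>?R c. ?h a)" by (simp add: sum_distrib_left)
    also have "\<dots> \<le> N * M\<^sup>2 * (N * D\<^sup>2)" using cols by (intro mult_left_mono) auto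
    also have "\<dots> = ((N * M) * D)\<^sup>2" by (simp add: power2_eq_square mult_ac)
    finally show "L2_set (\<lambda>c. cmod (conv G f \<xi> c)) F \<le> (N * M) * D"
      unfolding L2_set_def using M(1) l2_le_nonneg[OF D]
      by (intro real_le_lsqrt) (auto intro: sum_nonneg)
  qed
  then show ?thesis using that[of "N * M"] M(1) by simp
qed

text \<open>Right convolution is a sum of at most N weighted translates of \<xi>. The translate by a
  carries arrows of the fiber over \<open>src G a\<close> injectively into the fiber over
  \<open>rng G a\<close>, so the bound D on all fibers controls each one.\<close>

lemma conv_right_bound:
  assumes "g \<in> Cc"
  obtains C where "C \<ge> 0" "\<And>\<xi> D. l2_le G \<xi> D \<Longrightarrow> l2_le G (conv G \<xi> g) (C * D)"
proof -
  obtain M where M: "M \<ge> 0" "\<And>a. cmod (g a) \<le> M" using Cc_bounded[OF assms] by blast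
  obtain N :: nat where N: "\<And>x. card (fiber G x \<inter> supp g) \<le> N"
    by (rule quotient_card_bound[OF Cc_compact_supp[OF assms]]) blast
  have "l2_le G (conv G \<xi> g) ((N * M) * D)" if D: "l2_le G \<xi> D" for \<xi> D
  proof (rule l2_leI)
    fix x F assume F: "finite F" "F \<subseteq> fiber G x"
    let ?B = "fiber G x \<inter> supp g"
    have "L2_set (\<lambda>c. cmod (conv G \<xi> g c)) F \<le> L2_set (\<lambda>c. \<Sum>a\<in>?B. M * cmod (\<xi> (comp G c (ginv G a)))) F"
    proof (rule L2_set_mono)
      fix c assume "c \<in> F"
      then have "src G c = x" using F by (auto simp: fiber_def)
      then have "cmod (conv G \<xi> g c) \<le> (\<Sum>a\<in>?B. cmod (\<xi> (comp G c (ginv G a)) * g a))"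
        unfolding conv_right_sum[OF assms] by (simp add: norm_sum)
      also have "\<dots> \<le> (\<Sum>a\<in>?B. M * cmod (\<xi> (comp G c (ginv G a))))"
        by (intro sum_mono) (simp add: norm_mult mult.commute[of M] mult_left_mono M)
      finally show "cmod (conv G \<xi> g c) \<le> (\<Sum>a\<in>?B. M * cmod (\<xi> (comp G c (ginv G a))))" .
    qed simp
    also have "\<dots> \<le> (\<Sum>a\<in>?B. L2_set (\<lambda>c. M * cmod (\<xi> (comp G c (ginv G a)))) F)"
      by (rule L2_set_sum_le)
    also have "\<dots> \<le> (\<Sum>a\<in>?B. M * D)"
    proof (rule sum_mono)
      fix a assume a: "a \<in> ?B"
      let ?q = "\<lambda>c. comp G c (ginv G a)"
      have Fa: "F \<subseteq> fiber G (src G a)" using a F by (auto simp: fiber_def)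
      then have inj: "inj_on ?q F" by (rule inj_on_subset[OF quotient_inj_left])
      have "L2_set (\<lambda>c. cmod (\<xi> (?q c))) F = L2_set (\<lambda>b. cmod (\<xi> b)) (?q ` F)"
        unfolding L2_set_def by (simp add: sum.reindex[OF inj])
      also have "\<dots> \<le> D"
        using Fa F(1) by (intro l2_leD[OF D, where x="rng G a"]) (auto simp: fiber_def src_quotient)
      finally show "L2_set (\<lambda>c. M * cmod (\<xi> (?q c))) F \<le> M * D"
        using M(1) by (simp add: L2_set_right_distrib[symmetric] mult_left_mono)
    qed
    also have "\<dots> = card ?B * (M * D)" by simp
    also have "\<dots> \<le> N * (M * D)"
      using N[of x] M(1) l2_le_nonneg[OF D] by (intro mult_right_mono) auto
    finally show "L2_set (\<lambda>c. cmod (conv G \<xi> g c)) F \<le> (N * M) * D" by (simp add: mult.assoc)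
  qed
  then show ?thesis using that[of "N * M"] M(1) by simp
qed

text \<open>The support lies in the product of the two supports. This product is compact because
  composability is a closed condition.\<close>

lemma conv_Cc:
  assumes f: "f \<in> Cc" and g: "g \<in> Cc" shows "conv G f g \<in> Cc"
proof (rule CcI)
  have q: "continuous_on {(c, a). src G c = src G a} (\<lambda>p. comp G (fst p) (ginv G (snd p)))"
    by (rule continuous_on_comp) (auto intro!: continuous_intros simp: rng_inv)
  have "continuous_on {(c, a). src G c = src G a} (\<lambda>(c, a). f (comp G c (ginv G a)) * g a)"
    unfolding case_prod_unfold
    by (intro continuous_on_mult continuous_on_compose2[OF Cc_continuous[OF f]]
        continuous_on_compose2[OF Cc_continuous[OF g]] q[unfolded case_prod_unfold] continuous_on_snd continuous_on_id)
      auto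
  then show "continuous_on UNIV (conv G f g)" unfolding conv_def
    by (rule continuous_fiber_sum[OF _ Cc_compact_supp[OF g]]) (simp add: zero_outside_supp)
  let ?C = "(supp f \<times> supp g) \<inter> composable G"
  have "composable G = {p. src G (fst p) = rng G (snd p)}" by (auto simp: composable_def)
  moreover have "closed {p. src G (fst p) = rng G (snd p)}"
    by (intro closed_Collect_eq continuous_on_src continuous_on_rng continuous_on_fst continuous_on_snd continuous_on_id)
  ultimately have "compact ?C"
    using f g by (intro compact_Int_closed compact_Times Cc_compact_supp) auto
  moreover have "continuous_on ?C (\<lambda>(a, b). comp G a b)"
    by (rule continuous_on_subset[OF continuous_comp]) auto
  ultimately show "compact ((\<lambda>(a, b). comp G a b) ` ?C)" by (intro compact_continuous_image)
  fix c assume "conv G f g c \<noteq> 0"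
  then obtain a where "a \<in> fiber G (src G c)" "f (comp G c (ginv G a)) * g a \<noteq> 0"
    unfolding conv_def using infsum_0[of "fiber G (src G c)" "\<lambda>a. f (comp G c (ginv G a)) * g a"] by blast
  then have a: "src G c = src G a" "comp G c (ginv G a) \<in> supp f" "a \<in> supp g"
    using zero_outside_supp[of _ f] zero_outside_supp[of _ g] by (auto simp: fiber_def)
  then have "(comp G c (ginv G a), a) \<in> ?C" by (simp add: composable_def src_quotient)
  moreover have "c = (\<lambda>(a, b). comp G a b) (comp G c (ginv G a), a)" by (simp add: cancel_right' a)
  ultimately show "c \<in> (\<lambda>(a, b). comp G a b) ` ?C" by (metis image_eqI)
qed

text \<open>Extension by density, phrased through differences of values so that it applies to
  convolution from either side and to multiplication.\<close>

lemma L2_transfer: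
  assumes \<xi>: "\<xi> \<in> L2 G" and C: "C \<ge> 0"
    and le: "\<And>\<eta> D. \<eta> \<in> Cc \<Longrightarrow> l2_le G (\<lambda>a. \<xi> a - \<eta> a) D \<Longrightarrow> l2_le G (\<lambda>a. \<Phi> \<xi> a - \<Phi> \<eta> a) (C * D)"
    and Cc: "\<And>\<eta>. \<eta> \<in> Cc \<Longrightarrow> \<Phi> \<eta> \<in> Cc"
  shows "\<Phi> \<xi> \<in> L2 G"
proof (rule L2_closed)
  fix e :: real assume e: "e > 0"
  \<comment> \<open>Dividing by C + 1 covers C = 0.\<close>
  then have "e / (C + 1) > 0" using C by simp
  then obtain \<eta> where \<eta>: "\<eta> \<in> Cc" "l2_le G (\<lambda>a. \<xi> a - \<eta> a) (e / (C + 1))"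
    using \<xi> unfolding L2_iff by blast
  have "C * (e / (C + 1)) \<le> e" using e C by (simp add: field_simps)
  then have "l2_le G (\<lambda>a. \<Phi> \<xi> a - \<Phi> \<eta> a) e" by (rule l2_le_mono[OF le[OF \<eta>]])
  then show "\<exists>\<zeta>\<in>L2 G. l2_le G (\<lambda>a. \<Phi> \<xi> a - \<zeta> a) e" using Cc_L2[OF Cc[OF \<eta>(1)]] by blast
qed

lemma conv_left_L2:
  assumes f: "f \<in> Cc" and \<xi>: "\<xi> \<in> L2 G" shows "conv G f \<xi> \<in> L2 G"
proof -
  obtain C where C: "C \<ge> 0" "\<And>\<xi> D. l2_le G \<xi> D \<Longrightarrow> l2_le G (conv G f \<xi>) (C * D)"
    using conv_left_bound[OF f] by blast
  show ?thesis
    by (rule L2_transfer[OF \<xi> C(1)]) (simp_all add: C(2) conv_Cc f flip: conv_diff_right)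
qed

lemma conv_right_L2:
  assumes g: "g \<in> Cc" and \<xi>: "\<xi> \<in> L2 G" shows "conv G \<xi> g \<in> L2 G"
proof -
  obtain C where C: "C \<ge> 0" "\<And>\<xi> D. l2_le G \<xi> D \<Longrightarrow> l2_le G (conv G \<xi> g) (C * D)"
    using conv_right_bound[OF g] by blast
  show ?thesis
    by (rule L2_transfer[OF \<xi> C(1), where \<Phi>="\<lambda>\<xi>. conv G \<xi> g"])
      (simp_all add: C(2) conv_Cc g flip: conv_diff_left)
qed

lemma Cb_mult_L2:
  assumes f: "f \<in> Cb" and \<xi>: "\<xi> \<in> L2 G" shows "(\<lambda>a. f a * \<xi> a) \<in> L2 G"
proof -
  obtain M where "\<And>a. cmod (f a) \<le> M" using f by (auto simp: Cb_def bounded_iff)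
  then have M: "cmod (f a) \<le> \<bar>M\<bar>" for a by (meson abs_ge_self order_trans)
  have dom: "cmod (f a * z) \<le> cmod (of_real \<bar>M\<bar> * z)" for a z
    using mult_right_mono[OF M norm_ge_zero[of z]] by (simp add: norm_mult)
  show ?thesis
  proof (rule L2_transfer[OF \<xi>, of "\<bar>M\<bar>" "\<lambda>\<xi> a. f a * \<xi> a"])
    fix \<eta> D assume "l2_le G (\<lambda>a. \<xi> a - \<eta> a) D"
    from l2_le_scale[OF this, of "of_real \<bar>M\<bar>"]
    have "l2_le G (\<lambda>a. of_real \<bar>M\<bar> * (\<xi> a - \<eta> a)) (\<bar>M\<bar> * D)" by simp
    then have "l2_le G (\<lambda>a. f a * (\<xi> a - \<eta> a)) (\<bar>M\<bar> * D)" by (rule l2_le_dominated) (rule dom)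
    then show "l2_le G (\<lambda>a. f a * \<xi> a - f a * \<eta> a) (\<bar>M\<bar> * D)" by (simp add: right_diff_distrib)
  qed (use f Cc_mult in \<open>auto simp: Cb_def\<close>)
qed

text \<open>The compact supports of the outer factors reduce both sides to one finite double sum for
  arbitrary \<xi>. The inner sum is matched by the substitution a = d b.\<close>

lemma conv_assoc:
  assumes f: "f \<in> Cc" and g: "g \<in> Cc"
  shows "conv G f (conv G \<xi> g) = conv G (conv G f \<xi>) g"
proof
  fix c
  let ?x = "src G c"
  let ?A = "{a \<in> fiber G ?x. comp G c (ginv G a) \<in> supp f}" and ?B = "fiber G ?x \<inter> supp g"
  have inner: "(\<Sum>a\<in>?A. f (comp G c (ginv G a)) * \<xi> (comp G a (ginv G b))) = conv G f \<xi> (comp G c (ginv G b))"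
    if b: "b \<in> ?B" for b
  proof -
    have sb: "src G c = src G b" using b by (simp add: fiber_def)
    have "conv G f \<xi> (comp G c (ginv G b)) =
        (\<Sum>\<^sub>\<infinity>d\<in>fiber G (rng G b). f (comp G (comp G c (ginv G b)) (ginv G d)) * \<xi> d)"
      unfolding conv_def by (simp add: src_quotient sb)
    also have "\<dots> = (\<Sum>\<^sub>\<infinity>d\<in>fiber G (rng G b).
        f (comp G c (ginv G (comp G d b))) * \<xi> (comp G (comp G d b) (ginv G b)))"
    proof (rule infsum_cong)
      fix d assume "d \<in> fiber G (rng G b)"
      then have d: "src G d = rng G b" by (simp add: fiber_def)
      have "comp G (comp G c (ginv G b)) (ginv G d) = comp G c (ginv G (comp G d b))"
        using d sb by (simp add: ginv_comp assoc rng_inv src_inv)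
      then show "f (comp G (comp G c (ginv G b)) (ginv G d)) * \<xi> d =
          f (comp G c (ginv G (comp G d b))) * \<xi> (comp G (comp G d b) (ginv G b))"
        by (simp only: cancel_right[OF d])
    qed
    also have "\<dots> = (\<Sum>\<^sub>\<infinity>a\<in>fiber G (src G b). f (comp G c (ginv G a)) * \<xi> (comp G a (ginv G b)))"
      by (rule infsum_reindex_bij_betw[OF bij_betw_translate])
    also have "\<dots> = (\<Sum>\<^sub>\<infinity>a\<in>?A. f (comp G c (ginv G a)) * \<xi> (comp G a (ginv G b)))"
      by (rule infsum_cong_neutral) (auto simp: sb zero_outside_supp)
    also have "\<dots> = (\<Sum>a\<in>?A. f (comp G c (ginv G a)) * \<xi> (comp G a (ginv G b)))"
      using conv_left_sum(1)[OF f] by simp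
    finally show ?thesis ..
  qed
  have "conv G f (conv G \<xi> g) c = (\<Sum>a\<in>?A. f (comp G c (ginv G a)) * (\<Sum>b\<in>?B. \<xi> (comp G a (ginv G b)) * g b))"
    unfolding conv_left_sum(2)[OF f]
    by (rule sum.cong[OF refl]) (simp add: conv_right_sum[OF g] fiber_def)
  also have "\<dots> = (\<Sum>a\<in>?A. \<Sum>b\<in>?B. f (comp G c (ginv G a)) * \<xi> (comp G a (ginv G b)) * g b)"
    by (simp add: sum_distrib_left mult.assoc)
  also have "\<dots> = (\<Sum>b\<in>?B. \<Sum>a\<in>?A. f (comp G c (ginv G a)) * \<xi> (comp G a (ginv G b)) * g b)"
    by (rule sum.swap)
  also have "\<dots> = (\<Sum>b\<in>?B. conv G f \<xi> (comp G c (ginv G b)) * g b)"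
    by (rule sum.cong[OF refl]) (simp add: inner sum_distrib_right[symmetric])
  also have "\<dots> = conv G (conv G f \<xi>) g c" by (rule conv_right_sum[OF g, symmetric])
  finally show "conv G f (conv G \<xi> g) c = conv G (conv G f \<xi>) g c" .
qed

lemma Cc_star:
  assumes "f \<in> Cc" shows "(\<lambda>a. cnj (f (ginv G a))) \<in> Cc"
proof (rule CcI)
  show "continuous_on UNIV (\<lambda>a. cnj (f (ginv G a)))"
    by (intro continuous_intros continuous_on_compose2[OF Cc_continuous[OF assms]]) auto
  show "compact (ginv G ` supp f)"
    by (intro compact_continuous_image continuous_on_ginv continuous_on_id Cc_compact_supp assms)
  show "a \<in> ginv G ` supp f" if "cnj (f (ginv G a)) \<noteq> 0" for a
    using that zero_outside_supp[of "ginv G a" f] by (auto intro!: image_eqI[of a _ "ginv G a"])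
qed

text \<open>All nonzero terms lie over the finite sets ?A and ?C, so the sums may be exchanged. The
  conjugate of the kernel at (c, a) is the kernel of the involuted function at (a, c).\<close>

lemma conv_adjoint_Cc:
  assumes f: "f \<in> Cc" and \<xi>: "\<xi> \<in> Cc"
  shows "l2_inner G \<eta> (conv G f \<xi>) x = l2_inner G (conv G (\<lambda>a. cnj (f (ginv G a))) \<eta>) \<xi> x"
proof -
  let ?A = "fiber G x \<inter> supp \<xi>"
  let ?C = "\<Union>a\<in>?A. {c \<in> fiber G (src G a). comp G c (ginv G a) \<in> supp f}"
  have finA: "finite ?A" by (rule finite_fiber_Int_compact[OF Cc_compact_supp[OF \<xi>]])
  have "finite {c \<in> fiber G (src G a). comp G c (ginv G a) \<in> supp f}" for a
    by (rule quotient_card_bound[OF Cc_compact_supp[OF f]])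
  then have finC: "finite ?C" using finA by blast
  have Cx: "?C \<subseteq> fiber G x" by (auto simp: fiber_def)
  have fz: "f (comp G c (ginv G a)) = 0" if "c \<in> fiber G x" "c \<notin> ?C" "a \<in> ?A" for c a
    using that by (intro zero_outside_supp) (auto simp: fiber_def)
  have conv1: "conv G f \<xi> c = (\<Sum>a\<in>?A. f (comp G c (ginv G a)) * \<xi> a)" if "c \<in> fiber G x" for c
    using that by (simp add: conv_right_sum[OF \<xi>] fiber_def)
  have "l2_inner G \<eta> (conv G f \<xi>) x = (\<Sum>\<^sub>\<infinity>c\<in>?C. cnj (\<eta> c) * conv G f \<xi> c)"
    unfolding l2_inner_def using Cx conv1 fz by (intro infsum_cong_neutral) auto
  also have "\<dots> = (\<Sum>c\<in>?C. cnj (\<eta> c) * conv G f \<xi> c)" using finC by simp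
  also have "\<dots> = (\<Sum>c\<in>?C. \<Sum>a\<in>?A. cnj (\<eta> c) * (f (comp G c (ginv G a)) * \<xi> a))"
    using Cx conv1 by (intro sum.cong refl) (auto simp: sum_distrib_left)
  also have "\<dots> = (\<Sum>a\<in>?A. \<Sum>c\<in>?C. cnj (\<eta> c) * (f (comp G c (ginv G a)) * \<xi> a))"
    by (rule sum.swap)
  also have "\<dots> = (\<Sum>a\<in>?A. cnj (conv G (\<lambda>a. cnj (f (ginv G a))) \<eta> a) * \<xi> a)"
  proof (rule sum.cong[OF refl])
    fix a assume a: "a \<in> ?A"
    have q: "ginv G (comp G a (ginv G c)) = comp G c (ginv G a)" if "c \<in> fiber G x" for c
      using a that by (intro ginv_quotient) (auto simp: fiber_def)
    have ax: "src G a = x" using a by (simp add: fiber_def)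
    have "conv G (\<lambda>a. cnj (f (ginv G a))) \<eta> a = (\<Sum>c\<in>?C. cnj (f (ginv G (comp G a (ginv G c)))) * \<eta> c)"
      using fz[OF _ _ a] q Cx by (intro conv_eq_sum[OF finC]) (auto simp: ax)
    also have "\<dots> = (\<Sum>c\<in>?C. cnj (f (comp G c (ginv G a))) * \<eta> c)"
      using q Cx by (intro sum.cong refl) auto
    finally show "(\<Sum>c\<in>?C. cnj (\<eta> c) * (f (comp G c (ginv G a)) * \<xi> a)) =
        cnj (conv G (\<lambda>a. cnj (f (ginv G a))) \<eta> a) * \<xi> a"
      by (simp add: sum_distrib_left mult_ac)
  qed
  also have "\<dots> = l2_inner G (conv G (\<lambda>a. cnj (f (ginv G a))) \<eta>) \<xi> x"
    unfolding l2_inner_def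
    by (subst infsum_finite[OF finA, symmetric], rule infsum_cong_neutral) (auto simp: zero_outside_supp)
  finally show ?thesis .
qed

text \<open>Only \<xi> is approximated by \<open>Cc\<close>, as the previous identity already allows
  every \<eta>.\<close>

lemma conv_adjoint:
  assumes f: "f \<in> Cc" and \<eta>: "\<eta> \<in> L2 G" and \<xi>: "\<xi> \<in> L2 G"
  shows "l2_inner G \<eta> (conv G f \<xi>) x = l2_inner G (conv G (\<lambda>a. cnj (f (ginv G a))) \<eta>) \<xi> x"
proof -
  let ?f = "\<lambda>a. cnj (f (ginv G a))"
  obtain C where C: "C \<ge> 0" "\<And>\<xi> D. l2_le G \<xi> D \<Longrightarrow> l2_le G (conv G f \<xi>) (C * D)"
    using conv_left_bound[OF f] by blast
  obtain B where B: "l2_le G \<eta> B" using L2_l2_le[OF \<eta>] by blast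
  obtain E where E: "l2_le G (conv G ?f \<eta>) E" using L2_l2_le[OF conv_left_L2[OF Cc_star[OF f] \<eta>]] by blast
  obtain H where H: "l2_le G \<xi> H" using L2_l2_le[OF \<xi>] by blast
  have "cmod (l2_inner G \<eta> (conv G f \<xi>) x - l2_inner G (conv G ?f \<eta>) \<xi> x) \<le> (B * C + E) * e"
    if e: "e > 0" for e
  proof -
    obtain \<zeta> where \<zeta>: "\<zeta> \<in> Cc" "l2_le G (\<lambda>a. \<xi> a - \<zeta> a) e"
      using \<xi> e unfolding L2_iff by blast
    obtain K where K: "l2_le G \<zeta> K" using Cc_l2_le[OF \<zeta>(1)] by blast
    have "l2_inner G \<eta> (conv G f \<xi>) x - l2_inner G (conv G ?f \<eta>) \<xi> x =
        l2_inner G \<eta> (conv G f (\<lambda>a. \<xi> a - \<zeta> a)) x - l2_inner G (conv G ?f \<eta>) (\<lambda>a. \<xi> a - \<zeta> a) x"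
      unfolding conv_diff_right[OF f] l2_inner_diff_right[OF B C(2)[OF H] C(2)[OF K]]
        l2_inner_diff_right[OF E H K] conv_adjoint_Cc[OF f \<zeta>(1)] by simp
    also have "cmod \<dots> \<le> B * (C * e) + E * e"
      by (rule order_trans[OF norm_triangle_ineq4])
        (intro add_mono l2_inner_bound[OF B C(2)[OF \<zeta>(2)]] l2_inner_bound[OF E \<zeta>(2)])
    finally show ?thesis by (simp add: algebra_simps)
  qed
  from eq_zeroI[OF this] show ?thesis by simp
qed

lemma left_reg_adjoint_pair:
  assumes f: "f \<in> Cc"
  shows "adjoint_pair G (left_reg G f) (left_reg G (\<lambda>a. cnj (f (ginv G a))))"
  unfolding adjoint_pair_def
proof (intro conjI ballI ext)
  show "left_reg G f \<in> L2 G \<rightarrow>\<^sub>E L2 G"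
    using conv_left_L2[OF f] by (auto simp: left_reg_apply) (simp add: left_reg_def)
  show "left_reg G (\<lambda>a. cnj (f (ginv G a))) \<in> L2 G \<rightarrow>\<^sub>E L2 G"
    using conv_left_L2[OF Cc_star[OF f]] by (auto simp: left_reg_apply) (simp add: left_reg_def)
qed (simp add: left_reg_apply conv_adjoint[OF f])

lemma left_reg_adjointable: "f \<in> Cc \<Longrightarrow> left_reg G f \<in> adjointable G"
  using left_reg_adjoint_pair adjointable_iff by blast

lemma left_reg_diff:
  "f \<in> Cc \<Longrightarrow> g \<in> Cc \<Longrightarrow> left_reg G (\<lambda>a. f a - g a) = op_diff G (left_reg G f) (left_reg G g)"
  unfolding op_diff_def by (auto simp: fun_eq_iff left_reg_apply conv_diff_kernel)
    (simp_all add: left_reg_def)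

end

subsection \<open>Equivariant operators with compact support\<close>

context etale_groupoid
begin

lemma left_reg_equivariant:
  assumes f: "f \<in> Cc" shows "equivariant G (left_reg G f)"
  unfolding equivariant_def
proof (intro ballI)
  fix g \<xi> :: "'g \<Rightarrow> complex" assume g: "g \<in> Cc" and \<xi>: "\<xi> \<in> L2 G"
  show "left_reg G f (right_op G g \<xi>) = right_op G g (left_reg G f \<xi>)"
    by (simp add: left_reg_apply right_op_apply conv_left_L2 conv_right_L2 f g \<xi> conv_assoc)
qed

text \<open>A nonzero term at c and a would exhibit c as the product of c a^-1 in
  \<open>supp f\<close> and a in \<open>supp u\<close>, while c lies in \<open>supp v\<close>;
  separation forbids this.\<close>

lemma left_reg_compactly_supported:
  assumes f: "f \<in> Cc" shows "compactly_supported G (left_reg G f)"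
  unfolding compactly_supported_def
proof (intro exI[of _ "supp f"] conjI ballI impI)
  show "compact (supp f)" by (rule Cc_compact_supp[OF f])
  fix u v \<xi> assume uv: "u \<in> Cb" "v \<in> Cb" and sep: "separated G (supp f) u v" and \<xi>: "\<xi> \<in> L2 G"
  have u\<xi>: "(\<lambda>a. u a * \<xi> a) \<in> L2 G" by (rule Cb_mult_L2[OF uv(1) \<xi>])
  have "v c * conv G f (\<lambda>a. u a * \<xi> a) c = 0" for c
  proof (cases "v c = 0")
    case False
    then have c: "c \<in> supp v" using zero_outside_supp by blast
    have "f (comp G c (ginv G a)) * (u a * \<xi> a) = 0" if a: "a \<in> fiber G (src G c)" for a
    proof (rule ccontr)
      assume nz: "f (comp G c (ginv G a)) * (u a * \<xi> a) \<noteq> 0"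
      then have *: "comp G c (ginv G a) \<in> supp f" "a \<in> supp u"
        using zero_outside_supp[of _ f] zero_outside_supp[of _ u] by auto
      have s: "src G c = src G a" using a by (simp add: fiber_def)
      have "c \<in> set_comp G (supp f) (supp u)"
        unfolding set_comp_def composable_def mem_Collect_eq
        by (rule exI[of _ "comp G c (ginv G a)"], rule exI[of _ a])
          (simp add: * cancel_right'[OF s] src_quotient[OF s])
      with c sep show False unfolding separated_def by blast
    qed
    then show ?thesis unfolding conv_def by (simp add: infsum_0)
  qed simp
  then have "(\<lambda>c. v c * conv G f (\<lambda>a. u a * \<xi> a) c) = (\<lambda>_. 0)" by (rule ext)
  then show "mult_op G v (left_reg G f (mult_op G u \<xi>)) = (\<lambda>_. 0)"
    using \<xi> u\<xi> conv_left_L2[OF f u\<xi>] by (simp only: mult_op_def left_reg_apply restrict_apply if_True)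
qed

text \<open>The quotient c a^-1 is a unit only for a = c, so a single term remains.\<close>

lemma conv_unit_left:
  assumes "\<And>a. a \<notin> units G \<Longrightarrow> h a = 0"
  shows "conv G h \<xi> c = h (rng G c) * \<xi> c"
proof -
  have "conv G h \<xi> c = (\<Sum>a\<in>{c}. h (comp G c (ginv G a)) * \<xi> a)"
  proof (rule conv_eq_sum)
    fix a assume "a \<in> fiber G (src G c)" "a \<notin> {c}"
    then have "comp G c (ginv G a) \<notin> units G" by (simp add: fiber_def quotient_unit_iff)
    then show "h (comp G c (ginv G a)) * \<xi> a = 0" using assms by simp
  qed (auto simp: fiber_def)
  then show ?thesis by (simp add: inv_right)
qed

lemma conv_unit_right:
  assumes "\<And>a. a \<notin> units G \<Longrightarrow> h a = 0"
  shows "conv G \<xi> h c = \<xi> c * h (src G c)"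
proof -
  have "conv G \<xi> h c = (\<Sum>a\<in>{src G c}. \<xi> (comp G c (ginv G a)) * h a)"
  proof (rule conv_eq_sum)
    fix a assume "a \<in> fiber G (src G c)" "a \<notin> {src G c}"
    then have "a \<notin> units G" by (auto simp: fiber_def src_unit)
    then show "\<xi> (comp G c (ginv G a)) * h a = 0" using assms by simp
  qed (auto simp: fiber_def src_unit)
  then show ?thesis by (simp add: ginv_unit unit_right)
qed

text \<open>Openness of the unit space makes a cut-off on it an element of \<open>Cc\<close> on the
  whole groupoid.\<close>

lemma unit_bump:
  assumes "compact C" "C \<subseteq> units G"
  obtains h where "h \<in> Cc" "\<And>a. a \<in> C \<Longrightarrow> h a = 1" "\<And>a. a \<notin> units G \<Longrightarrow> h a = 0"
proof -
  obtain h :: "'g \<Rightarrow> complex" where h: "h \<in> Cc" "\<And>a. a \<in> C \<Longrightarrow> h a = 1" "supp h \<subseteq> units G"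
    using bump_function[OF assms(1) open_units assms(2)] by metis
  have "h a = 0" if "a \<notin> units G" for a using that h(3) by (intro zero_outside_supp) blast
  then show ?thesis using that h by blast
qed

text \<open>Density of \<open>Cc\<close> suffices because the difference is bounded; the equivalence
  depends on \<open>adjointable_bounded\<close> at this point.\<close>

lemma adjointable_eq_on_Cc:
  assumes T: "T \<in> adjointable G" and R: "R \<in> adjointable G"
    and eq: "\<And>\<xi>. \<xi> \<in> Cc \<Longrightarrow> T \<xi> = R \<xi>"
  shows "T = R"
proof (rule adjointable_eqI[OF T R])
  fix \<xi> assume \<xi>: "\<xi> \<in> L2 G"
  let ?Q = "op_diff G T R"
  have Q: "?Q \<in> adjointable G" by (rule op_diff_adjointable[OF T R])
  have bound: "cmod (T \<xi> a - R \<xi> a) \<le> op_norm G ?Q * e" if e: "e > 0" for a e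
  proof -
    obtain \<zeta> where \<zeta>: "\<zeta> \<in> Cc" "l2_le G (\<lambda>a. \<xi> a - \<zeta> a) e"
      using \<xi> e unfolding L2_iff by blast
    have L2: "(\<lambda>a. \<xi> a - \<zeta> a) \<in> L2 G" by (intro L2_diff \<xi> Cc_L2 \<zeta>)
    have "?Q (\<lambda>a. \<xi> a - \<zeta> a) = (\<lambda>a. ?Q \<xi> a - ?Q \<zeta> a)"
      using adjointable_axpy[OF Q \<xi> Cc_L2[OF \<zeta>(1)], of "-1"] by simp
    moreover have "?Q \<zeta> = (\<lambda>_. 0)" using eq[OF \<zeta>(1)] Cc_L2[OF \<zeta>(1)] by (simp add: op_diff_def)
    ultimately have "?Q (\<lambda>a. \<xi> a - \<zeta> a) a = T \<xi> a - R \<xi> a" using \<xi> by (simp add: op_diff_def)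
    then show ?thesis using l2_le_pointwise[OF op_leD[OF op_le_norm[OF Q] L2 \<zeta>(2)], of a] by simp
  qed
  show "T \<xi> = R \<xi>"
  proof
    fix a
    have "T \<xi> a - R \<xi> a = 0" by (rule eq_zeroI[OF bound])
    then show "T \<xi> a = R \<xi> a" by simp
  qed
qed

text \<open>The kernel of \<open>T\<close> at \<open>c\<close> is \<open>(T h) c\<close> for any \<open>h \<in> Cc\<close> supported on the units with
  \<open>h (src c) = 1\<close>: on the units left and right convolution by \<open>h\<close> are pointwise
  multiplications, so equivariance makes this value independent of \<open>h\<close>.\<close>

lemma equivariant_kernel:
  assumes T: "T \<in> adjointable G" and equiv: "equivariant G T"
  obtains f where "continuous_on UNIV f"
    "\<And>h c. h \<in> Cc \<Longrightarrow> (\<And>a. a \<notin> units G \<Longrightarrow> h a = 0) \<Longrightarrow> T h c = h (src G c) * f c"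
proof -
  have "\<exists>h. h \<in> Cc \<and> h (src G c) = 1 \<and> (\<forall>a. a \<notin> units G \<longrightarrow> h a = 0)" for c
    by (rule unit_bump[of "{src G c}"]) auto
  then obtain k where k: "\<And>c. k c \<in> Cc" "\<And>c. k c (src G c) = 1" "\<And>c a. a \<notin> units G \<Longrightarrow> k c a = 0"
    by metis
  define f where "f c = T (k c) c" for c
  have T_conv: "T (conv G h g) = conv G (T h) g" if "h \<in> Cc" "g \<in> Cc" for h g
    using equiv that unfolding equivariant_def
    by (metis Cc_L2 right_op_apply adjointable_L2[OF T])
  have Th: "T h c = h (src G c) * f c" if h: "h \<in> Cc" "\<And>a. a \<notin> units G \<Longrightarrow> h a = 0" for h c
  proof -
    \<comment> \<open>Both functions live on the units, where convolution is the pointwise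
      product.\<close>
    have "conv G h (k c) = conv G (k c) h"
    proof
      fix b show "conv G h (k c) b = conv G (k c) h b"
        by (cases "b \<in> units G") (simp_all add: conv_unit_left[OF h(2)] conv_unit_right[OF h(2)] rng_unit src_unit k(3))
    qed
    then have "T (conv G h (k c)) c = T (conv G (k c) h) c" by simp
    then show ?thesis
      unfolding T_conv[OF h(1) k(1)] T_conv[OF k(1) h(1)] f_def
      by (simp add: conv_unit_right[OF h(2)] conv_unit_right[OF k(3)] k(2))
  qed
  have "continuous_on UNIV f"
    unfolding continuous_on_eq_continuous_at[OF open_UNIV]
  proof
    fix c0
    obtain V K where V: "open V" "compact K" "src G c0 \<in> V" "V \<subseteq> K" "K \<subseteq> units G"
      by (rule compact_nbhd[OF open_units src_mem_units])
    \<comment> \<open>The cut-off \<open>k c\<close> changes with c. One h equal to 1 on a whole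
      neighbourhood of the source of c0 identifies f near c0 with the continuous function T
      h.\<close>
    obtain h where h: "h \<in> Cc" "\<And>a. a \<in> K \<Longrightarrow> h a = 1" "\<And>a. a \<notin> units G \<Longrightarrow> h a = 0"
      by (rule unit_bump[OF V(2,5)]) blast
    have "continuous_on UNIV (T h)"
      by (intro L2_continuous adjointable_L2[OF T] Cc_L2 h)
    then have "continuous_on (src G -` V) (T h)" by (rule continuous_on_subset) simp
    moreover have "T h c = f c" if "c \<in> src G -` V" for c
      using that V(4) h(2)[of "src G c"] by (simp add: Th[OF h(1,3)] subset_iff)
    ultimately have "continuous_on (src G -` V) f" using continuous_on_cong[OF refl] by blast
    then show "isCont f c0"
      using V open_src_vimage[OF V(1)] by (simp add: continuous_on_eq_continuous_at)
  qed
  then show ?thesis using that Th by blast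
qed

text \<open>If \<open>T\<close> has compact support \<open>K\<close>, then the indicator function of the units and any function
  supported off \<open>K \<union> K\<inverse>\<close> are \<open>K\<close>-separated, so that the kernel vanishes off \<open>K \<union> K\<inverse>\<close>.\<close>

lemma equivariant_compactly_supported_imp_left_reg:
  assumes T: "T \<in> adjointable G" and equiv: "equivariant G T" and "compactly_supported G T"
  shows "T \<in> left_reg G ` Cc"
proof -
  obtain K where K: "compact K" and KT: "\<And>u v \<xi>. u \<in> Cb \<Longrightarrow> v \<in> Cb \<Longrightarrow> separated G K u v \<Longrightarrow> \<xi> \<in> L2 G \<Longrightarrow>
      mult_op G v (T (mult_op G u \<xi>)) = (\<lambda>_. 0)"
    using assms(3) unfolding compactly_supported_def by blast
  obtain f where f: "continuous_on UNIV f"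
    "\<And>h c. h \<in> Cc \<Longrightarrow> (\<And>a. a \<notin> units G \<Longrightarrow> h a = 0) \<Longrightarrow> T h c = h (src G c) * f c"
    using equivariant_kernel[OF T equiv] by blast
  \<comment> \<open>The inverses answer the second condition of \<open>separated\<close>: a product
    k a is a unit only if a is the inverse of k.\<close>
  let ?K = "K \<union> ginv G ` K"
  have K': "compact ?K"
    using K by (intro compact_Un compact_continuous_image continuous_on_ginv continuous_on_id)
  have fK: "c \<in> ?K" if "f c \<noteq> 0" for c
  proof (rule ccontr)
    assume c: "c \<notin> ?K"
    let ?u = "\<lambda>a. if a \<in> units G then 1 else 0 :: complex"
    have "continuous_on (units G \<union> - units G) ?u"
      using closed_units open_units by (intro continuous_on_cases continuous_on_const) auto
    then have u: "?u \<in> Cb" unfolding Cb_def by (auto simp: bounded_iff intro: exI[of _ 1])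
    have su: "supp ?u \<subseteq> units G"
      by (rule supp_subset[OF closed_units]) (auto split: if_splits)
    obtain v :: "'g \<Rightarrow> complex" where v: "v \<in> Cc" "\<And>a. a \<in> {c} \<Longrightarrow> v a = 1" "supp v \<subseteq> - ?K" "\<And>a. cmod (v a) \<le> 1"
    proof (rule bump_function[of "{c}" "- ?K"])
      show "open (- ?K)" using compact_imp_closed[OF K'] by (rule open_Compl)
    qed (use c in auto)
    have vb: "v \<in> Cb" using v(1,4) unfolding Cb_def by (auto simp: Cc_continuous bounded_iff)
    have "separated G K ?u v" unfolding separated_def
    proof (intro conjI equals0I)
      fix b assume b: "b \<in> set_comp G K (supp ?u) \<inter> supp v"
      then obtain k x where kx: "b = comp G k x" "k \<in> K" "x \<in> units G" "src G k = rng G x"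
        using su unfolding set_comp_def composable_def by auto
      then have "b = k" by (metis rng_unit unit_right)
      with b kx v(3) show False by auto
    next
      fix b assume b: "b \<in> supp ?u \<inter> set_comp G K (supp v)"
      then obtain k a where ka: "b = comp G k a" "k \<in> K" "a \<in> supp v" "src G k = rng G a"
        unfolding set_comp_def composable_def by auto
      have "comp G k a \<in> units G" using b su ka(1) by auto
      then have "comp G k (ginv G (ginv G a)) \<in> units G" by simp
      then have "k = ginv G a" using ka(4) by (subst (asm) quotient_unit_iff) (simp_all add: src_inv)
      then have "a = ginv G k" by simp
      with ka v(3) show False by blast
    qed
    note sep = KT[OF u vb this]
    obtain h where h: "h \<in> Cc" "\<And>a. a \<in> {src G c} \<Longrightarrow> h a = 1" "\<And>a. a \<notin> units G \<Longrightarrow> h a = 0"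
      by (rule unit_bump[of "{src G c}"]) auto
    \<comment> \<open>Multiplying by the indicator leaves h unchanged, so the support condition
      applies to T h itself; at c it reads f c = 0, since v and h take the value 1 where
      needed.\<close>
    have "mult_op G ?u h = h" using Cc_L2[OF h(1)] h(3) by (auto simp: mult_op_def fun_eq_iff)
    then have "mult_op G v (T h) = (\<lambda>_. 0)" using sep[OF Cc_L2[OF h(1)]] by simp
    then have "v c * T h c = 0"
      using adjointable_L2[OF T Cc_L2[OF h(1)]] unfolding mult_op_def restrict_apply fun_eq_iff by simp
    then have "f c = 0" using f(2)[OF h(1,3), of c] h(2) v(2) by simp
    with \<open>f c \<noteq> 0\<close> show False ..
  qed
  have fCc: "f \<in> Cc" by (rule CcI[OF f(1) K' fK])
  have "T = left_reg G f"
  proof (rule adjointable_eq_on_Cc[OF T left_reg_adjointable[OF fCc]])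
    fix \<xi> :: "'g \<Rightarrow> complex" assume \<xi>: "\<xi> \<in> Cc"
    have "compact (rng G ` supp \<xi>)"
      by (intro compact_continuous_image continuous_on_rng continuous_on_id Cc_compact_supp \<xi>)
    then obtain h where h: "h \<in> Cc" "\<And>a. a \<in> rng G ` supp \<xi> \<Longrightarrow> h a = 1" "\<And>a. a \<notin> units G \<Longrightarrow> h a = 0"
      by (rule unit_bump[of "rng G ` supp \<xi>"]) auto
    have "conv G h \<xi> = \<xi>"
    proof
      fix c show "conv G h \<xi> c = \<xi> c"
        using h(2)[of "rng G c"] zero_outside_supp[of c \<xi>]
        by (cases "c \<in> supp \<xi>") (simp_all add: conv_unit_left[OF h(3)])
    qed
    then have "T \<xi> = right_op G \<xi> (T h)"
      using equiv \<xi> Cc_L2[OF h(1)] right_op_apply[OF Cc_L2[OF h(1)], of \<xi>]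
      unfolding equivariant_def by metis
    also have "\<dots> = conv G (T h) \<xi>"
      by (rule right_op_apply[OF adjointable_L2[OF T Cc_L2[OF h(1)]]])
    also have "\<dots> = conv G f \<xi>"
    proof
      fix c
      show "conv G (T h) \<xi> c = conv G f \<xi> c" unfolding conv_def
      proof (rule infsum_cong)
        fix a assume "a \<in> fiber G (src G c)"
        \<comment> \<open>T h is evaluated at an arrow whose source is the range of a, and h equals
          1 there whenever a lies in \<open>supp \<xi>\<close>.\<close>
        then have "src G (comp G c (ginv G a)) = rng G a" by (simp add: fiber_def src_quotient)
        then show "T h (comp G c (ginv G a)) * \<xi> a = f (comp G c (ginv G a)) * \<xi> a"
          using h(2)[of "rng G a"] zero_outside_supp[of a \<xi>]
          by (cases "a \<in> supp \<xi>") (simp_all add: f(2)[OF h(1,3)])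
      qed
    qed
    finally show "T \<xi> = left_reg G f \<xi>" by (simp add: left_reg_apply Cc_L2[OF \<xi>])
  qed
  then show ?thesis using fCc by blast
qed

lemma compactly_supported_iff:
  assumes "T \<in> adjointable G" "equivariant G T"
  shows "compactly_supported G T \<longleftrightarrow> T \<in> left_reg G ` Cc"
  using assms equivariant_compactly_supported_imp_left_reg left_reg_compactly_supported by blast

lemma equivariant_compactly_supported_eq:
  "{T \<in> adjointable G. equivariant G T \<and> compactly_supported G T} = left_reg G ` Cc"
  using compactly_supported_iff left_reg_adjointable left_reg_equivariant left_reg_compactly_supported
  by blast

section \<open>The reduced algebra as a norm closure\<close>

lemma reduced_norm_diff:
  "f \<in> Cc \<Longrightarrow> g \<in> Cc \<Longrightarrow>
    reduced_norm G (\<lambda>a. f a - g a) = op_norm G (op_diff G (left_reg G f) (left_reg G g))"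
  unfolding reduced_norm_def by (simp add: left_reg_diff)

lemma op_norm_diff_self: "T \<in> adjointable G \<Longrightarrow> op_norm G (op_diff G T T) = 0"
proof (rule antisym)
  assume T: "T \<in> adjointable G"
  show "op_norm G (op_diff G T T) \<le> 0"
    by (rule op_norm_le) (auto simp: op_le_def op_diff_def l2_le_zero)
  show "0 \<le> op_norm G (op_diff G T T)" by (intro op_norm_nonneg op_diff_adjointable T)
qed

text \<open>Resolves the definite description. The triangle inequality carries the limit along F to
  every equivalent sequence, and F itself belongs to its class, which forces any other candidate to
  agree with T.\<close>

lemma left_reg_ext_eq:
  assumes F: "F \<in> reduced_Cauchy G" and T: "T \<in> adjointable G"
    and lim: "(\<lambda>n. op_norm G (op_diff G T (left_reg G (F n)))) \<longlonglongrightarrow> 0"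
  shows "left_reg_ext G (reduced_equiv G `` {F}) = T"
  unfolding left_reg_ext_def
proof (rule the_equality)
  have FCc: "F n \<in> Cc" for n using F by (simp add: reduced_Cauchy_def)
  show "T \<in> adjointable G \<and> (\<forall>E\<in>reduced_equiv G `` {F}.
      (\<lambda>n. op_norm G (op_diff G T (left_reg G (E n)))) \<longlonglongrightarrow> 0)"
  proof (intro conjI T ballI)
    fix E assume "E \<in> reduced_equiv G `` {F}"
    then have E: "\<And>n. E n \<in> Cc" and EF: "(\<lambda>n. reduced_norm G (\<lambda>a. F n a - E n a)) \<longlonglongrightarrow> 0"
      by (auto simp: reduced_equiv_def reduced_Cauchy_def)
    show "(\<lambda>n. op_norm G (op_diff G T (left_reg G (E n)))) \<longlonglongrightarrow> 0"
    proof (rule tendsto_sandwich[OF _ _ tendsto_const])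
      show "\<forall>\<^sub>F n in sequentially. 0 \<le> op_norm G (op_diff G T (left_reg G (E n)))"
        by (intro always_eventually allI op_norm_nonneg op_diff_adjointable T left_reg_adjointable E)
      show "\<forall>\<^sub>F n in sequentially. op_norm G (op_diff G T (left_reg G (E n))) \<le>
          op_norm G (op_diff G T (left_reg G (F n))) + reduced_norm G (\<lambda>a. F n a - E n a)"
        by (intro always_eventually allI)
          (simp add: reduced_norm_diff FCc E op_norm_triangle T left_reg_adjointable)
      show "(\<lambda>n. op_norm G (op_diff G T (left_reg G (F n))) + reduced_norm G (\<lambda>a. F n a - E n a)) \<longlonglongrightarrow> 0"
        using tendsto_add[OF lim EF] by simp
    qed
  qed
  have FF: "F \<in> reduced_equiv G `` {F}"
  proof -
    have "reduced_norm G (\<lambda>a. F n a - F n a) = 0" for n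
      unfolding reduced_norm_diff[OF FCc FCc] by (rule op_norm_diff_self[OF left_reg_adjointable[OF FCc]])
    then show ?thesis using F by (simp add: reduced_equiv_def)
  qed
  fix S assume "S \<in> adjointable G \<and> (\<forall>E\<in>reduced_equiv G `` {F}.
      (\<lambda>n. op_norm G (op_diff G S (left_reg G (E n)))) \<longlonglongrightarrow> 0)"
  then have S: "S \<in> adjointable G" and limS: "(\<lambda>n. op_norm G (op_diff G S (left_reg G (F n)))) \<longlonglongrightarrow> 0"
    using FF by auto
  have "op_norm G (op_diff G S T) \<le> 0"
  proof (rule tendsto_lowerbound)
    show "(\<lambda>n. op_norm G (op_diff G S (left_reg G (F n))) + op_norm G (op_diff G T (left_reg G (F n)))) \<longlonglongrightarrow> 0"
      using tendsto_add[OF limS lim] by simp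
    show "\<forall>\<^sub>F n in sequentially. op_norm G (op_diff G S T) \<le>
        op_norm G (op_diff G S (left_reg G (F n))) + op_norm G (op_diff G T (left_reg G (F n)))"
      using op_norm_triangle[OF S left_reg_adjointable[OF FCc] T]
      by (simp add: op_norm_commute[OF T left_reg_adjointable[OF FCc]])
  qed simp
  then show "S = T" by (rule op_norm_diff_zero[OF S T])
qed

text \<open>A Cauchy sequence has an operator limit by \<open>adjointable_complete\<close>, and this
  limit is the value of the extension. Conversely, approximants of T with errors below 1/(n+1) form
  a Cauchy sequence for the reduced norm, and its class is sent to T.\<close>

lemma left_reg_ext_image: "left_reg_ext G ` reduced_Cstar G = norm_closure G (left_reg G ` Cc)"
proof (intro subset_antisym subsetI)
  fix T assume "T \<in> left_reg_ext G ` reduced_Cstar G"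
  then obtain F where F: "F \<in> reduced_Cauchy G" and TF: "T = left_reg_ext G (reduced_equiv G `` {F})"
    unfolding reduced_Cstar_def by (auto elim!: quotientE)
  then have FCc: "F n \<in> Cc" for n by (simp add: reduced_Cauchy_def)
  obtain R where R: "R \<in> adjointable G" "(\<lambda>n. op_norm G (op_diff G R (left_reg G (F n)))) \<longlonglongrightarrow> 0"
  proof (rule adjointable_complete[of "\<lambda>n. left_reg G (F n)"])
    show "\<exists>N. \<forall>m\<ge>N. \<forall>n\<ge>N. op_norm G (op_diff G (left_reg G (F m)) (left_reg G (F n))) < \<epsilon>"
      if "\<epsilon> > 0" for \<epsilon>
      using F that unfolding reduced_Cauchy_def by (simp add: reduced_norm_diff[OF FCc FCc])
  qed (auto simp: left_reg_adjointable FCc)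
  have TR: "T = R" unfolding TF by (rule left_reg_ext_eq[OF F R])
  show "T \<in> norm_closure G (left_reg G ` Cc)" unfolding norm_closure_def TR
  proof (intro CollectI conjI R allI impI)
    fix \<epsilon> :: real assume "\<epsilon> > 0"
    then obtain n where "op_norm G (op_diff G R (left_reg G (F n))) < \<epsilon>"
      using order_tendstoD(2)[OF R(2)] eventually_happens'[OF sequentially_bot] by blast
    then show "\<exists>S\<in>left_reg G ` Cc. op_norm G (op_diff G R S) < \<epsilon>" using FCc by blast
  qed
next
  fix T assume "T \<in> norm_closure G (left_reg G ` Cc)"
  then have T: "T \<in> adjointable G" and "\<And>\<epsilon>. \<epsilon> > 0 \<Longrightarrow> \<exists>f\<in>Cc. op_norm G (op_diff G T (left_reg G f)) < \<epsilon>"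
    unfolding norm_closure_def by auto
  then have "\<exists>f\<in>Cc. op_norm G (op_diff G T (left_reg G f)) < inverse (real (Suc n))" for n by simp
  then obtain F where F: "\<And>n. F n \<in> Cc" "\<And>n. op_norm G (op_diff G T (left_reg G (F n))) < inverse (real (Suc n))"
    by metis
  have lim: "(\<lambda>n. op_norm G (op_diff G T (left_reg G (F n)))) \<longlonglongrightarrow> 0"
  proof (rule tendsto_sandwich[OF _ _ tendsto_const LIMSEQ_inverse_real_of_nat])
    show "\<forall>\<^sub>F n in sequentially. 0 \<le> op_norm G (op_diff G T (left_reg G (F n)))"
      by (intro always_eventually allI op_norm_nonneg op_diff_adjointable T left_reg_adjointable F)
    show "\<forall>\<^sub>F n in sequentially. op_norm G (op_diff G T (left_reg G (F n))) \<le> inverse (real (Suc n))"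
      by (intro always_eventually allI less_imp_le F)
  qed
  have "F \<in> reduced_Cauchy G" unfolding reduced_Cauchy_def
  proof (intro CollectI conjI allI impI F)
    fix \<epsilon> :: real assume "\<epsilon> > 0"
    then have "\<forall>\<^sub>F n in sequentially. op_norm G (op_diff G T (left_reg G (F n))) < \<epsilon> / 2"
      by (intro order_tendstoD(2)[OF lim]) simp
    then obtain N where N: "\<And>n. n \<ge> N \<Longrightarrow> op_norm G (op_diff G T (left_reg G (F n))) < \<epsilon> / 2"
      unfolding eventually_sequentially by blast
    have "reduced_norm G (\<lambda>a. F m a - F n a) < \<epsilon>" if "m \<ge> N" "n \<ge> N" for m n
      using op_norm_triangle[OF left_reg_adjointable[OF F(1)] T left_reg_adjointable[OF F(1)], of m n]
        N[OF that(1)] N[OF that(2)] op_norm_commute[OF left_reg_adjointable[OF F(1)] T, of m]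
      by (simp add: reduced_norm_diff F)
    then show "\<exists>N. \<forall>m\<ge>N. \<forall>n\<ge>N. reduced_norm G (\<lambda>a. F m a - F n a) < \<epsilon>" by blast
  qed
  then have "reduced_equiv G `` {F} \<in> reduced_Cstar G" "left_reg_ext G (reduced_equiv G `` {F}) = T"
    using left_reg_ext_eq[OF _ T lim] by (simp_all add: reduced_Cstar_def quotientI)
  then show "T \<in> left_reg_ext G ` reduced_Cstar G" by blast
qed

end

theorem propositionD:
  fixes G :: "'g::t2_space groupoid"
  assumes "etale_groupoid G"
  shows "(\<forall>T\<in>adjointable G. equivariant G T \<longrightarrow>
            (compactly_supported G T \<longleftrightarrow> T \<in> left_reg G ` Cc)) \<and>
         left_reg_ext G ` reduced_Cstar G =
           norm_closure G {T \<in> adjointable G. equivariant G T \<and> compactly_supported G T}"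
proof -
  interpret etale_groupoid G by fact
  show ?thesis
    unfolding equivariant_compactly_supported_eq
    using compactly_supported_iff left_reg_ext_image by blast
qed

end
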